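(* Let $\mathcal K$ be a flag simplicial complex on the vertex set $[m]$. There is a surjective homomorphism of graded Lie algebras $$\psi:N_{\mathcal K}[t]\to L'(\mathrm{RC}_{\mathcal K}),\qquad \psi(xt^k):=h^k(\varphi'(x)),\quad x\in N_{\mathcal K},\ k\ge0.$$
   Context: $[m]=\{1,\dots,m\}$; simplicial complexes on $[m]$ contain $\varnothing$ and all singletons; $\mathcal K$ is flag if every set of pairwise adjacent vertices is a simplex. $\mathbb Z_2$ is the field with two elements. For $J\subset[m]$, $\mathcal K_J=\{I\in\mathcal K: I\subset J\}$. The right-angled Coxeter group is $\mathrm{RC}_{\mathcal K}=\langle g_1,\dots,g_m\mid g_i^2=1,\ g_ig_j=g_jg_i \text{ for }\{i,j\}\in\mathcal K\rangle$. For a group $G$: $(a,b)=a^{-1}b^{-1}ab$, $\gamma_1(G)=G$, $\gamma_{k+1}(G)=(\gamma_k(G),G)$, $L_k(G)=\gamma_k(G)/\gamma_{k+1}(G)$, $L(G)=\bigoplus_{k\ge1}L_k(G)$ with bracket $[\overline a,\overline b]=\overline{(a,b)}$; $L'(G)=\bigoplus_{k\ge2}L_k(G)$ is its commutator subalgebra. $L(\mathrm{RC}_{\mathcal K})$ is a Lie algebra over $\mathbb Z_2$; $\overline g_i\in L_1(\mathrm{RC}_{\mathcal K})$ is the class of $g_i$. The map $h:L'(\mathrm{RC}_{\mathcal K})\to L'(\mathrm{RC}_{\mathcal K})$ is the (well-defined, linear) map sending $a\gamma_{k+1}\in L_k$ to $a^2\gamma_{k+2}\in L_{k+1}$ for $k\ge2$,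 where $\gamma_k=\gamma_k(\mathrm{RC}_{\mathcal K})$. The graph Lie algebra is $L_{\mathcal K}=\mathrm{FL}_{\mathbb Z_2}(\mu_1,\dots,\mu_m)/([\mu_i,\mu_j]=0\text{ for }\{i,j\}\in\mathcal K)$, where $\mathrm{FL}_{\mathbb Z_2}$ is the free Lie algebra over $\mathbb Z_2$ and $\deg\mu_i=1$. There is an epimorphism of Lie algebras $\varphi:L_{\mathcal K}\to L(\mathrm{RC}_{\mathcal K})$, $\varphi(\mu_i)=\overline g_i$. For elements $q_1,\dots,q_m$ of a Lie algebra, $I=\{t_1<\dots<t_s\}\subset[m]$ and an element $x$, put $c_q(I,x)=[q_{t_1},[q_{t_2},\dots[q_{t_s},x]\dots]]$. For $J\subset[m]$ let $\Theta_{\mathcal K}(J)\subset J$ be the set of all $j\in J$ such that $j$ is the smallest vertex of its connected component of $\mathcal K_J$, and $j$ and $\max(J)$ lie in different connected components of $\mathcal K_J$. The set of GPTW generators is $\mathrm{GPTW}=\{c_\mu(J\setminus\{j\},\mu_j): J\subset[m],\ j\in\Theta_{\mathcal K}(J)\}\subset L_{\mathcal K}$, and $N_{\mathcal K}\subset L_{\mathcal K}$ is the Lie subalgebra generated by $\mathrm{GPTW}$. One has $N_{\mathcal K}\subset L'_{\mathcal K}=[L_{\mathcal K},L_{\mathcal K}]$, and $\varphi':N_{\mathcal K}\to L'(\mathrm{RC}_{\mathcal K})$ is the restriction of $\varphi$. For a graded Lie algebra $\mathfrak g=\bigoplus_n\mathfrak g_n$, $\mathfrak g[t]=\bigoplus_{k\ge0}\mathfrak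 g t^k$ is the graded Lie algebra with $\deg(xt^k)=n+k$ for $x\in\mathfrak g_n$ and $[xt^k,yt^\ell]=[x,y]t^{k+\ell}$. *)

theory Defs
  imports "HOL-Algebra.Algebra" "HOL-Number_Theory.Residues"
begin

section \<open>Lie algebras over a commutative ring\<close>

text \<open>
  A Lie algebra over \<open>R\<close> is carried by a HOL-Algebra \<open>module\<close> record \<open>L\<close>. That record already has a
  multiplication, about which the locale \<^locale>\<open>module\<close> assumes nothing: it is the Lie bracket, so
  \<open>x \<otimes>\<^bsub>L\<^esub> y\<close> is read \<open>[x, y]\<close>. The field \<open>one\<close> has no meaning and is left undefined.
\<close>

locale lie_algebra = module R L for R (structure) and L (structure) +
  assumes bracket_closed:
      "\<lbrakk>x \<in> carrier L; y \<in> carrier L\<rbrakk> \<Longrightarrow> x \<otimes>\<^bsub>L\<^esub> y \<in> carrier L"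
    and bracket_add_left:
      "\<lbrakk>x \<in> carrier L; y \<in> carrier L; z \<in> carrier L\<rbrakk> \<Longrightarrow>
        (x \<oplus>\<^bsub>L\<^esub> y) \<otimes>\<^bsub>L\<^esub> z = x \<otimes>\<^bsub>L\<^esub> z \<oplus>\<^bsub>L\<^esub> y \<otimes>\<^bsub>L\<^esub> z"
    and bracket_add_right:
      "\<lbrakk>x \<in> carrier L; y \<in> carrier L; z \<in> carrier L\<rbrakk> \<Longrightarrow>
        x \<otimes>\<^bsub>L\<^esub> (y \<oplus>\<^bsub>L\<^esub> z) = x \<otimes>\<^bsub>L\<^esub> y \<oplus>\<^bsub>L\<^esub> x \<otimes>\<^bsub>L\<^esub> z"
    and bracket_smult_left:
      "\<lbrakk>r \<in> carrier R; x \<in> carrier L; y \<in> carrier L\<rbrakk> \<Longrightarrow>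
        (r \<odot>\<^bsub>L\<^esub> x) \<otimes>\<^bsub>L\<^esub> y = r \<odot>\<^bsub>L\<^esub> (x \<otimes>\<^bsub>L\<^esub> y)"
    and bracket_smult_right:
      "\<lbrakk>r \<in> carrier R; x \<in> carrier L; y \<in> carrier L\<rbrakk> \<Longrightarrow>
        x \<otimes>\<^bsub>L\<^esub> (r \<odot>\<^bsub>L\<^esub> y) = r \<odot>\<^bsub>L\<^esub> (x \<otimes>\<^bsub>L\<^esub> y)"
    and bracket_self:
      "x \<in> carrier L \<Longrightarrow> x \<otimes>\<^bsub>L\<^esub> x = \<zero>\<^bsub>L\<^esub>"
    and jacobi:
      "\<lbrakk>x \<in> carrier L; y \<in> carrier L; z \<in> carrier L\<rbrakk> \<Longrightarrow>
        x \<otimes>\<^bsub>L\<^esub> (y \<otimes>\<^bsub>L\<^esub> z) \<oplus>\<^bsub>L\<^esub> y \<otimes>\<^bsub>L\<^esub> (z \<otimes>\<^bsub>L\<^esub> x) \<oplus>\<^bsub>L\<^esub> z \<otimes>\<^bsub>L\<^esub> (x \<otimes>\<^bsub>L\<^esub> y) = \<zero>\<^bsub>L\<^esub>"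

locale lie_algebra_hom =
  dom: lie_algebra R A + cod: lie_algebra R B
  for R (structure) and A (structure) and B (structure) +
  fixes f
  assumes hom_closed: "x \<in> carrier A \<Longrightarrow> f x \<in> carrier B"
    and hom_add:
      "\<lbrakk>x \<in> carrier A; y \<in> carrier A\<rbrakk> \<Longrightarrow> f (x \<oplus>\<^bsub>A\<^esub> y) = f x \<oplus>\<^bsub>B\<^esub> f y"
    and hom_smult:
      "\<lbrakk>r \<in> carrier R; x \<in> carrier A\<rbrakk> \<Longrightarrow> f (r \<odot>\<^bsub>A\<^esub> x) = r \<odot>\<^bsub>B\<^esub> f x"
    and hom_bracket:
      "\<lbrakk>x \<in> carrier A; y \<in> carrier A\<rbrakk> \<Longrightarrow> f (x \<otimes>\<^bsub>A\<^esub> y) = f x \<otimes>\<^bsub>B\<^esub> f y"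

text \<open>\<open>D n\<close> is the homogeneous component of degree \<open>n\<close>; the last axiom says \<open>L = \<Oplus>\<^sub>n D n\<close>.\<close>

locale graded_lie_algebra = lie_algebra R L for R (structure) and L (structure) +
  fixes D :: "nat \<Rightarrow> _ set"
  assumes component_submodule: "submodule (D n) R L"
    and component_bracket: "\<lbrakk>x \<in> D i; y \<in> D j\<rbrakk> \<Longrightarrow> x \<otimes>\<^bsub>L\<^esub> y \<in> D (i + j)"
    and decomposition:
      "x \<in> carrier L \<Longrightarrow>
        \<exists>!c. (\<forall>n. c n \<in> D n) \<and> finite {n. c n \<noteq> \<zero>\<^bsub>L\<^esub>} \<and> x = (\<Oplus>\<^bsub>L\<^esub>n\<in>{n. c n \<noteq> \<zero>\<^bsub>L\<^esub>}. c n)"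

locale graded_lie_algebra_hom =
  lie_algebra_hom R A B f + gr_dom: graded_lie_algebra R A D + gr_cod: graded_lie_algebra R B E
  for R (structure) and A (structure) and D and B (structure) and E and f +
  assumes hom_degree: "x \<in> D n \<Longrightarrow> f x \<in> E n"

definition lie_subalgebra where
  "lie_subalgebra R L H \<longleftrightarrow>
    submodule H R L \<and> (\<forall>x\<in>H. \<forall>y\<in>H. x \<otimes>\<^bsub>L\<^esub> y \<in> H)"

definition subalgebra_generated where
  "subalgebra_generated R L S = L\<lparr>carrier := \<Inter>{H. lie_subalgebra R L H \<and> S \<subseteq> H}\<rparr>"

definition lie_ideal where
  "lie_ideal R L I \<longleftrightarrow>
    submodule I R L \<and> (\<forall>x\<in>carrier L. \<forall>y\<in>I. x \<otimes>\<^bsub>L\<^esub> y \<in> I)"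

definition lie_ideal_generated where
  "lie_ideal_generated R L S = \<Inter>{I. lie_ideal R L I \<and> S \<subseteq> I}"

definition lie_quotient :: "('r, 'a, 'm) module_scheme \<Rightarrow> 'a set \<Rightarrow> ('r, 'a set) module" where
  "lie_quotient L I =
    \<lparr>carrier = a_rcosets\<^bsub>L\<^esub> I,
     monoid.mult = rcoset_mult L I,
     one = undefined,
     ring.zero = I,
     ring.add = set_add L,
     smult = (\<lambda>r A. \<Union>a\<in>A. I +>\<^bsub>L\<^esub> (r \<odot>\<^bsub>L\<^esub> a))\<rparr>"

text \<open>\<open>L[t]\<close>: the constructor \<^const>\<open>UP\<close> of univariate polynomials supplies everything except the
  scalar multiplication, which there is by coefficients from \<open>L\<close> and here is by \<open>R\<close>.
  The element \<open>x t\<^sup>k\<close> is \<open>monom (UP L) x k\<close>.\<close>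

definition lie_poly :: "('r, 'a, 'm) module_scheme \<Rightarrow> ('r, nat \<Rightarrow> 'a) module" where
  "lie_poly L =
    \<lparr>carrier = carrier (UP L),
     monoid.mult = monoid.mult (UP L),
     one = undefined,
     ring.zero = ring.zero (UP L),
     ring.add = ring.add (UP L),
     smult = (\<lambda>r p n. r \<odot>\<^bsub>L\<^esub> p n)\<rparr>"

text \<open>Degree in \<open>L[t]\<close>, where \<open>deg (x t\<^sup>k) = deg x + k\<close>.\<close>

definition lie_poly_component ::
    "('r, 'a, 'm) module_scheme \<Rightarrow> (nat \<Rightarrow> 'a set) \<Rightarrow> nat \<Rightarrow> (nat \<Rightarrow> 'a) set" where
  "lie_poly_component L D n =
    {p \<in> carrier (lie_poly L). \<forall>k. if k \<le> n then p k \<in> D (n - k) else p k = \<zero>\<^bsub>L\<^esub>}"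

text \<open>Grading of a Lie algebra generated by \<open>V\<close> in which the elements of \<open>V\<close> have degree 1:
  component \<open>n\<close> is spanned by the \<open>n\<close>-fold bracketings of elements of \<open>V\<close>.\<close>

inductive homogeneous :: "('r, 'q) ring_scheme \<Rightarrow> ('r, 'a, 'm) module_scheme \<Rightarrow> 'a set \<Rightarrow>
    nat \<Rightarrow> 'a \<Rightarrow> bool"
  for R L V where
  gen: "x \<in> V \<Longrightarrow> homogeneous R L V 1 x"
| zero: "homogeneous R L V n (\<zero>\<^bsub>L\<^esub>)"
| add: "\<lbrakk>homogeneous R L V n x; homogeneous R L V n y\<rbrakk> \<Longrightarrow> homogeneous R L V n (x \<oplus>\<^bsub>L\<^esub> y)"
| smult: "\<lbrakk>r \<in> carrier R; homogeneous R L V n x\<rbrakk> \<Longrightarrow> homogeneous R L V n (r \<odot>\<^bsub>L\<^esub> x)"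
| bracket: "\<lbrakk>homogeneous R L V i x; homogeneous R L V j y\<rbrakk> \<Longrightarrow>
    homogeneous R L V (i + j) (x \<otimes>\<^bsub>L\<^esub> y)"


section \<open>Free Lie algebras\<close>

text \<open>The free Lie algebra over \<open>R\<close> on a set \<open>V\<close>: formal Lie expressions in \<open>V\<close> modulo the smallest
  congruence containing the \<open>R\<close>-module and Lie algebra identities.\<close>

datatype ('r, 'x) lie_term =
    Gen 'x
  | Zero
  | Add "('r, 'x) lie_term" "('r, 'x) lie_term"
  | Smult 'r "('r, 'x) lie_term"
  | Bracket "('r, 'x) lie_term" "('r, 'x) lie_term"

inductive_set lie_terms :: "('r, 'q) ring_scheme \<Rightarrow> 'x set \<Rightarrow> ('r, 'x) lie_term set"
  for R V where
  "x \<in> V \<Longrightarrow> Gen x \<in> lie_terms R V"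
| "Zero \<in> lie_terms R V"
| "\<lbrakk>a \<in> lie_terms R V; b \<in> lie_terms R V\<rbrakk> \<Longrightarrow> Add a b \<in> lie_terms R V"
| "\<lbrakk>r \<in> carrier R; a \<in> lie_terms R V\<rbrakk> \<Longrightarrow> Smult r a \<in> lie_terms R V"
| "\<lbrakk>a \<in> lie_terms R V; b \<in> lie_terms R V\<rbrakk> \<Longrightarrow> Bracket a b \<in> lie_terms R V"

inductive lie_eq :: "('r, 'q) ring_scheme \<Rightarrow> 'x set \<Rightarrow>
    ('r, 'x) lie_term \<Rightarrow> ('r, 'x) lie_term \<Rightarrow> bool"
  for R V where
  refl: "a \<in> lie_terms R V \<Longrightarrow> lie_eq R V a a"
| sym: "lie_eq R V a b \<Longrightarrow> lie_eq R V b a"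
| trans: "\<lbrakk>lie_eq R V a b; lie_eq R V b c\<rbrakk> \<Longrightarrow> lie_eq R V a c"
| add_cong: "\<lbrakk>lie_eq R V a a'; lie_eq R V b b'\<rbrakk> \<Longrightarrow> lie_eq R V (Add a b) (Add a' b')"
| smult_cong: "\<lbrakk>r \<in> carrier R; lie_eq R V a a'\<rbrakk> \<Longrightarrow> lie_eq R V (Smult r a) (Smult r a')"
| bracket_cong: "\<lbrakk>lie_eq R V a a'; lie_eq R V b b'\<rbrakk> \<Longrightarrow>
    lie_eq R V (Bracket a b) (Bracket a' b')"
| add_assoc: "\<lbrakk>a \<in> lie_terms R V; b \<in> lie_terms R V; c \<in> lie_terms R V\<rbrakk> \<Longrightarrow>
    lie_eq R V (Add (Add a b) c) (Add a (Add b c))"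
| add_comm: "\<lbrakk>a \<in> lie_terms R V; b \<in> lie_terms R V\<rbrakk> \<Longrightarrow> lie_eq R V (Add a b) (Add b a)"
| add_zero: "a \<in> lie_terms R V \<Longrightarrow> lie_eq R V (Add Zero a) a"
| smult_zero: "a \<in> lie_terms R V \<Longrightarrow> lie_eq R V (Smult \<zero>\<^bsub>R\<^esub> a) Zero"
| smult_one: "a \<in> lie_terms R V \<Longrightarrow> lie_eq R V (Smult \<one>\<^bsub>R\<^esub> a) a"
| smult_assoc: "\<lbrakk>r \<in> carrier R; s \<in> carrier R; a \<in> lie_terms R V\<rbrakk> \<Longrightarrow>
    lie_eq R V (Smult (r \<otimes>\<^bsub>R\<^esub> s) a) (Smult r (Smult s a))"
| smult_add_left: "\<lbrakk>r \<in> carrier R; s \<in> carrier R; a \<in> lie_terms R V\<rbrakk> \<Longrightarrow>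
    lie_eq R V (Smult (r \<oplus>\<^bsub>R\<^esub> s) a) (Add (Smult r a) (Smult s a))"
| smult_add_right: "\<lbrakk>r \<in> carrier R; a \<in> lie_terms R V; b \<in> lie_terms R V\<rbrakk> \<Longrightarrow>
    lie_eq R V (Smult r (Add a b)) (Add (Smult r a) (Smult r b))"
| bracket_add_left: "\<lbrakk>a \<in> lie_terms R V; b \<in> lie_terms R V; c \<in> lie_terms R V\<rbrakk> \<Longrightarrow>
    lie_eq R V (Bracket (Add a b) c) (Add (Bracket a c) (Bracket b c))"
| bracket_add_right: "\<lbrakk>a \<in> lie_terms R V; b \<in> lie_terms R V; c \<in> lie_terms R V\<rbrakk> \<Longrightarrow>
    lie_eq R V (Bracket a (Add b c)) (Add (Bracket a b) (Bracket a c))"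
| bracket_smult_left: "\<lbrakk>r \<in> carrier R; a \<in> lie_terms R V; b \<in> lie_terms R V\<rbrakk> \<Longrightarrow>
    lie_eq R V (Bracket (Smult r a) b) (Smult r (Bracket a b))"
| bracket_smult_right: "\<lbrakk>r \<in> carrier R; a \<in> lie_terms R V; b \<in> lie_terms R V\<rbrakk> \<Longrightarrow>
    lie_eq R V (Bracket a (Smult r b)) (Smult r (Bracket a b))"
| bracket_self: "a \<in> lie_terms R V \<Longrightarrow> lie_eq R V (Bracket a a) Zero"
| jacobi: "\<lbrakk>a \<in> lie_terms R V; b \<in> lie_terms R V; c \<in> lie_terms R V\<rbrakk> \<Longrightarrow>
    lie_eq R V (Add (Add (Bracket a (Bracket b c)) (Bracket b (Bracket c a)))
      (Bracket c (Bracket a b))) Zero"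

definition lie_class :: "('r, 'q) ring_scheme \<Rightarrow> 'x set \<Rightarrow>
    ('r, 'x) lie_term \<Rightarrow> ('r, 'x) lie_term set" where
  "lie_class R V a = {b. lie_eq R V a b}"

definition free_lie :: "('r, 'q) ring_scheme \<Rightarrow> 'x set \<Rightarrow> ('r, ('r, 'x) lie_term set) module" where
  "free_lie R V =
    \<lparr>carrier = lie_class R V ` lie_terms R V,
     monoid.mult = (\<lambda>A B. \<Union>a\<in>A. \<Union>b\<in>B. lie_class R V (Bracket a b)),
     one = undefined,
     ring.zero = lie_class R V Zero,
     ring.add = (\<lambda>A B. \<Union>a\<in>A. \<Union>b\<in>B. lie_class R V (Add a b)),
     smult = (\<lambda>r A. \<Union>a\<in>A. lie_class R V (Smult r a))\<rparr>"

definition free_lie_gen :: "('r, 'q) ring_scheme \<Rightarrow> 'x set \<Rightarrow> 'x \<Rightarrow> ('r, 'x) lie_term set" where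
  "free_lie_gen R V x = lie_class R V (Gen x)"


section \<open>Groups given by generators and relations\<close>

text \<open>Words over the generators \<open>S\<close> and their formal inverses: the letter \<open>(a, True)\<close> stands for \<open>a\<close>
  and \<open>(a, False)\<close> for its inverse. A pair \<open>(r, s)\<close> in \<open>E\<close> is the defining relation \<open>r = s\<close>.\<close>

type_synonym 'a word = "('a \<times> bool) list"

definition words :: "'a set \<Rightarrow> 'a word set" where
  "words S = lists (S \<times> UNIV)"

inductive word_eq :: "'a set \<Rightarrow> ('a word \<times> 'a word) set \<Rightarrow> 'a word \<Rightarrow> 'a word \<Rightarrow> bool"
  for S E where
  refl: "w \<in> words S \<Longrightarrow> word_eq S E w w"
| sym: "word_eq S E v w \<Longrightarrow> word_eq S E w v"
| trans: "\<lbrakk>word_eq S E u v; word_eq S E v w\<rbrakk> \<Longrightarrow> word_eq S E u w"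
| cancel: "\<lbrakk>u \<in> words S; v \<in> words S; a \<in> S\<rbrakk> \<Longrightarrow>
    word_eq S E (u @ [(a, b), (a, \<not> b)] @ v) (u @ v)"
| relation: "\<lbrakk>u \<in> words S; v \<in> words S; r \<in> words S; s \<in> words S; (r, s) \<in> E\<rbrakk> \<Longrightarrow>
    word_eq S E (u @ r @ v) (u @ s @ v)"

definition word_class :: "'a set \<Rightarrow> ('a word \<times> 'a word) set \<Rightarrow> 'a word \<Rightarrow> 'a word set" where
  "word_class S E w = {v. word_eq S E w v}"

definition presented_group :: "'a set \<Rightarrow> ('a word \<times> 'a word) set \<Rightarrow> 'a word set monoid" where
  "presented_group S E =
    \<lparr>carrier = word_class S E ` words S,
     monoid.mult = (\<lambda>A B. \<Union>u\<in>A. \<Union>v\<in>B. word_class S E (u @ v)),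
     one = word_class S E []\<rparr>"


section \<open>The Lie algebra of the lower central series\<close>

definition group_commutator :: "('a, 'b) monoid_scheme \<Rightarrow> 'a \<Rightarrow> 'a \<Rightarrow> 'a" where
  "group_commutator G a b = inv\<^bsub>G\<^esub> a \<otimes>\<^bsub>G\<^esub> inv\<^bsub>G\<^esub> b \<otimes>\<^bsub>G\<^esub> a \<otimes>\<^bsub>G\<^esub> b"

text \<open>The series starts at index 1; the value at 0 is irrelevant.\<close>

fun lower_central :: "('a, 'b) monoid_scheme \<Rightarrow> nat \<Rightarrow> 'a set" where
  "lower_central G 0 = carrier G"
| "lower_central G (Suc 0) = carrier G"
| "lower_central G (Suc (Suc k)) =
    generate G {group_commutator G a b | a b. a \<in> lower_central G (Suc k) \<and> b \<in> carrier G}"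

definition lcs_quotient :: "('a, 'b) monoid_scheme \<Rightarrow> nat \<Rightarrow> 'a set monoid" where
  "lcs_quotient G k =
    (G\<lparr>carrier := lower_central G k\<rparr>) Mod lower_central G (Suc k)"

definition lcs_bracket :: "('a, 'b) monoid_scheme \<Rightarrow> nat \<Rightarrow> nat \<Rightarrow> 'a set \<Rightarrow> 'a set \<Rightarrow> 'a set" where
  "lcs_bracket G i j A B =
    (\<Union>a\<in>A. \<Union>b\<in>B. lower_central G (Suc (i + j)) #>\<^bsub>G\<^esub> group_commutator G a b)"

text \<open>\<open>L(G)\<close>, as a set of finitely supported families \<open>x\<close> with \<open>x k \<in> L\<^sub>k(G)\<close> for \<open>k \<ge> 1\<close>. The integer
  scalar \<open>r\<close> acts as the \<open>r\<close>-th multiple (a power in the multiplicatively written \<open>L\<^sub>k(G)\<close>); when all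
  \<open>L\<^sub>k(G)\<close> have exponent 2, restricting it to \<open>{0, 1}\<close> is the action of \<open>residue_ring 2\<close>.\<close>

definition lcs_lie :: "('a, 'b) monoid_scheme \<Rightarrow> (int, nat \<Rightarrow> 'a set) module" where
  "lcs_lie G =
    \<lparr>carrier = carrier (sum_group {1..} (lcs_quotient G)),
     monoid.mult = (\<lambda>x y. \<lambda>n\<in>{1..}.
        finprod (lcs_quotient G n) (\<lambda>i. lcs_bracket G i (n - i) (x i) (y (n - i))) {1..<n}),
     one = undefined,
     ring.zero = \<one>\<^bsub>sum_group {1..} (lcs_quotient G)\<^esub>,
     ring.add = monoid.mult (sum_group {1..} (lcs_quotient G)),
     smult = (\<lambda>r x. \<lambda>n\<in>{1..}. x n [^]\<^bsub>lcs_quotient G n\<^esub> r)\<rparr>"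

text \<open>The class of \<open>a \<in> \<gamma>\<^sub>k(G)\<close> in the summand \<open>L\<^sub>k(G)\<close>.\<close>

definition lcs_class :: "('a, 'b) monoid_scheme \<Rightarrow> nat \<Rightarrow> 'a \<Rightarrow> nat \<Rightarrow> 'a set" where
  "lcs_class G k a = (\<lambda>n\<in>{1..}.
    if n = k then lower_central G (Suc k) #>\<^bsub>G\<^esub> a else \<one>\<^bsub>lcs_quotient G n\<^esub>)"

definition lcs_lie_derived :: "('a, 'b) monoid_scheme \<Rightarrow> (int, nat \<Rightarrow> 'a set) module" where
  "lcs_lie_derived G =
    (lcs_lie G)\<lparr>carrier := {x \<in> carrier (lcs_lie G). x 1 = \<one>\<^bsub>lcs_quotient G 1\<^esub>}\<rparr>"

definition lcs_derived_component :: "('a, 'b) monoid_scheme \<Rightarrow> nat \<Rightarrow> (nat \<Rightarrow> 'a set) set" where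
  "lcs_derived_component G n =
    {x \<in> carrier (lcs_lie_derived G). \<forall>k\<ge>1. k \<noteq> n \<longrightarrow> x k = \<one>\<^bsub>lcs_quotient G k\<^esub>}"

text \<open>The squaring map: \<open>a\<gamma>\<^sub>k\<^sub>+\<^sub>1\<close> in degree \<open>k \<ge> 2\<close> goes to \<open>a\<^sup>2\<gamma>\<^sub>k\<^sub>+\<^sub>2\<close> in degree \<open>k + 1\<close>. The union over all
  representatives \<open>a\<close> is a single coset exactly because that is well defined.\<close>

definition lcs_square :: "('a, 'b) monoid_scheme \<Rightarrow> (nat \<Rightarrow> 'a set) \<Rightarrow> nat \<Rightarrow> 'a set" where
  "lcs_square G x = (\<lambda>n\<in>{1..}.
    if n \<ge> 3 then (\<Union>a\<in>x (n - 1). lower_central G (Suc n) #>\<^bsub>G\<^esub> (a \<otimes>\<^bsub>G\<^esub> a))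
    else \<one>\<^bsub>lcs_quotient G n\<^esub>)"


section \<open>Simplicial complexes\<close>

definition simplicial_complex :: "nat \<Rightarrow> nat set set \<Rightarrow> bool" where
  "simplicial_complex m K \<longleftrightarrow>
    K \<subseteq> Pow {1..m} \<and> {} \<in> K \<and> (\<forall>i\<in>{1..m}. {i} \<in> K) \<and> (\<forall>I\<in>K. \<forall>J\<subseteq>I. J \<in> K)"

definition flag_complex :: "nat \<Rightarrow> nat set set \<Rightarrow> bool" where
  "flag_complex m K \<longleftrightarrow>
    simplicial_complex m K \<and>
    (\<forall>I\<subseteq>{1..m}. (\<forall>i\<in>I. \<forall>j\<in>I. i \<noteq> j \<longrightarrow> {i, j} \<in> K) \<longrightarrow> I \<in> K)"

definition full_subcomplex :: "nat set set \<Rightarrow> nat set \<Rightarrow> nat set set" where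
  "full_subcomplex K J = {I \<in> K. I \<subseteq> J}"

text \<open>Two vertices lie in the same connected component iff an edge path joins them.\<close>

definition same_component :: "nat set set \<Rightarrow> (nat \<times> nat) set" where
  "same_component K = {(i, j). {i, j} \<in> K}\<^sup>*"

definition Theta :: "nat set set \<Rightarrow> nat set \<Rightarrow> nat set" where
  "Theta K J = {j \<in> J.
    (\<forall>i\<in>J. (i, j) \<in> same_component (full_subcomplex K J) \<longrightarrow> j \<le> i) \<and>
    (j, Max J) \<notin> same_component (full_subcomplex K J)}"


section \<open>Right-angled Coxeter groups and graph Lie algebras\<close>

definition RC_relations :: "nat \<Rightarrow> nat set set \<Rightarrow> (nat word \<times> nat word) set" where
  "RC_relations m K =
    {([(i, True), (i, True)], []) | i. i \<in> {1..m}} \<union>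
    {([(i, True), (j, True)], [(j, True), (i, True)]) | i j. {i, j} \<in> K}"

definition RC :: "nat \<Rightarrow> nat set set \<Rightarrow> nat word set monoid" where
  "RC m K = presented_group {1..m} (RC_relations m K)"

definition RC_gen :: "nat \<Rightarrow> nat set set \<Rightarrow> nat \<Rightarrow> nat word set" where
  "RC_gen m K i = word_class {1..m} (RC_relations m K) [(i, True)]"

abbreviation Z2 :: "int ring" where
  "Z2 \<equiv> residue_ring 2"

definition graph_lie_ideal :: "nat \<Rightarrow> nat set set \<Rightarrow> (int, nat) lie_term set set" where
  "graph_lie_ideal m K = lie_ideal_generated Z2 (free_lie Z2 {1..m})
    {free_lie_gen Z2 {1..m} i \<otimes>\<^bsub>free_lie Z2 {1..m}\<^esub> free_lie_gen Z2 {1..m} j | i j. {i, j} \<in> K}"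

definition graph_lie :: "nat \<Rightarrow> nat set set \<Rightarrow> (int, (int, nat) lie_term set set) module" where
  "graph_lie m K = lie_quotient (free_lie Z2 {1..m}) (graph_lie_ideal m K)"

definition mu :: "nat \<Rightarrow> nat set set \<Rightarrow> nat \<Rightarrow> (int, nat) lie_term set set" where
  "mu m K i = graph_lie_ideal m K +>\<^bsub>free_lie Z2 {1..m}\<^esub> free_lie_gen Z2 {1..m} i"

definition graph_lie_component ::
    "nat \<Rightarrow> nat set set \<Rightarrow> nat \<Rightarrow> (int, nat) lie_term set set set" where
  "graph_lie_component m K n = {x. homogeneous Z2 (graph_lie m K) (mu m K ` {1..m}) n x}"

text \<open>The homomorphism with \<open>\<mu>\<^sub>i \<mapsto> g\<^sub>i \<gamma>\<^sub>2\<close>; it is unique because the \<open>\<mu>\<^sub>i\<close> generate.\<close>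

definition varphi ::
    "nat \<Rightarrow> nat set set \<Rightarrow> (int, nat) lie_term set set \<Rightarrow> nat \<Rightarrow> nat word set set" where
  "varphi m K = (THE f. f \<in> extensional (carrier (graph_lie m K)) \<and>
    lie_algebra_hom Z2 (graph_lie m K) (lcs_lie (RC m K)) f \<and>
    (\<forall>i\<in>{1..m}. f (mu m K i) = lcs_class (RC m K) 1 (RC_gen m K i)))"

definition nested_bracket ::
    "('r, 'a, 'm) module_scheme \<Rightarrow> (nat \<Rightarrow> 'a) \<Rightarrow> nat set \<Rightarrow> 'a \<Rightarrow> 'a" where
  "nested_bracket L q I x = foldr (\<lambda>t y. q t \<otimes>\<^bsub>L\<^esub> y) (sorted_list_of_set I) x"

definition GPTW :: "nat \<Rightarrow> nat set set \<Rightarrow> (int, nat) lie_term set set set" where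
  "GPTW m K = {nested_bracket (graph_lie m K) (mu m K) (J - {j}) (mu m K j) | J j.
    J \<subseteq> {1..m} \<and> j \<in> Theta K J}"

definition N_lie :: "nat \<Rightarrow> nat set set \<Rightarrow> (int, (int, nat) lie_term set set) module" where
  "N_lie m K = subalgebra_generated Z2 (graph_lie m K) (GPTW m K)"

definition N_component ::
    "nat \<Rightarrow> nat set set \<Rightarrow> nat \<Rightarrow> (int, nat) lie_term set set set" where
  "N_component m K n = carrier (N_lie m K) \<inter> graph_lie_component m K n"

definition varphi_N ::
    "nat \<Rightarrow> nat set set \<Rightarrow> (int, nat) lie_term set set \<Rightarrow> nat \<Rightarrow> nat word set set" where
  "varphi_N m K = restrict (varphi m K) (carrier (N_lie m K))"

end

theory Submission
  imports Defs
begin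

text \<open>
  Over \<open>\<int>/2\<close>, on \<open>L'(G)\<close> with \<open>G = RC\<^sub>K\<close>, the squaring map \<open>h\<close> is additive and satisfies
  \<open>[h x, y] = h [x, y]\<close>; hence \<open>\<Sum> x\<^sub>k t\<^sup>k \<mapsto> \<Sum> h\<^sup>k \<phi>(x\<^sub>k)\<close> is a homomorphism of Lie algebras.
  For surjectivity one argues by induction on the degree \<open>n\<close>. The image contains all brackets of elements
  of degree at least 2 and all squares \<open>h x\<close> of degree \<open>n\<close>. Modulo these, the operators \<open>ad g\<^sub>i\<close> commute
  on \<open>L'(G)\<close>, and since \<open>g\<^sub>i\<close> is an involution, \<open>[g\<^sub>i, [g\<^sub>i, x]] = h [g\<^sub>i, x]\<close> vanishes. So only the
  multilinear commutators \<open>f(a, b) = [\<dots>, [g\<^sub>a, g\<^sub>b]]\<close> supported on a set \<open>J\<close> of \<open>n\<close> vertices remain.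
  By the Jacobi identity \<open>f(a, b) + f(b, c) + f(c, a) = 0\<close>, and \<open>f\<close> vanishes on edges, so \<open>f(j, max J)\<close>
  depends only on the component of \<open>j\<close> in \<open>K\<^sub>J\<close>; choosing \<open>j\<close> minimal in its component gives exactly the
  images of the GPTW generators.
\<close>

section \<open>Lie algebras over the field with two elements\<close>

text \<open>The degree bound 2 decides what may be rearranged. Exchanging ad g_i and ad g_j on x
  costs [[g_i, g_j], x], which is a bracket of two elements of L' only if x itself has degree at
  least 2. So in an iterated bracket of generators the outer letters can be permuted freely, but the
  innermost pair cannot; moving letters in and out of that pair takes the Jacobi identity, and this
  is the origin of the cocycle f(a, b). All error terms are brackets or squares of elements of lower
  degree. They lie in the image by induction, because the image is a subalgebra and because h
  corresponds to multiplication by t upstairs. They remain harmless under further bracketing,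
  because ad g_i is a derivation that commutes with h on L'. No basis of any of the Lie algebras is
  used. Everything is tested on additive spanning sets of homogeneous elements, and the directness
  of a grading is obtained from explicit projections.\<close>

lemma Z2_simps [simp]:
  "carrier Z2 = {0, 1}" "\<zero>\<^bsub>Z2\<^esub> = 0" "\<one>\<^bsub>Z2\<^esub> = 1"
  "x \<oplus>\<^bsub>Z2\<^esub> y = (x + y) mod 2" "x \<otimes>\<^bsub>Z2\<^esub> y = (x * y) mod 2"
  by (auto simp: residue_ring_def)

lemma cring_Z2: "cring Z2"
  by (simp add: residues.cring residues_def)

text \<open>Closure under addition alone: over the field with two elements the scalars are 0 and 1
  and every element is its own negative, so this is already the linear span.\<close>

inductive_set add_span :: "('a, 'm) ring_scheme \<Rightarrow> 'a set \<Rightarrow> 'a set"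
  for L :: "('a, 'm) ring_scheme" and S where
  zero: "\<zero>\<^bsub>L\<^esub> \<in> add_span L S"
| base: "x \<in> S \<Longrightarrow> x \<in> add_span L S"
| add: "\<lbrakk>x \<in> add_span L S; y \<in> add_span L S\<rbrakk> \<Longrightarrow> x \<oplus>\<^bsub>L\<^esub> y \<in> add_span L S"

lemma add_span_mono: "x \<in> add_span L S \<Longrightarrow> S \<subseteq> T \<Longrightarrow> x \<in> add_span L T"
  by (induction rule: add_span.induct) (auto intro: add_span.intros)

locale abelian_2_group = abelian_group L for L (structure) +
  assumes add_self: "x \<in> carrier L \<Longrightarrow> x \<oplus> x = \<zero>"
begin

lemma add_self_left: "\<lbrakk>x \<in> carrier L; y \<in> carrier L\<rbrakk> \<Longrightarrow> x \<oplus> (x \<oplus> y) = y"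
  by (simp add: add_self a_assoc [symmetric])

lemma add_eq_zero_iff: "\<lbrakk>x \<in> carrier L; y \<in> carrier L\<rbrakk> \<Longrightarrow> x \<oplus> y = \<zero> \<longleftrightarrow> x = y"
  by (metis add_self add_self_left r_zero)

lemma minus_self: "x \<in> carrier L \<Longrightarrow> \<ominus> x = x"
  by (simp add: add_self minus_equality)

lemma add_span_closed: "x \<in> add_span L S \<Longrightarrow> S \<subseteq> carrier L \<Longrightarrow> x \<in> carrier L"
  by (induction rule: add_span.induct) auto

end

locale lie_algebra_Z2 = lie_algebra Z2 L for L (structure)

sublocale lie_algebra_Z2 \<subseteq> abelian_2_group L
proof
  fix x assume "x \<in> carrier L"
  then show "x \<oplus> x = \<zero>"
    using smult_l_distr [of 1 1 x] smult_one [of x] smult_l_null [of x] by simp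
qed

context lie_algebra_Z2
begin

lemma bracket_zero_left: "x \<in> carrier L \<Longrightarrow> \<zero> \<otimes> x = \<zero>"
  using bracket_smult_left [of 0 x x] smult_l_null bracket_closed by simp

lemma bracket_zero_right: "x \<in> carrier L \<Longrightarrow> x \<otimes> \<zero> = \<zero>"
  using bracket_smult_right [of 0 x x] smult_l_null bracket_closed by simp

lemma bracket_commute:
  assumes "x \<in> carrier L" "y \<in> carrier L" shows "x \<otimes> y = y \<otimes> x"
proof -
  have "\<zero> = (x \<oplus> y) \<otimes> (x \<oplus> y)"
    using bracket_self [of "x \<oplus> y"] assms by simp
  also have "\<dots> = x \<otimes> y \<oplus> y \<otimes> x"
  proof -
    have "(x \<oplus> y) \<otimes> (x \<oplus> y) = (x \<otimes> x \<oplus> x \<otimes> y) \<oplus> (y \<otimes> x \<oplus> y \<otimes> y)"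
      using assms by (simp add: bracket_add_left bracket_add_right bracket_closed a_ac)
    then show ?thesis
      using assms by (simp add: bracket_closed bracket_self [of x] bracket_self [of y])
  qed
  finally show ?thesis
    using assms add_eq_zero_iff [of "x \<otimes> y" "y \<otimes> x"] by (simp add: bracket_closed)
qed

text \<open>Jacobi in derivation form; characteristic 2 removes all signs.\<close>

lemma bracket_leibniz:
  assumes "x \<in> carrier L" "y \<in> carrier L" "z \<in> carrier L"
  shows "x \<otimes> (y \<otimes> z) = (x \<otimes> y) \<otimes> z \<oplus> y \<otimes> (x \<otimes> z)"
proof -
  have "x \<otimes> (y \<otimes> z) \<oplus> (y \<otimes> (z \<otimes> x) \<oplus> z \<otimes> (x \<otimes> y)) = \<zero>"
    using jacobi [OF assms] assms by (simp add: a_assoc bracket_closed)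
  then have "x \<otimes> (y \<otimes> z) = y \<otimes> (z \<otimes> x) \<oplus> z \<otimes> (x \<otimes> y)"
    using assms by (simp add: add_eq_zero_iff bracket_closed)
  then show ?thesis
    using assms by (simp add: bracket_closed a_comm bracket_commute [of z])
qed

lemma smult_Z2: "x \<in> carrier L \<Longrightarrow> r \<in> carrier Z2 \<Longrightarrow> r \<odot> x = (if r = 0 then \<zero> else x)"
  using smult_l_null smult_one by auto

lemma Z2_submoduleI:
  assumes "H \<subseteq> carrier L" "\<zero> \<in> H" "\<And>x y. \<lbrakk>x \<in> H; y \<in> H\<rbrakk> \<Longrightarrow> x \<oplus> y \<in> H"
  shows "submodule H Z2 L"
proof (rule submoduleI)
  fix r x assume "r \<in> carrier Z2" "x \<in> H"
  then show "r \<odot> x \<in> H"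
    using assms smult_Z2 [of x r] by auto
qed (use assms minus_self in auto)

lemma submodule_subset: "submodule H Z2 L \<Longrightarrow> H \<subseteq> carrier L"
  and submodule_zero: "submodule H Z2 L \<Longrightarrow> \<zero> \<in> H"
  and submodule_add: "submodule H Z2 L \<Longrightarrow> x \<in> H \<Longrightarrow> y \<in> H \<Longrightarrow> x \<oplus> y \<in> H"
    apply (simp add: submoduleE)
  using submodule.axioms(1) subgroup.one_closed apply fastforce
  by (simp add: submoduleE)

lemma add_span_submodule: "S \<subseteq> carrier L \<Longrightarrow> submodule (add_span L S) Z2 L"
  by (rule Z2_submoduleI) (auto intro: add_span.intros add_span_closed)

end

text \<open>All Lie axioms are multi-additive except \<open>x \<otimes> x = \<zero>\<close>, whose
  defect on a sum is \<open>x \<otimes> y \<oplus> y \<otimes> x\<close>. With commutativity on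
  \<open>S\<close> as a further hypothesis, every axiom needs testing on a spanning set only. For
  L(G) this set consists of classes of single group elements, where commutator identities apply
  directly.\<close>

lemma lie_algebra_Z2I:
  fixes L :: "(int, 'a, 'm) module_scheme" (structure)
  assumes "abelian_2_group L"
    and smult0: "\<And>x. x \<in> carrier L \<Longrightarrow> 0 \<odot> x = \<zero>"
    and smult1: "\<And>x. x \<in> carrier L \<Longrightarrow> 1 \<odot> x = x"
    and closed: "\<And>x y. \<lbrakk>x \<in> carrier L; y \<in> carrier L\<rbrakk> \<Longrightarrow> x \<otimes> y \<in> carrier L"
    and addl: "\<And>x y z. \<lbrakk>x \<in> carrier L; y \<in> carrier L; z \<in> carrier L\<rbrakk> \<Longrightarrow>
        (x \<oplus> y) \<otimes> z = x \<otimes> z \<oplus> y \<otimes> z"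
    and addr: "\<And>x y z. \<lbrakk>x \<in> carrier L; y \<in> carrier L; z \<in> carrier L\<rbrakk> \<Longrightarrow>
        x \<otimes> (y \<oplus> z) = x \<otimes> y \<oplus> x \<otimes> z"
    and S: "S \<subseteq> carrier L" "carrier L \<subseteq> add_span L S"
    and self: "\<And>x. x \<in> S \<Longrightarrow> x \<otimes> x = \<zero>"
    and comm: "\<And>x y. \<lbrakk>x \<in> S; y \<in> S\<rbrakk> \<Longrightarrow> x \<otimes> y = y \<otimes> x"
    and jacobi: "\<And>x y z. \<lbrakk>x \<in> S; y \<in> S; z \<in> S\<rbrakk> \<Longrightarrow>
        x \<otimes> (y \<otimes> z) \<oplus> y \<otimes> (z \<otimes> x) \<oplus> z \<otimes> (x \<otimes> y) = \<zero>"
  shows "lie_algebra Z2 L"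
proof -
  interpret abelian_2_group L by fact
  have zl: "\<zero> \<otimes> x = \<zero>" if "x \<in> carrier L" for x
    using addl [of \<zero> \<zero> x] that closed [of \<zero> x] add_self [of "\<zero> \<otimes> x"] by simp
  have zr: "x \<otimes> \<zero> = \<zero>" if "x \<in> carrier L" for x
    using addr [of x \<zero> \<zero>] that closed [of x \<zero>] add_self [of "x \<otimes> \<zero>"] by simp
  have span: "x \<in> add_span L S \<longleftrightarrow> x \<in> carrier L" for x
    using S add_span_closed by auto
  have comm1: "x \<otimes> y = y \<otimes> x" if "x \<in> carrier L" "y \<in> S" for x y
  proof -
    from that have "x \<in> add_span L S" by (simp add: span)
    then show ?thesis using \<open>y \<in> S\<close> S
      by (induction) (auto simp: zl zr addl addr comm subset_iff span)
  qed
  have comm2: "x \<otimes> y = y \<otimes> x" if "x \<in> carrier L" "y \<in> carrier L" for x y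
  proof -
    from that have "y \<in> add_span L S" by (simp add: span)
    then show ?thesis using \<open>x \<in> carrier L\<close> S
      by (induction) (auto simp: zl zr addl addr comm1 subset_iff span)
  qed
  have self': "x \<otimes> x = \<zero>" if "x \<in> carrier L" for x
  proof -
    from that have "x \<in> add_span L S" by (simp add: span)
    then show ?thesis
    proof induction
      case (add x y)
      then have "(x \<oplus> y) \<otimes> (x \<oplus> y) = x \<otimes> y \<oplus> x \<otimes> y"
        by (simp add: addl addr span comm2 [of y x] closed)
      then show ?case using add by (simp add: span add_self closed)
    qed (simp_all add: zl self)
  qed
  define J where "J x y z = x \<otimes> (y \<otimes> z) \<oplus> y \<otimes> (z \<otimes> x) \<oplus> z \<otimes> (x \<otimes> y)" for x y z
  \<comment> \<open>Cyclic symmetry lets additivity in the first argument serve for all three: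
    \<open>J1\<close>, \<open>J2\<close> and \<open>J3\<close> free one more argument each, after a
    rotation.\<close>
  have Jcyc: "J x y z = J y z x" if "x \<in> carrier L" "y \<in> carrier L" "z \<in> carrier L" for x y z
    using that by (simp add: J_def closed a_ac)
  have Jadd: "J (x \<oplus> x') y z = J x y z \<oplus> J x' y z"
    if "x \<in> carrier L" "x' \<in> carrier L" "y \<in> carrier L" "z \<in> carrier L" for x x' y z
    using that by (simp add: J_def closed a_ac addl addr)
  have J0: "J \<zero> y z = \<zero>" if "y \<in> carrier L" "z \<in> carrier L" for y z
    using that by (simp add: J_def closed zl zr)
  have J1: "J x y z = \<zero>" if "x \<in> carrier L" "y \<in> S" "z \<in> S" for x y z
  proof -
    from that have "x \<in> add_span L S" by (simp add: span)
    then show ?thesis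
      using that(2,3) S by induction (auto simp: J0 Jadd span jacobi [folded J_def] subset_iff)
  qed
  have J2: "J x y z = \<zero>" if "x \<in> carrier L" "y \<in> carrier L" "z \<in> S" for x y z
  proof -
    from that have "x \<in> add_span L S" by (simp add: span)
    then show ?thesis
    proof induction
      case (base x) then show ?case using Jcyc [of x y z] J1 [of y z x] that S by auto
    qed (use that S in \<open>auto simp: J0 Jadd span\<close>)
  qed
  have J3: "J x y z = \<zero>" if "x \<in> carrier L" "y \<in> carrier L" "z \<in> carrier L" for x y z
  proof -
    from that have "x \<in> add_span L S" by (simp add: span)
    then show ?thesis
    proof induction
      case (base x) then show ?case using Jcyc [of x y z] J2 [of y z x] that S by auto
    qed (use that S in \<open>auto simp: J0 Jadd span\<close>)
  qed
  have mod: "module Z2 L"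
  proof (rule moduleI)
    show "abelian_group L" by (rule abelian_group_axioms)
  qed (auto simp: cring_Z2 smult0 smult1 add_self)
  show ?thesis
    by (intro lie_algebra.intro mod lie_algebra_axioms.intro)
      (auto simp: closed addl addr smult0 smult1 zl zr self' J3 J_def [symmetric])
qed

section \<open>Subalgebras and homomorphisms\<close>

lemma (in lie_algebra) subalgebra_lie_algebra:
  assumes "lie_subalgebra R L H" shows "lie_algebra R (L\<lparr>carrier := H\<rparr>)"
proof -
  have H: "submodule H R L" "H \<subseteq> carrier L" "\<And>x y. \<lbrakk>x \<in> H; y \<in> H\<rbrakk> \<Longrightarrow> x \<otimes>\<^bsub>L\<^esub> y \<in> H"
    using assms by (auto simp: lie_subalgebra_def submoduleE)
  have "module R (L\<lparr>carrier := H\<rparr>)"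
    using submodule.submodule_is_module [OF H(1)] module_axioms by blast
  then show ?thesis
    using H(2,3) by (intro lie_algebra.intro lie_algebra_axioms.intro)
     (auto simp: subset_iff bracket_add_left bracket_add_right bracket_smult_left
        bracket_smult_right bracket_self jacobi)
qed

lemma (in lie_algebra) lie_subalgebra_Inter:
  assumes "\<And>H. H \<in> \<A> \<Longrightarrow> lie_subalgebra R L H" "\<A> \<noteq> {}"
  shows "lie_subalgebra R L (\<Inter>\<A>)"
proof -
  have sm: "submodule H R L" if "H \<in> \<A>" for H
    using assms that by (auto simp: lie_subalgebra_def)
  have "submodule (\<Inter>\<A>) R L"
  proof (rule submoduleI)
    show "\<Inter>\<A> \<subseteq> carrier L"
      using assms(2) sm by (auto dest!: submoduleE(1))
    show "\<zero>\<^bsub>L\<^esub> \<in> \<Inter>\<A>"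
      using sm submodule.axioms(1) subgroup.one_closed by fastforce
  qed (auto simp: submoduleE sm)
  then show ?thesis
    using assms by (auto simp: lie_subalgebra_def)
qed

lemma (in lie_algebra) carrier_lie_subalgebra: "lie_subalgebra R L (carrier L)"
  by (simp add: lie_subalgebra_def carrier_is_submodule bracket_closed)

lemma (in lie_algebra) subalgebra_generated_lie_subalgebra:
  assumes "S \<subseteq> carrier L"
  shows "lie_subalgebra R L (carrier (subalgebra_generated R L S))"
  unfolding subalgebra_generated_def
  using lie_subalgebra_Inter [of "{H. lie_subalgebra R L H \<and> S \<subseteq> H}"]
    carrier_lie_subalgebra assms by auto

text \<open>With scalars 0 and 1, additivity gives linearity; compatibility with the bracket is a
  biadditive condition, so a spanning set suffices.\<close>

lemma lie_algebra_hom_Z2I: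
  assumes "lie_algebra Z2 A" "lie_algebra Z2 B"
    and closed: "\<And>x. x \<in> carrier A \<Longrightarrow> f x \<in> carrier B"
    and add: "\<And>x y. \<lbrakk>x \<in> carrier A; y \<in> carrier A\<rbrakk> \<Longrightarrow> f (x \<oplus>\<^bsub>A\<^esub> y) = f x \<oplus>\<^bsub>B\<^esub> f y"
    and S: "S \<subseteq> carrier A" "carrier A \<subseteq> add_span A S"
    and bracket: "\<And>x y. \<lbrakk>x \<in> S; y \<in> S\<rbrakk> \<Longrightarrow> f (x \<otimes>\<^bsub>A\<^esub> y) = f x \<otimes>\<^bsub>B\<^esub> f y"
  shows "lie_algebra_hom Z2 A B f"
proof -
  interpret A: lie_algebra_Z2 A by (rule lie_algebra_Z2.intro) fact
  interpret B: lie_algebra_Z2 B by (rule lie_algebra_Z2.intro) fact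
  have zero: "f \<zero>\<^bsub>A\<^esub> = \<zero>\<^bsub>B\<^esub>"
    using add [of "\<zero>\<^bsub>A\<^esub>" "\<zero>\<^bsub>A\<^esub>"] closed [of "\<zero>\<^bsub>A\<^esub>"] B.add_self by simp
  have span: "x \<in> add_span A S \<longleftrightarrow> x \<in> carrier A" for x
    using S A.add_span_closed by auto
  have 1: "f (x \<otimes>\<^bsub>A\<^esub> y) = f x \<otimes>\<^bsub>B\<^esub> f y" if "x \<in> carrier A" "y \<in> S" for x y
  proof -
    from that have "x \<in> add_span A S" by (simp add: span)
    then show ?thesis
      using that(2) S
      by induction (auto simp: zero A.bracket_zero_left B.bracket_zero_left closed bracket
          A.bracket_add_left B.bracket_add_left add span subset_iff A.bracket_closed)
  qed
  have 2: "f (x \<otimes>\<^bsub>A\<^esub> y) = f x \<otimes>\<^bsub>B\<^esub> f y" if "x \<in> carrier A" "y \<in> carrier A" for x y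
  proof -
    from that have "y \<in> add_span A S" by (simp add: span)
    then show ?thesis
      using that(1) S
      by induction (auto simp: zero A.bracket_zero_right B.bracket_zero_right closed 1
          A.bracket_add_right B.bracket_add_right add span subset_iff A.bracket_closed)
  qed
  have 3: "f (r \<odot>\<^bsub>A\<^esub> x) = r \<odot>\<^bsub>B\<^esub> f x" if "r \<in> carrier Z2" "x \<in> carrier A" for r x
    using that by (simp only: A.smult_Z2 B.smult_Z2 closed) (simp add: zero)
  show ?thesis
    by (intro lie_algebra_hom.intro lie_algebra_hom_axioms.intro assms 2 3)
qed

section \<open>Gradings from projections\<close>

lemma (in abelian_2_group) hom_finsum:
  assumes "finite A" "c \<in> A \<rightarrow> carrier L" "\<And>x. x \<in> carrier L \<Longrightarrow> f x \<in> carrier M" "abelian_2_group M"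
    and "\<And>x y. \<lbrakk>x \<in> carrier L; y \<in> carrier L\<rbrakk> \<Longrightarrow> f (x \<oplus> y) = f x \<oplus>\<^bsub>M\<^esub> f y"
  shows "f (\<Oplus>n\<in>A. c n) = (\<Oplus>\<^bsub>M\<^esub>n\<in>A. f (c n))"
proof -
  interpret M: abelian_2_group M by fact
  have zero: "f \<zero> = \<zero>\<^bsub>M\<^esub>"
    using assms(5) [of \<zero> \<zero>] assms(3) [of \<zero>] M.add_self by simp
  show ?thesis
    using assms(1,2)
  proof induction
    case (insert x F)
    then have "f (\<Oplus>n\<in>insert x F. c n) = f (c x \<oplus> (\<Oplus>n\<in>F. c n))"
      by (subst finsum_insert) auto
    also have "\<dots> = f (c x) \<oplus>\<^bsub>M\<^esub> (\<Oplus>\<^bsub>M\<^esub>n\<in>F. f (c n))"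
      using insert assms(5) by (simp add: Pi_iff)
    also have "\<dots> = (\<Oplus>\<^bsub>M\<^esub>n\<in>insert x F. f (c n))"
      using insert assms(3) by (subst M.finsum_insert) (auto simp: Pi_iff)
    finally show ?case .
  qed (simp add: zero)
qed

lemma (in abelian_2_group) finsum_support:
  assumes "finite A" "c \<in> A \<rightarrow> carrier L" "{n. c n \<noteq> \<zero>} \<subseteq> A"
  shows "(\<Oplus>n\<in>{n. c n \<noteq> \<zero>}. c n) = (\<Oplus>n\<in>A. c n)"
  using assms by (intro add.finprod_mono_neutral_cong_left) auto

text \<open>The hard half of a grading is directness of the sum. Additive maps that are the identity
  on one component and zero on the others settle it: applied to any decomposition they read off its
  terms. That \<open>\<pi> n x\<close> lies in \<open>D n\<close> for every \<open>x\<close> then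
  follows from spanning.\<close>

lemma (in lie_algebra_Z2) graded_by_projections:
  assumes D: "\<And>n. submodule (D n) Z2 L"
    and br: "\<And>i j x y. \<lbrakk>x \<in> D i; y \<in> D j\<rbrakk> \<Longrightarrow> x \<otimes> y \<in> D (i + j)"
    and span: "carrier L \<subseteq> add_span L (\<Union>n. D n)"
    and padd: "\<And>n x y. \<lbrakk>x \<in> carrier L; y \<in> carrier L\<rbrakk> \<Longrightarrow> \<pi> n (x \<oplus> y) = \<pi> n x \<oplus> \<pi> n y"
    and pD: "\<And>n k x. x \<in> D k \<Longrightarrow> \<pi> n x = (if n = k then x else \<zero>)"
  shows "graded_lie_algebra Z2 L D"
proof -
  have DL: "x \<in> carrier L" if "x \<in> D n" for x n
    using D submodule_subset that by blast
  have UL: "(\<Union>n. D n) \<subseteq> carrier L"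
    using DL by blast
  have p0: "\<pi> n \<zero> = \<zero>" for n
    using pD [OF submodule_zero [OF D]] by auto
  have pin: "\<pi> n x \<in> D n \<and> finite {n. \<pi> n x \<noteq> \<zero>} \<and> x = (\<Oplus>n\<in>{n. \<pi> n x \<noteq> \<zero>}. \<pi> n x)"
    if "x \<in> carrier L" for n x
  proof -
    have "x \<in> add_span L (\<Union>n. D n)" using that span by blast
    then have "(\<forall>n. \<pi> n x \<in> D n) \<and> finite {n. \<pi> n x \<noteq> \<zero>} \<and> x = (\<Oplus>n\<in>{n. \<pi> n x \<noteq> \<zero>}. \<pi> n x)"
    proof induction
      case zero
      then show ?case using D submodule_zero by (auto simp: p0)
    next
      case (base x)
      then obtain k where k: "x \<in> D k" by blast
      then have "{n. \<pi> n x \<noteq> \<zero>} \<subseteq> {k}" by (auto simp: pD)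
      moreover have "(\<Oplus>n\<in>{n. \<pi> n x \<noteq> \<zero>}. \<pi> n x) = (\<Oplus>n\<in>{k}. \<pi> n x)"
        using k DL by (intro finsum_support) (auto simp: pD)
      moreover have "\<dots> = x"
        using k DL [OF k] by (simp add: pD)
      ultimately show ?case
        using k D submodule_zero by (auto simp: pD intro: finite_subset)
    next
      case (add x y)
      let ?A = "{n. \<pi> n x \<noteq> \<zero>} \<union> {n. \<pi> n y \<noteq> \<zero>}"
      have fin: "finite ?A" using add by blast
      have L: "x \<in> carrier L" "y \<in> carrier L"
        using add add_span_closed UL by blast+
      have pL: "\<pi> n x \<in> carrier L" "\<pi> n y \<in> carrier L" for n
        using add DL by blast+
      have sub: "{n. \<pi> n (x \<oplus> y) \<noteq> \<zero>} \<subseteq> ?A"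
        using L by (auto simp: padd)
      have "(\<Oplus>n\<in>{n. \<pi> n (x \<oplus> y) \<noteq> \<zero>}. \<pi> n (x \<oplus> y)) = (\<Oplus>n\<in>?A. \<pi> n (x \<oplus> y))"
        using fin sub L pL by (intro finsum_support) (auto simp: padd)
      also have "\<dots> = (\<Oplus>n\<in>?A. \<pi> n x \<oplus> \<pi> n y)"
        using L by (simp add: padd)
      also have "\<dots> = (\<Oplus>n\<in>?A. \<pi> n x) \<oplus> (\<Oplus>n\<in>?A. \<pi> n y)"
        using pL by (intro finsum_addf) auto
      also have "(\<Oplus>n\<in>?A. \<pi> n x) = x"
        using finsum_support [OF fin, of "\<lambda>n. \<pi> n x"] add pL by auto
      also have "(\<Oplus>n\<in>?A. \<pi> n y) = y"
        using finsum_support [OF fin, of "\<lambda>n. \<pi> n y"] add pL by auto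
      finally show ?case
        using finite_subset [OF sub fin] add D submodule_add L by (auto simp: padd)
    qed
    then show ?thesis by blast
  qed
  have uniq: "c = (\<lambda>n. \<pi> n x)"
    if "\<forall>n. c n \<in> D n" "finite {n. c n \<noteq> \<zero>}" "x = (\<Oplus>n\<in>{n. c n \<noteq> \<zero>}. c n)" for c x
  proof
    fix k
    have cL: "c n \<in> carrier L" for n using that DL by blast
    have "\<pi> k x = (\<Oplus>n\<in>{n. c n \<noteq> \<zero>}. \<pi> k (c n))"
      using that(3) pin DL
      by (simp only:) (rule hom_finsum, use that(2) cL abelian_2_group_axioms in \<open>auto simp: padd\<close>)
    also have "\<dots> = (\<Oplus>n\<in>{n. c n \<noteq> \<zero>}. if k = n then c n else \<zero>)"
      using that(1) cL by (intro finsum_cong') (auto simp: pD)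
    also have "\<dots> = (\<Oplus>n\<in>insert k {n. c n \<noteq> \<zero>}. if k = n then c n else \<zero>)"
      using that(2) cL by (intro add.finprod_mono_neutral_cong_left) auto
    also have "\<dots> = c k"
      using that(2) cL finsum_singleton [of k "insert k {n. c n \<noteq> \<zero>}" c] by auto
    finally show "c k = \<pi> k x" ..
  qed
  show ?thesis
  proof (intro graded_lie_algebra.intro graded_lie_algebra_axioms.intro lie_algebra_axioms D br)
    fix x assume "x \<in> carrier L"
    then show "\<exists>!c. (\<forall>n. c n \<in> D n) \<and> finite {n. c n \<noteq> \<zero>} \<and> x = (\<Oplus>n\<in>{n. c n \<noteq> \<zero>}. c n)"
      using pin uniq by (intro ex1I [of _ "\<lambda>n. \<pi> n x"]) blast+
  qed
qed

section \<open>Polynomials over a Lie algebra\<close>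

lemma lie_poly_simps [simp]:
  "carrier (lie_poly L) = up L"
  "\<zero>\<^bsub>lie_poly L\<^esub> = (\<lambda>n. \<zero>\<^bsub>L\<^esub>)"
  "r \<odot>\<^bsub>lie_poly L\<^esub> p = (\<lambda>n. r \<odot>\<^bsub>L\<^esub> p n)"
  by (simp_all add: lie_poly_def UP_def)

lemma lie_poly_add: "\<lbrakk>p \<in> up L; q \<in> up L\<rbrakk> \<Longrightarrow> p \<oplus>\<^bsub>lie_poly L\<^esub> q = (\<lambda>n. p n \<oplus>\<^bsub>L\<^esub> q n)"
  by (simp add: lie_poly_def UP_def)

lemma lie_poly_mult: "\<lbrakk>p \<in> up L; q \<in> up L\<rbrakk> \<Longrightarrow>
    p \<otimes>\<^bsub>lie_poly L\<^esub> q = (\<lambda>n. \<Oplus>\<^bsub>L\<^esub>i\<in>{..n}. p i \<otimes>\<^bsub>L\<^esub> q (n - i))"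
  by (simp add: lie_poly_def UP_def)

lemma monom_UP: "x \<in> carrier L \<Longrightarrow> monom (UP L) x k = (\<lambda>i. if i = k then x else \<zero>\<^bsub>L\<^esub>)"
  by (simp add: UP_def)

lemma up_finite_support: "p \<in> up L \<Longrightarrow> finite {k. p k \<noteq> \<zero>\<^bsub>L\<^esub>}"
proof -
  assume "p \<in> up L"
  then obtain n where "bound \<zero>\<^bsub>L\<^esub> n p" by (auto simp: up_def)
  then have "{k. p k \<noteq> \<zero>\<^bsub>L\<^esub>} \<subseteq> {..n}" by (auto simp: bound_def not_less [symmetric])
  then show ?thesis by (rule finite_subset) simp
qed

context lie_algebra_Z2
begin

lemma up_zero: "(\<lambda>n. \<zero>) \<in> up L"
  by (auto simp: up_def bound_def)

lemma up_add: "\<lbrakk>p \<in> up L; q \<in> up L\<rbrakk> \<Longrightarrow> (\<lambda>n. p n \<oplus> q n) \<in> up L"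
proof (rule mem_upI)
  assume pq: "p \<in> up L" "q \<in> up L"
  then show "p n \<oplus> q n \<in> carrier L" for n by auto
  from pq obtain m n where "bound \<zero> m p" "bound \<zero> n q" by (auto simp: up_def)
  then have "bound \<zero> (max m n) (\<lambda>n. p n \<oplus> q n)" by (auto simp: bound_def)
  then show "\<exists>n. bound \<zero> n (\<lambda>n. p n \<oplus> q n)" ..
qed

lemma up_mult: "\<lbrakk>p \<in> up L; q \<in> up L\<rbrakk> \<Longrightarrow> (\<lambda>n. \<Oplus>i\<in>{..n}. p i \<otimes> q (n - i)) \<in> up L"
proof (rule mem_upI)
  assume pq: "p \<in> up L" "q \<in> up L"
  then show "(\<Oplus>i\<in>{..n}. p i \<otimes> q (n - i)) \<in> carrier L" for n
    by (intro finsum_closed) (auto intro: bracket_closed)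
  from pq obtain m n where mn: "bound \<zero> m p" "bound \<zero> n q" by (auto simp: up_def)
  have "(\<Oplus>i\<in>{..k}. p i \<otimes> q (k - i)) = \<zero>" if "m + n < k" for k
  proof -
    have "(\<Oplus>i\<in>{..k}. p i \<otimes> q (k - i)) = (\<Oplus>i\<in>{..k}. \<zero>)"
    proof (rule finsum_cong')
      fix i assume "i \<in> {..k}"
      show "p i \<otimes> q (k - i) = \<zero>"
      proof (cases "m < i")
        case True then show ?thesis using mn pq by (auto simp: bound_def bracket_zero_left mem_upD)
      next
        case False
        then have "n < k - i" using that by linarith
        then show ?thesis using mn pq by (auto simp: bound_def bracket_zero_right mem_upD)
      qed
    qed auto
    then show ?thesis by simp
  qed
  then have "bound \<zero> (m + n) (\<lambda>n. \<Oplus>i\<in>{..n}. p i \<otimes> q (n - i))" by (auto simp: bound_def)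
  then show "\<exists>n. bound \<zero> n (\<lambda>n. \<Oplus>i\<in>{..n}. p i \<otimes> q (n - i))" ..
qed

lemma up_monom: "x \<in> carrier L \<Longrightarrow> (\<lambda>i. if i = k then x else \<zero>) \<in> up L"
  by (auto simp: up_def bound_def intro!: exI [of _ k])

lemma lie_poly_abelian: "abelian_2_group (lie_poly L)"
proof -
  have "abelian_group (lie_poly L)"
  proof (rule abelian_groupI)
    fix p assume "p \<in> carrier (lie_poly L)"
    then show "\<exists>q\<in>carrier (lie_poly L). q \<oplus>\<^bsub>lie_poly L\<^esub> p = \<zero>\<^bsub>lie_poly L\<^esub>"
      by (intro bexI [of _ p]) (auto simp: lie_poly_add add_self mem_upD)
  qed (auto simp: lie_poly_add up_zero up_add a_ac mem_upD intro!: ext)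
  then show ?thesis
    by (intro abelian_2_group.intro abelian_2_group_axioms.intro)
       (auto simp: lie_poly_add add_self mem_upD)
qed

lemma lie_poly_span:
  "up L \<subseteq> add_span (lie_poly L) {up_ring.monom (UP L) x k | x k. x \<in> carrier L}" (is "_ \<subseteq> ?S")
proof
  fix p assume p: "p \<in> up L"
  have main: "p \<in> up L \<Longrightarrow> (\<And>k. n \<le> k \<Longrightarrow> p k = \<zero>) \<Longrightarrow> p \<in> ?S" for n p
  proof (induction n arbitrary: p)
    case 0
    then have "p = \<zero>\<^bsub>lie_poly L\<^esub>" by (simp add: fun_eq_iff)
    then show ?case by (simp only: add_span.zero)
  next
    case (Suc n)
    let ?q = "\<lambda>i. if i = n then \<zero> else p i"
    have pn: "p n \<in> carrier L" using Suc(2) by (rule mem_upD)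
    have q: "?q \<in> up L"
    proof (rule mem_upI)
      show "(if i = n then \<zero> else p i) \<in> carrier L" for i
        using mem_upD [OF Suc(2), of i] by simp
      have "bound \<zero> n ?q" using Suc(3) by (intro bound.intro) simp
      then show "\<exists>k. bound \<zero> k ?q" ..
    qed
    have 1: "?q \<in> ?S"
    proof (rule Suc.IH [OF q])
      fix k assume "n \<le> k"
      then show "?q k = \<zero>" using Suc(3) [of k] by (cases "k = n") auto
    qed
    have 2: "up_ring.monom (UP L) (p n) n \<in> ?S"
      using pn by (intro add_span.base) blast
    have "?q \<oplus>\<^bsub>lie_poly L\<^esub> up_ring.monom (UP L) (p n) n = p"
      using q pn up_monom [OF pn, of n] mem_upD [OF Suc(2)]
      by (simp add: lie_poly_add monom_UP) (rule ext, simp)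
    with add_span.add [OF 1 2] show ?case by simp
  qed
  obtain n where n: "bound \<zero> n p" using p by (auto simp: up_def)
  show "p \<in> ?S"
    by (rule main [OF p, of "Suc n"]) (rule bound.bound [OF n], simp)
qed

lemma monom_bracket:
  assumes "x \<in> carrier L" "y \<in> carrier L"
  shows "up_ring.monom (UP L) x k \<otimes>\<^bsub>lie_poly L\<^esub> up_ring.monom (UP L) y l = up_ring.monom (UP L) (x \<otimes> y) (k + l)"
proof
  fix n
  have "(\<Oplus>i\<in>{..n}. (if i = k then x else \<zero>) \<otimes> (if n - i = l then y else \<zero>))
      = (\<Oplus>i\<in>{..n}. if k = i then (if n = k + l then x \<otimes> y else \<zero>) else \<zero>)"
    using assms by (intro finsum_cong') (auto simp: bracket_zero_left bracket_zero_right bracket_closed)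
  also have "\<dots> = (if n = k + l then x \<otimes> y else \<zero>)"
  proof (cases "k \<le> n")
    case True
    then show ?thesis
      using finsum_singleton [of k "{..n}" "\<lambda>_. if n = k + l then x \<otimes> y else \<zero>"] assms
      by (simp add: bracket_closed)
  next
    case False
    then have "(\<Oplus>i\<in>{..n}. if k = i then (if n = k + l then x \<otimes> y else \<zero>) else \<zero>) = (\<Oplus>i\<in>{..n}. \<zero>)"
      by (intro finsum_cong') auto
    then show ?thesis using False by simp
  qed
  finally show "(up_ring.monom (UP L) x k \<otimes>\<^bsub>lie_poly L\<^esub> up_ring.monom (UP L) y l) n = up_ring.monom (UP L) (x \<otimes> y) (k + l) n"
    using assms by (simp add: monom_UP bracket_closed lie_poly_mult up_monom)
qed

lemma monom_add:
  assumes "x \<in> carrier L" "y \<in> carrier L"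
  shows "up_ring.monom (UP L) x k \<oplus>\<^bsub>lie_poly L\<^esub> up_ring.monom (UP L) y k = up_ring.monom (UP L) (x \<oplus> y) k"
  using assms by (auto simp: monom_UP lie_poly_add up_monom)

lemma monom_zero: "up_ring.monom (UP L) \<zero> k = \<zero>\<^bsub>lie_poly L\<^esub>"
  by (auto simp: monom_UP)

text \<open>Monomials span, and on them each axiom is the corresponding one in \<open>L\<close> with
  the exponents of t added.\<close>

lemma lie_poly_lie_algebra: "lie_algebra Z2 (lie_poly L)"
proof (rule lie_algebra_Z2I [OF lie_poly_abelian])
  show "{up_ring.monom (UP L) x k | x k. x \<in> carrier L} \<subseteq> carrier (lie_poly L)"
    by (auto simp: monom_UP up_monom)
  show "carrier (lie_poly L) \<subseteq> add_span (lie_poly L) {up_ring.monom (UP L) x k | x k. x \<in> carrier L}"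
    using lie_poly_span by simp
  show "p \<otimes>\<^bsub>lie_poly L\<^esub> q \<in> carrier (lie_poly L)"
    if "p \<in> carrier (lie_poly L)" "q \<in> carrier (lie_poly L)" for p q
    using that by (simp add: lie_poly_mult up_mult)
  show "(p \<oplus>\<^bsub>lie_poly L\<^esub> q) \<otimes>\<^bsub>lie_poly L\<^esub> r
      = p \<otimes>\<^bsub>lie_poly L\<^esub> r \<oplus>\<^bsub>lie_poly L\<^esub> q \<otimes>\<^bsub>lie_poly L\<^esub> r"
    if "p \<in> carrier (lie_poly L)" "q \<in> carrier (lie_poly L)" "r \<in> carrier (lie_poly L)" for p q r
  proof -
    have c: "p n \<in> carrier L" "q n \<in> carrier L" "r n \<in> carrier L" for n using that by auto
    then have "(\<Oplus>i\<in>{..n}. (p i \<oplus> q i) \<otimes> r (n - i))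
        = (\<Oplus>i\<in>{..n}. p i \<otimes> r (n - i)) \<oplus> (\<Oplus>i\<in>{..n}. q i \<otimes> r (n - i))" for n
      by (simp add: bracket_add_left bracket_closed finsum_addf Pi_iff)
    with that show ?thesis
      by (simp add: lie_poly_add lie_poly_mult up_mult up_add)
  qed
  show "r \<otimes>\<^bsub>lie_poly L\<^esub> (p \<oplus>\<^bsub>lie_poly L\<^esub> q)
      = r \<otimes>\<^bsub>lie_poly L\<^esub> p \<oplus>\<^bsub>lie_poly L\<^esub> r \<otimes>\<^bsub>lie_poly L\<^esub> q"
    if "r \<in> carrier (lie_poly L)" "p \<in> carrier (lie_poly L)" "q \<in> carrier (lie_poly L)" for p q r
  proof -
    have c: "p n \<in> carrier L" "q n \<in> carrier L" "r n \<in> carrier L" for n using that by auto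
    then have "(\<Oplus>i\<in>{..n}. r i \<otimes> (p (n - i) \<oplus> q (n - i)))
        = (\<Oplus>i\<in>{..n}. r i \<otimes> p (n - i)) \<oplus> (\<Oplus>i\<in>{..n}. r i \<otimes> q (n - i))" for n
      by (simp add: bracket_add_right bracket_closed finsum_addf Pi_iff)
    then show ?thesis
      using that by (simp add: lie_poly_add lie_poly_mult up_mult up_add)
  qed
next
  fix p assume "p \<in> {up_ring.monom (UP L) x k | x k. x \<in> carrier L}"
  then show "p \<otimes>\<^bsub>lie_poly L\<^esub> p = \<zero>\<^bsub>lie_poly L\<^esub>"
    by (clarsimp simp del: lie_poly_simps simp: monom_bracket bracket_self monom_zero)
next
  fix p q
  assume "p \<in> {up_ring.monom (UP L) x k | x k. x \<in> carrier L}" "q \<in> {up_ring.monom (UP L) x k | x k. x \<in> carrier L}"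
  then obtain x k y l where
    "p = up_ring.monom (UP L) x k" "q = up_ring.monom (UP L) y l" "x \<in> carrier L" "y \<in> carrier L" by blast
  then show "p \<otimes>\<^bsub>lie_poly L\<^esub> q = q \<otimes>\<^bsub>lie_poly L\<^esub> p"
    by (simp add: monom_bracket add.commute bracket_commute [of x y])
next
  fix p q r
  assume "p \<in> {up_ring.monom (UP L) x k | x k. x \<in> carrier L}" "q \<in> {up_ring.monom (UP L) x k | x k. x \<in> carrier L}"
    "r \<in> {up_ring.monom (UP L) x k | x k. x \<in> carrier L}"
  then obtain x k y l z n where
    eq: "p = up_ring.monom (UP L) x k" "q = up_ring.monom (UP L) y l" "r = up_ring.monom (UP L) z n"
    and c: "x \<in> carrier L" "y \<in> carrier L" "z \<in> carrier L" by blast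
  have "l + (n + k) = k + (l + n)" "n + (k + l) = k + (l + n)" by simp_all
  then show "p \<otimes>\<^bsub>lie_poly L\<^esub> (q \<otimes>\<^bsub>lie_poly L\<^esub> r) \<oplus>\<^bsub>lie_poly L\<^esub> q \<otimes>\<^bsub>lie_poly L\<^esub> (r \<otimes>\<^bsub>lie_poly L\<^esub> p)
      \<oplus>\<^bsub>lie_poly L\<^esub> r \<otimes>\<^bsub>lie_poly L\<^esub> (p \<otimes>\<^bsub>lie_poly L\<^esub> q) = \<zero>\<^bsub>lie_poly L\<^esub>"
    using c unfolding eq
    by (simp only: monom_bracket bracket_closed monom_add a_closed jacobi monom_zero)
qed (auto simp: smult_l_null [simplified] smult_one [simplified] mem_upD intro!: ext)

lemma submodule_finsum:
  assumes "submodule H Z2 L" "finite A" "\<And>i. i \<in> A \<Longrightarrow> c i \<in> H"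
  shows "(\<Oplus>i\<in>A. c i) \<in> H"
  using assms(2,3)
proof induction
  case (insert x F)
  then show ?case
    using submodule_subset [OF assms(1)] submodule_add [OF assms(1)]
    by (subst finsum_insert) auto
qed (simp add: submodule_zero [OF assms(1)])

text \<open>The hypotheses supply projections of \<open>L\<close> rather than a bare grading,
  because the projections of the polynomial algebra are assembled from them coefficient by
  coefficient.\<close>

lemma lie_poly_graded:
  assumes D: "\<And>n. submodule (D n) Z2 L"
    and br: "\<And>i j x y. \<lbrakk>x \<in> D i; y \<in> D j\<rbrakk> \<Longrightarrow> x \<otimes> y \<in> D (i + j)"
    and span: "carrier L \<subseteq> add_span L (\<Union>n. D n)"
    and padd: "\<And>n x y. \<lbrakk>x \<in> carrier L; y \<in> carrier L\<rbrakk> \<Longrightarrow> \<pi> n (x \<oplus> y) = \<pi> n x \<oplus> \<pi> n y"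
    and pD: "\<And>n k x. x \<in> D k \<Longrightarrow> \<pi> n x = (if n = k then x else \<zero>)"
  shows "graded_lie_algebra Z2 (lie_poly L) (lie_poly_component L D)"
proof -
  interpret P: lie_algebra_Z2 "lie_poly L"
    by (intro lie_algebra_Z2.intro lie_poly_lie_algebra)
  have DL: "x \<in> carrier L" if "x \<in> D n" for x n
    using D submodule_subset that by blast
  have UL: "(\<Union>n. D n) \<subseteq> carrier L"
    using DL by blast
  have p0: "\<pi> n \<zero> = \<zero>" for n
    using pD [OF submodule_zero [OF D]] by auto
  have pcl: "\<pi> n x \<in> carrier L" if "x \<in> carrier L" for n x
  proof -
    have "x \<in> add_span L (\<Union>n. D n)" using that span by blast
    then show ?thesis
      by induction (auto simp: p0 pD DL padd add_span_closed [OF _ UL])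
  qed
  let ?C = "lie_poly_component L D"
  have C: "p \<in> ?C n \<longleftrightarrow> p \<in> up L \<and> (\<forall>k. if k \<le> n then p k \<in> D (n - k) else p k = \<zero>)" for p n
    by (simp add: lie_poly_component_def)
  show ?thesis
  \<comment> \<open>The part of degree \<open>n\<close> has \<open>\<pi> (n - k) (p k)\<close> as
    its coefficient at exponent \<open>k\<close>. Without the guard \<open>k \<le> n\<close>,
    truncated subtraction would pick up the degree 0 part of the higher coefficients.\<close>
  proof (rule P.graded_by_projections
      [where \<pi> = "\<lambda>n p k. if p \<in> up L \<and> k \<le> n then \<pi> (n - k) (p k) else \<zero>"])
    show "submodule (?C n) Z2 (lie_poly L)" for n
    proof (rule P.Z2_submoduleI)
      show "p \<oplus>\<^bsub>lie_poly L\<^esub> q \<in> ?C n" if "p \<in> ?C n" "q \<in> ?C n" for p q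
      proof -
        have "(if k \<le> n then p k \<oplus> q k \<in> D (n - k) else p k \<oplus> q k = \<zero>)" for k
          using that unfolding C by (metis D submodule_add l_zero zero_closed)
        then show ?thesis
          using that unfolding C by (simp add: lie_poly_add up_add)
      qed
    qed (auto simp: C up_zero submodule_zero [OF D])
    show "p \<otimes>\<^bsub>lie_poly L\<^esub> q \<in> ?C (i + j)" if "p \<in> ?C i" "q \<in> ?C j" for i j p q
    proof -
      have up: "p \<in> up L" "q \<in> up L"
        and p: "\<And>k. k \<le> i \<Longrightarrow> p k \<in> D (i - k)" "\<And>k. i < k \<Longrightarrow> p k = \<zero>"
        and q: "\<And>k. k \<le> j \<Longrightarrow> q k \<in> D (j - k)" "\<And>k. j < k \<Longrightarrow> q k = \<zero>"
        using that by (auto simp: C split: if_splits dest: leD)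
      have c: "p k \<in> carrier L" "q k \<in> carrier L" for k using up by auto
      have zero: "p l \<otimes> q (k - l) = \<zero>" if "i < l \<or> j < k - l" for k l
        using that p q c by (auto simp: bracket_zero_left bracket_zero_right)
      have "(\<Oplus>l\<in>{..k}. p l \<otimes> q (k - l)) \<in> D (i + j - k)" if "k \<le> i + j" for k
      proof (rule submodule_finsum [OF D])
        fix l assume "l \<in> {..k}"
        show "p l \<otimes> q (k - l) \<in> D (i + j - k)"
        proof (cases "i < l \<or> j < k - l")
          case True
          then show ?thesis using zero submodule_zero [OF D] by simp
        next
          case False
          then have "p l \<otimes> q (k - l) \<in> D ((i - l) + (j - (k - l)))"
            by (intro br p q) auto
          moreover have "(i - l) + (j - (k - l)) = i + j - k"
            using False \<open>l \<in> {..k}\<close> that by auto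
          ultimately show ?thesis by simp
        qed
      qed simp
      moreover have "(\<Oplus>l\<in>{..k}. p l \<otimes> q (k - l)) = \<zero>" if "\<not> k \<le> i + j" for k
      proof -
        have "(\<Oplus>l\<in>{..k}. p l \<otimes> q (k - l)) = (\<Oplus>l\<in>{..k}. \<zero>)"
          using that by (intro finsum_cong' zero) auto
        then show ?thesis by simp
      qed
      ultimately show ?thesis
        using up by (simp add: C lie_poly_mult up_mult)
    qed
    show "carrier (lie_poly L) \<subseteq> add_span (lie_poly L) (\<Union>n. ?C n)"
    proof
      fix p assume "p \<in> carrier (lie_poly L)"
      then have "p \<in> add_span (lie_poly L) {up_ring.monom (UP L) x k | x k. x \<in> carrier L}"
        using lie_poly_span by auto
      then show "p \<in> add_span (lie_poly L) (\<Union>n. ?C n)"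
      proof induction
        case (base p)
        then obtain x k where p: "p = up_ring.monom (UP L) x k" "x \<in> carrier L" by blast
        then have "x \<in> add_span L (\<Union>n. D n)" using span by blast
        then have "up_ring.monom (UP L) x k \<in> add_span (lie_poly L) (\<Union>n. ?C n)"
        proof induction
          case zero
          then show ?case by (simp only: monom_zero add_span.zero)
        next
          case (base x)
          then obtain n where n: "x \<in> D n" by blast
          have "up_ring.monom (UP L) x k \<in> ?C (n + k)"
            using n DL [OF n] submodule_zero [OF D] by (auto simp: C monom_UP up_monom)
          then show ?case by (blast intro: add_span.base)
        next
          case (add x y)
          have "x \<in> carrier L" "y \<in> carrier L"
            using add add_span_closed [OF _ UL] by auto
          with add_span.add [OF add.IH] show ?case by (simp only: monom_add)
        qed
        then show ?case by (simp add: p)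
      qed (rule add_span.intros; assumption)+
    qed
  next
    fix n p q assume "p \<in> carrier (lie_poly L)" "q \<in> carrier (lie_poly L)"
    moreover from this have "(\<lambda>k. if p \<in> up L \<and> k \<le> n then \<pi> (n - k) (p k) else \<zero>) \<in> up L"
      "(\<lambda>k. if q \<in> up L \<and> k \<le> n then \<pi> (n - k) (q k) else \<zero>) \<in> up L"
      by (auto intro!: mem_upI exI [of _ n] bound.intro simp: pcl mem_upD)
    ultimately show "(\<lambda>k. if p \<oplus>\<^bsub>lie_poly L\<^esub> q \<in> up L \<and> k \<le> n then \<pi> (n - k) ((p \<oplus>\<^bsub>lie_poly L\<^esub> q) k) else \<zero>)
      = (\<lambda>k. if p \<in> up L \<and> k \<le> n then \<pi> (n - k) (p k) else \<zero>) \<oplus>\<^bsub>lie_poly L\<^esub>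
        (\<lambda>k. if q \<in> up L \<and> k \<le> n then \<pi> (n - k) (q k) else \<zero>)"
      by (auto simp: lie_poly_add up_add padd mem_upD)
  next
    fix n m p assume p: "p \<in> ?C m"
    have "(if p \<in> up L \<and> k \<le> n then \<pi> (n - k) (p k) else \<zero>) = (if n = m then p k else \<zero>)" for k
    proof -
      have k: "if k \<le> m then p k \<in> D (m - k) else p k = \<zero>" and up: "p \<in> up L"
        using p unfolding C by auto
      show ?thesis
      proof (cases "k \<le> m")
        case True
        with k pD [of "p k" "m - k" "n - k"] up show ?thesis by auto
      next
        case False
        with k up show ?thesis by (auto simp: p0)
      qed
    qed
    then show "(\<lambda>k. if p \<in> up L \<and> k \<le> n then \<pi> (n - k) (p k) else \<zero>) = (if n = m then p else \<zero>\<^bsub>lie_poly L\<^esub>)"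
      by (auto intro!: ext)
  qed
qed

end

declare One_nat_def [simp del] \<comment> \<open>it would rewrite \<open>{1..m}\<close> to \<open>{Suc 0..m}\<close>\<close>

section \<open>Free Lie algebras and quotients\<close>

text \<open>Operations on quotients are defined as unions over representatives; independence of the
  representative is what evaluates such a union.\<close>

lemma UN_constant_on: "a \<in> A \<Longrightarrow> (\<And>x. x \<in> A \<Longrightarrow> F x = C) \<Longrightarrow> (\<Union>x\<in>A. F x) = C"
  by auto

lemma image_constant_on: "a \<in> A \<Longrightarrow> (\<And>x. x \<in> A \<Longrightarrow> F x = c) \<Longrightarrow> F ` A = {c}"
  by auto

lemmas lie_eq_axioms =
  lie_eq.add_assoc lie_eq.add_comm lie_eq.add_zero lie_eq.smult_one lie_eq.smult_assoc
  lie_eq.smult_add_left lie_eq.smult_add_right lie_eq.bracket_add_left lie_eq.bracket_add_right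
  lie_eq.bracket_smult_left lie_eq.bracket_smult_right lie_eq.bracket_self lie_eq.jacobi

context
  fixes R :: "('r, 'q) ring_scheme" (structure) and V :: "'x set"
  assumes R: "cring R"
begin

interpretation cring R by (rule R)

lemma lie_class_eqI: "lie_eq R V a b \<Longrightarrow> lie_class R V a = lie_class R V b"
  unfolding lie_class_def by (blast intro: lie_eq.sym lie_eq.trans)

lemma lie_class_self: "a \<in> lie_terms R V \<Longrightarrow> a \<in> lie_class R V a"
  by (simp add: lie_class_def lie_eq.refl)

lemma free_lie_ops:
  assumes "a \<in> lie_terms R V" "b \<in> lie_terms R V"
  shows "lie_class R V a \<oplus>\<^bsub>free_lie R V\<^esub> lie_class R V b = lie_class R V (Add a b)"
    and "lie_class R V a \<otimes>\<^bsub>free_lie R V\<^esub> lie_class R V b = lie_class R V (Bracket a b)"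
    and "r \<in> carrier R \<Longrightarrow> r \<odot>\<^bsub>free_lie R V\<^esub> lie_class R V a = lie_class R V (Smult r a)"
proof -
  have *: "a \<in> lie_class R V a" "b \<in> lie_class R V b"
    using assms by (auto intro: lie_class_self)
  have eqs: "lie_class R V (Add a' b') = lie_class R V (Add a b)"
    "lie_class R V (Bracket a' b') = lie_class R V (Bracket a b)"
    "r \<in> carrier R \<Longrightarrow> lie_class R V (Smult r a') = lie_class R V (Smult r a)"
    if "a' \<in> lie_class R V a" "b' \<in> lie_class R V b" for a' b'
    using that unfolding lie_class_def [of _ _ a] lie_class_def [of _ _ b] mem_Collect_eq
    by (auto intro!: lie_class_eqI intro: lie_eq.sym lie_eq.add_cong lie_eq.bracket_cong lie_eq.smult_cong)
  show "lie_class R V a \<oplus>\<^bsub>free_lie R V\<^esub> lie_class R V b = lie_class R V (Add a b)"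
    unfolding free_lie_def ring.simps
    by (rule UN_constant_on [OF *(1)], rule UN_constant_on [OF *(2)], rule eqs(1))
  show "lie_class R V a \<otimes>\<^bsub>free_lie R V\<^esub> lie_class R V b = lie_class R V (Bracket a b)"
    unfolding free_lie_def monoid.simps
    by (rule UN_constant_on [OF *(1)], rule UN_constant_on [OF *(2)], rule eqs(2))
  show "r \<in> carrier R \<Longrightarrow> r \<odot>\<^bsub>free_lie R V\<^esub> lie_class R V a = lie_class R V (Smult r a)"
    unfolding free_lie_def module.simps
    by (rule UN_constant_on [OF *(1)], rule eqs(3) [OF _ *(2)])
qed

lemma free_lie_smult:
  "r \<in> carrier R \<Longrightarrow> a \<in> lie_terms R V \<Longrightarrow> r \<odot>\<^bsub>free_lie R V\<^esub> lie_class R V a = lie_class R V (Smult r a)"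
  using free_lie_ops(3) by blast

lemma free_lie_carrier: "carrier (free_lie R V) = lie_class R V ` lie_terms R V"
  and free_lie_zero: "\<zero>\<^bsub>free_lie R V\<^esub> = lie_class R V Zero"
  by (simp_all add: free_lie_def)

lemma free_lie_lie_algebra: "lie_algebra R (free_lie R V)"
proof -
  note simps = free_lie_ops free_lie_zero lie_terms.intros
  have "abelian_group (free_lie R V)"
  proof (rule abelian_groupI)
    fix x assume "x \<in> carrier (free_lie R V)"
    then obtain a where a: "a \<in> lie_terms R V" "x = lie_class R V a"
      by (auto simp: free_lie_carrier)
    have m: "\<ominus> \<one> \<in> carrier R" by simp
    \<comment> \<open>Terms have no negation, so the inverse is \<open>-1\<close> times
      \<open>a\<close>: the sum is \<open>(-1 + 1) a\<close>, that is \<open>0 a\<close>.\<close>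
    have "lie_eq R V (Add (Smult (\<ominus> \<one>) a) a) (Add (Smult (\<ominus> \<one>) a) (Smult \<one> a))"
      by (intro lie_eq.add_cong lie_eq.refl lie_eq.sym [OF lie_eq.smult_one] m a lie_terms.intros)
    then have "lie_eq R V (Add (Smult (\<ominus> \<one>) a) a) (Smult (\<ominus> \<one> \<oplus> \<one>) a)"
      by (rule lie_eq.trans) (intro lie_eq.sym [OF lie_eq.smult_add_left] m a one_closed)
    then have zero: "lie_eq R V (Add (Smult (\<ominus> \<one>) a) a) Zero"
      using lie_eq.smult_zero [OF a(1)] by (auto simp: l_neg intro: lie_eq.trans)
    show "\<exists>y\<in>carrier (free_lie R V). y \<oplus>\<^bsub>free_lie R V\<^esub> x = \<zero>\<^bsub>free_lie R V\<^esub>"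
      using a m by (intro bexI [of _ "lie_class R V (Smult (\<ominus> \<one>) a)"])
        (simp_all add: simps free_lie_carrier lie_class_eqI [OF zero])
  qed (auto simp: free_lie_carrier simps intro!: imageI lie_class_eqI intro: lie_eq_axioms del: equalityI)
  then have "module R (free_lie R V)"
    by (intro moduleI R)
      (auto simp: free_lie_carrier simps intro!: imageI lie_class_eqI intro: lie_eq_axioms del: equalityI)
  then show ?thesis
    by (intro lie_algebra.intro lie_algebra_axioms.intro)
      (auto simp: free_lie_carrier simps intro!: imageI lie_class_eqI intro: lie_eq_axioms del: equalityI)
qed

end

section \<open>Evaluation of Lie terms and the universal property of the free Lie algebra\<close>

primrec lie_eval ::
    "('r, 'a, 'm) module_scheme \<Rightarrow> ('x \<Rightarrow> 'a) \<Rightarrow> ('r, 'x) lie_term \<Rightarrow> 'a" where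
  "lie_eval B f (Gen x) = f x"
| "lie_eval B f Zero = \<zero>\<^bsub>B\<^esub>"
| "lie_eval B f (Add a b) = lie_eval B f a \<oplus>\<^bsub>B\<^esub> lie_eval B f b"
| "lie_eval B f (Smult r a) = r \<odot>\<^bsub>B\<^esub> lie_eval B f a"
| "lie_eval B f (Bracket a b) = lie_eval B f a \<otimes>\<^bsub>B\<^esub> lie_eval B f b"

context lie_algebra
begin

lemma lie_eval_closed:
  assumes "f \<in> V \<rightarrow> carrier L" "a \<in> lie_terms R V"
  shows "lie_eval L f a \<in> carrier L"
  using assms(2) by induction (use assms(1) in \<open>auto intro: bracket_closed\<close>)

text \<open>Every rule generating \<open>lie_eq\<close> is an identity of Lie algebras, so
  evaluation descends to classes.\<close>

lemma lie_eval_cong: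
  assumes f: "f \<in> V \<rightarrow> carrier L" and "lie_eq R V a b"
  shows "lie_eval L f a = lie_eval L f b"
  using assms(2)
proof induction
  case (add_comm a b)
  then show ?case by (simp add: M.a_comm lie_eval_closed [OF f])
next
  case (jacobi a b c)
  then show ?case by (simp add: lie_algebra.jacobi [OF lie_algebra_axioms] lie_eval_closed [OF f])
qed (simp_all add: lie_eval_closed [OF f] M.a_assoc smult_assoc1 smult_l_distr smult_r_distr
      bracket_add_left bracket_add_right bracket_smult_left bracket_smult_right bracket_self)

text \<open>Existence half of the universal property. On a class the value is the only element of
  its image under evaluation.\<close>

lemma free_lie_hom:
  assumes f: "f \<in> V \<rightarrow> carrier L"
  obtains g where "lie_algebra_hom R (free_lie R V) L g"
    and "\<And>x. x \<in> V \<Longrightarrow> g (free_lie_gen R V x) = f x"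
proof -
  define g where "g A = (THE y. lie_eval L f ` A = {y})" for A
  have g: "g (lie_class R V a) = lie_eval L f a" if "a \<in> lie_terms R V" for a
  proof -
    have "lie_eval L f ` lie_class R V a = {lie_eval L f a}"
      by (rule image_constant_on [OF lie_class_self [OF is_cring that]])
        (simp add: lie_class_def lie_eval_cong [OF f lie_eq.sym])
    then show ?thesis by (simp add: g_def)
  qed
  have "lie_algebra_hom R (free_lie R V) L g"
    by (intro lie_algebra_hom.intro lie_algebra_hom_axioms.intro free_lie_lie_algebra is_cring
        lie_algebra_axioms)
      (auto simp: free_lie_carrier [OF is_cring] free_lie_ops [OF is_cring] g
        lie_terms.intros lie_eval_closed [OF f])
  moreover have "g (free_lie_gen R V x) = f x" if "x \<in> V" for x
    using that by (simp add: free_lie_gen_def g lie_terms.intros)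
  ultimately show ?thesis using that by blast
qed

end

section \<open>Ideals, quotients and homogeneous elements\<close>

context lie_algebra_Z2
begin

lemma lie_ideal_generated_lie_ideal:
  assumes "S \<subseteq> carrier L"
  shows "lie_ideal Z2 L (lie_ideal_generated Z2 L S)" "S \<subseteq> lie_ideal_generated Z2 L S"
proof -
  have c: "lie_ideal Z2 L (carrier L)"
    by (simp add: lie_ideal_def carrier_is_submodule bracket_closed)
  have "submodule (lie_ideal_generated Z2 L S) Z2 L"
  proof (rule Z2_submoduleI)
    show "lie_ideal_generated Z2 L S \<subseteq> carrier L"
      using c assms by (auto simp: lie_ideal_generated_def)
  qed (auto simp: lie_ideal_generated_def lie_ideal_def submodule_zero submodule_add)
  then show "lie_ideal Z2 L (lie_ideal_generated Z2 L S)"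
    by (auto simp: lie_ideal_def lie_ideal_generated_def)
qed (auto simp: lie_ideal_generated_def)

context
  fixes I assumes I: "lie_ideal Z2 L I"
begin

lemma ideal_closed: "x \<in> I \<Longrightarrow> x \<in> carrier L"
  and ideal_bracket_right: "x \<in> carrier L \<Longrightarrow> y \<in> I \<Longrightarrow> x \<otimes> y \<in> I"
  and ideal_bracket_left: "x \<in> carrier L \<Longrightarrow> y \<in> I \<Longrightarrow> y \<otimes> x \<in> I"
  and ideal_zero: "\<zero> \<in> I"
proof -
  have I': "submodule I Z2 L" "\<And>x y. x \<in> carrier L \<Longrightarrow> y \<in> I \<Longrightarrow> x \<otimes> y \<in> I"
    using I by (auto simp: lie_ideal_def)
  show c: "x \<in> carrier L" if "x \<in> I" for x
    using I'(1) that submodule_subset by blast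
  show "x \<otimes> y \<in> I" if "x \<in> carrier L" "y \<in> I" for x y
    using I' that by blast
  show "y \<otimes> x \<in> I" if "x \<in> carrier L" "y \<in> I" for x y
    using I'(2) that bracket_commute [of y x] c by simp
  show "\<zero> \<in> I"
    using I'(1) submodule_zero by blast
qed

lemma ideal_abelian_subgroup: "abelian_subgroup I L"
  using I by (intro abelian_subgroupI3 additive_subgroup.intro abelian_group_axioms)
    (auto simp: lie_ideal_def dest: submodule.axioms)

interpretation ideal: abelian_subgroup I L by (rule ideal_abelian_subgroup)

lemma coset_absorb: "h \<in> I \<Longrightarrow> x \<in> carrier L \<Longrightarrow> I +> (h \<oplus> x) = I +> x"
  by (rule a_repr_independence [symmetric]) (auto simp: a_r_coset_def' ideal.a_subgroup)

lemma coset_elem: "y \<in> I +> x \<Longrightarrow> \<exists>h\<in>I. y = h \<oplus> x"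
  by (auto simp: a_r_coset_def')

lemma UN_coset_const:
  assumes "x \<in> carrier L" "\<And>h. h \<in> I \<Longrightarrow> F (h \<oplus> x) = F x"
  shows "(\<Union>a\<in>I +> x. F a) = F x"
  by (rule UN_constant_on [OF ideal.a_rcos_self [OF assms(1)]]) (use assms(2) coset_elem in blast)

lemma lie_quotient_carrier: "carrier (lie_quotient L I) = (\<lambda>x. I +> x) ` carrier L"
  by (auto simp: lie_quotient_def A_RCOSETS_def')

lemma lie_quotient_zero: "\<zero>\<^bsub>lie_quotient L I\<^esub> = I +> \<zero>"
  by (simp add: lie_quotient_def ideal.a_rcos_const ideal_zero)

text \<open>Changing one factor by an element of the ideal changes the bracket by an element of the
  ideal; the bracket is commutative in characteristic 2, so the one-sided condition in
  \<open>lie_ideal\<close> covers both factors.\<close>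

lemma lie_quotient_ops:
  assumes "x \<in> carrier L" "y \<in> carrier L"
  shows "(I +> x) \<oplus>\<^bsub>lie_quotient L I\<^esub> (I +> y) = I +> (x \<oplus> y)"
    and "(I +> x) \<otimes>\<^bsub>lie_quotient L I\<^esub> (I +> y) = I +> (x \<otimes> y)"
    and "r \<in> carrier Z2 \<Longrightarrow> r \<odot>\<^bsub>lie_quotient L I\<^esub> (I +> x) = I +> (r \<odot> x)"
proof -
  show "(I +> x) \<oplus>\<^bsub>lie_quotient L I\<^esub> (I +> y) = I +> (x \<oplus> y)"
    using assms by (simp add: lie_quotient_def ideal.a_rcos_sum)
  have 1: "I +> ((h \<oplus> x) \<otimes> z) = I +> (x \<otimes> z)" if "h \<in> I" "x \<in> carrier L" "z \<in> carrier L" for h x z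
    using that by (simp add: bracket_add_left ideal_closed coset_absorb ideal_bracket_left bracket_closed)
  have 2: "I +> (x \<otimes> (h \<oplus> y)) = I +> (x \<otimes> y)" if "h \<in> I" for h
    using that assms by (simp add: bracket_add_right ideal_closed coset_absorb ideal_bracket_right bracket_closed)
  have "(I +> x) \<otimes>\<^bsub>lie_quotient L I\<^esub> (I +> y) = (\<Union>a\<in>I +> x. \<Union>b\<in>I +> y. I +> (a \<otimes> b))"
    by (simp add: lie_quotient_def rcoset_mult_def)
  also have "\<dots> = (\<Union>b\<in>I +> y. I +> (x \<otimes> b))"
  proof (rule UN_coset_const [OF assms(1)])
    fix h assume h: "h \<in> I"
    have "I +> ((h \<oplus> x) \<otimes> b) = I +> (x \<otimes> b)" if "b \<in> I +> y" for b
      using coset_elem [OF that] assms h ideal_closed by (auto intro!: 1 del: equalityI)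
    then show "(\<Union>b\<in>I +> y. I +> ((h \<oplus> x) \<otimes> b)) = (\<Union>b\<in>I +> y. I +> (x \<otimes> b))"
      by simp
  qed
  also have "\<dots> = I +> (x \<otimes> y)"
    using assms 2 by (intro UN_coset_const) auto
  finally show "(I +> x) \<otimes>\<^bsub>lie_quotient L I\<^esub> (I +> y) = I +> (x \<otimes> y)" .
  show "r \<odot>\<^bsub>lie_quotient L I\<^esub> (I +> x) = I +> (r \<odot> x)" if "r \<in> carrier Z2"
  proof -
    have "(\<Union>a\<in>I +> x. I +> (r \<odot> a)) = I +> (r \<odot> x)"
      using assms that ideal_closed
      by (intro UN_coset_const) (auto simp: smult_Z2 [unfolded Z2_simps] coset_absorb)
    then show ?thesis by (simp add: lie_quotient_def)
  qed
qed

lemma lie_quotient_smult: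
  "r \<in> carrier Z2 \<Longrightarrow> x \<in> carrier L \<Longrightarrow> r \<odot>\<^bsub>lie_quotient L I\<^esub> (I +> x) = I +> (r \<odot> x)"
  using lie_quotient_ops(3) by blast

lemma lie_quotient_lie_algebra: "lie_algebra Z2 (lie_quotient L I)"
proof -
  note simps = lie_quotient_ops lie_quotient_zero lie_quotient_carrier
  have "abelian_group (lie_quotient L I)"
  proof (rule abelian_groupI)
    fix U assume "U \<in> carrier (lie_quotient L I)"
    then show "\<exists>Y\<in>carrier (lie_quotient L I). Y \<oplus>\<^bsub>lie_quotient L I\<^esub> U = \<zero>\<^bsub>lie_quotient L I\<^esub>"
      by (intro bexI [of _ U]) (auto simp: simps add_self)
  qed (auto simp: simps a_ac)
  then have "abelian_2_group (lie_quotient L I)"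
    by (intro abelian_2_group.intro abelian_2_group_axioms.intro) (auto simp: simps add_self)
  then show ?thesis
  proof (rule lie_algebra_Z2I [of _ "carrier (lie_quotient L I)"])
    fix U W assume "U \<in> carrier (lie_quotient L I)" "W \<in> carrier (lie_quotient L I)"
    then show "U \<otimes>\<^bsub>lie_quotient L I\<^esub> W = W \<otimes>\<^bsub>lie_quotient L I\<^esub> U"
      using bracket_commute by (force simp: simps)
  qed (auto simp: simps bracket_closed bracket_add_left bracket_add_right smult_Z2 [unfolded Z2_simps]
        bracket_self jacobi intro: add_span.base)
qed

lemma lie_quotient_hom:
  assumes "lie_algebra_hom Z2 L B g" "\<And>x. x \<in> I \<Longrightarrow> g x = \<zero>\<^bsub>B\<^esub>"
  obtains f where "lie_algebra_hom Z2 (lie_quotient L I) B f"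
    and "\<And>x. x \<in> carrier L \<Longrightarrow> f (I +> x) = g x"
proof -
  interpret g: lie_algebra_hom Z2 L B g by fact
  define f where "f A = (THE y. g ` A = {y})" for A
  have f: "f (I +> x) = g x" if "x \<in> carrier L" for x
  proof -
    have "g y = g x" if y: "y \<in> I +> x" for y
      using coset_elem [OF y] \<open>x \<in> carrier L\<close> assms(2) by (auto simp: g.hom_add g.hom_closed ideal_closed)
    then have "g ` (I +> x) = {g x}"
      by (rule image_constant_on [OF ideal.a_rcos_self [OF that]])
    then show ?thesis by (simp add: f_def)
  qed
  have "lie_algebra_hom Z2 (lie_quotient L I) B f"
    by (intro lie_algebra_hom.intro lie_algebra_hom_axioms.intro lie_quotient_lie_algebra
        g.cod.lie_algebra_axioms)
      (use smult_closed in \<open>auto simp: lie_quotient_carrier lie_quotient_ops [unfolded Z2_simps] f g.hom_closed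
        g.hom_add g.hom_bracket g.hom_smult [unfolded Z2_simps] bracket_closed\<close>)
  with f show ?thesis using that by blast
qed

end

text \<open>Needed to see that sums of homogeneous elements of \<open>N\<close> form a
  subalgebra.\<close>

lemma add_span_bracket:
  assumes "S \<subseteq> carrier L" "\<And>x y. \<lbrakk>x \<in> S; y \<in> S\<rbrakk> \<Longrightarrow> x \<otimes> y \<in> add_span L S"
    and "x \<in> add_span L S" "y \<in> add_span L S"
  shows "x \<otimes> y \<in> add_span L S"
proof -
  have c: "x \<in> carrier L" if "x \<in> add_span L S" for x
    using add_span_closed [OF that assms(1)] .
  have 1: "x \<otimes> y \<in> add_span L S" if "y \<in> S" for y
    using assms(3)
  proof induction
    case zero
    then show ?case using c [OF add_span.base [OF that]] by (auto simp: bracket_zero_left intro: add_span.zero)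
  next
    case (add x z)
    then show ?case using c [OF add_span.base [OF that]] c by (auto simp: bracket_add_left intro: add_span.add)
  qed (simp add: assms(2) that)
  show ?thesis
    using assms(4)
  proof induction
    case zero
    then show ?case using assms(3) c by (auto simp: bracket_zero_right intro: add_span.zero)
  next
    case (add y z)
    then show ?case using assms(3) c by (auto simp: bracket_add_right intro: add_span.add)
  qed (simp add: 1)
qed

lemma homogeneous_carrier:
  "homogeneous Z2 L S n x \<Longrightarrow> S \<subseteq> carrier L \<Longrightarrow> x \<in> carrier L"
  by (induction rule: homogeneous.induct) (auto intro: bracket_closed smult_closed)

lemma homogeneous_submodule:
  "S \<subseteq> carrier L \<Longrightarrow> submodule {x. homogeneous Z2 L S n x} Z2 L"
  by (rule Z2_submoduleI) (auto intro: homogeneous.intros homogeneous_carrier)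

end

text \<open>\<open>add_span\<close> mentions only zero and addition, and these do not change on
  passing to a subalgebra.\<close>

lemma add_span_carrier_update: "add_span (L\<lparr>carrier := H\<rparr>) S = add_span L S"
proof -
  have "x \<in> add_span (L\<lparr>carrier := H\<rparr>) S \<Longrightarrow> x \<in> add_span L S" for x
    by (induction rule: add_span.induct) (auto intro: add_span.intros)
  moreover have "x \<in> add_span L S \<Longrightarrow> x \<in> add_span (L\<lparr>carrier := H\<rparr>) S" for x
    by (induction rule: add_span.induct)
      (auto intro: add_span.base add_span.zero [of "L\<lparr>carrier := H\<rparr>", simplified]
        add_span.add [of _ "L\<lparr>carrier := H\<rparr>", simplified])
  ultimately show ?thesis by blast
qed

section \<open>Graph Lie algebras\<close>

lemma free_lie_gen_closed: "x \<in> V \<Longrightarrow> free_lie_gen Z2 V x \<in> carrier (free_lie Z2 V)"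
  by (simp add: free_lie_gen_def free_lie_carrier [OF cring_Z2] lie_terms.intros)

lemma lie_algebra_hom_zero:
  assumes "lie_algebra_hom Z2 A B f" shows "f \<zero>\<^bsub>A\<^esub> = \<zero>\<^bsub>B\<^esub>"
proof -
  interpret lie_algebra_hom Z2 A B f by fact
  interpret B: lie_algebra_Z2 B by (intro lie_algebra_Z2.intro cod.lie_algebra_axioms)
  show ?thesis
    using hom_add [of "\<zero>\<^bsub>A\<^esub>" "\<zero>\<^bsub>A\<^esub>"] hom_closed [of "\<zero>\<^bsub>A\<^esub>"] B.add_self by simp
qed

locale graph_lie_algebra =
  fixes m :: nat and K :: "nat set set"
  assumes complex: "simplicial_complex m K"
begin

abbreviation F where "F \<equiv> free_lie Z2 {1..m}"
abbreviation I where "I \<equiv> graph_lie_ideal m K"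
abbreviation L where "L \<equiv> graph_lie m K"

sublocale F: lie_algebra_Z2 F
  by (intro lie_algebra_Z2.intro free_lie_lie_algebra cring_Z2)

lemma edge_vertices: "{i, j} \<in> K \<Longrightarrow> i \<in> {1..m} \<and> j \<in> {1..m}"
  using complex by (auto simp: simplicial_complex_def)

lemma relators_closed:
  "{free_lie_gen Z2 {1..m} i \<otimes>\<^bsub>F\<^esub> free_lie_gen Z2 {1..m} j | i j. {i, j} \<in> K} \<subseteq> carrier F"
  using edge_vertices by (blast intro: F.bracket_closed free_lie_gen_closed)

lemma graph_ideal: "lie_ideal Z2 F I"
  unfolding graph_lie_ideal_def by (rule F.lie_ideal_generated_lie_ideal [OF relators_closed])

sublocale L: lie_algebra_Z2 L
  unfolding graph_lie_def by (intro lie_algebra_Z2.intro F.lie_quotient_lie_algebra graph_ideal)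

lemma mu_closed: "i \<in> {1..m} \<Longrightarrow> mu m K i \<in> carrier L"
  by (simp add: mu_def graph_lie_def F.lie_quotient_carrier [OF graph_ideal] free_lie_gen_closed
      del: atLeastAtMost_iff)

lemma mu_commute:
  assumes "{i, j} \<in> K" shows "mu m K i \<otimes>\<^bsub>L\<^esub> mu m K j = \<zero>\<^bsub>L\<^esub>"
proof -
  let ?g = "free_lie_gen Z2 {1..m}"
  have c: "?g i \<in> carrier F" "?g j \<in> carrier F"
    using edge_vertices [OF assms] by (simp_all add: free_lie_gen_closed del: atLeastAtMost_iff)
  have "?g i \<otimes>\<^bsub>F\<^esub> ?g j \<in> I"
    unfolding graph_lie_ideal_def
    using F.lie_ideal_generated_lie_ideal(2) [OF relators_closed] assms by blast
  then have "I +>\<^bsub>F\<^esub> (?g i \<otimes>\<^bsub>F\<^esub> ?g j \<oplus>\<^bsub>F\<^esub> \<zero>\<^bsub>F\<^esub>) = I +>\<^bsub>F\<^esub> \<zero>\<^bsub>F\<^esub>"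
    by (rule F.coset_absorb [OF graph_ideal]) simp
  then show ?thesis
    using c by (simp add: mu_def graph_lie_def F.lie_quotient_ops [OF graph_ideal]
        F.lie_quotient_zero [OF graph_ideal] F.bracket_closed)
qed

text \<open>Every element is the class of a Lie term. Scalar multiples require no case of their own,
  since the scalar is 0 or 1.\<close>

lemma graph_lie_induct [consumes 1, case_names zero mu add bracket]:
  assumes "x \<in> carrier L"
    and "P \<zero>\<^bsub>L\<^esub>" "\<And>i. i \<in> {1..m} \<Longrightarrow> P (mu m K i)"
    and add: "\<And>x y. \<lbrakk>x \<in> carrier L; y \<in> carrier L; P x; P y\<rbrakk> \<Longrightarrow> P (x \<oplus>\<^bsub>L\<^esub> y)"
    and bracket: "\<And>x y. \<lbrakk>x \<in> carrier L; y \<in> carrier L; P x; P y\<rbrakk> \<Longrightarrow> P (x \<otimes>\<^bsub>L\<^esub> y)"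
  shows "P x"
proof -
  let ?c = "\<lambda>t. I +>\<^bsub>F\<^esub> lie_class Z2 {1..m} t"
  have cF: "lie_class Z2 {1..m} t \<in> carrier F" if "t \<in> lie_terms Z2 {1..m}" for t
    using that by (simp add: free_lie_carrier [OF cring_Z2])
  have c: "?c t \<in> carrier L" if "t \<in> lie_terms Z2 {1..m}" for t
    using cF [OF that] by (simp add: graph_lie_def F.lie_quotient_carrier [OF graph_ideal])
  note ops = F.lie_quotient_ops [OF graph_ideal cF cF, folded graph_lie_def]
    free_lie_ops [OF cring_Z2]
  have "P (?c t)" if "t \<in> lie_terms Z2 {1..m}" for t
    using that
  proof induction
    case (1 x)
    then show ?case using assms(3) by (simp add: mu_def free_lie_gen_def)
  next
    case 2
    then show ?case using assms(2)
      by (simp add: graph_lie_def F.lie_quotient_zero [OF graph_ideal] free_lie_zero [OF cring_Z2])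
  next
    case (3 a b)
    then show ?case using add [OF c c] by (simp add: ops)
  next
    case (4 r a)
    have "?c (Smult r a) = r \<odot>\<^bsub>L\<^esub> ?c a"
      using F.lie_quotient_smult [OF graph_ideal 4(1) cF [OF 4(2)]] free_lie_smult [OF cring_Z2 4(1,2)]
      by (simp add: graph_lie_def)
    then show ?case
      using 4 assms(2) L.smult_Z2 [OF c, of a r] by simp
  next
    case (5 a b)
    then show ?case using bracket [OF c c] by (simp add: ops)
  qed
  moreover obtain t where "t \<in> lie_terms Z2 {1..m}" "x = ?c t"
    using assms(1)
    by (auto simp: graph_lie_def F.lie_quotient_carrier [OF graph_ideal] free_lie_carrier [OF cring_Z2])
  ultimately show ?thesis by simp
qed

text \<open>The induced map on the free Lie algebra has a kernel that is an ideal containing the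
  relators, so it factors through the quotient.\<close>

lemma graph_lie_hom:
  assumes B: "lie_algebra Z2 B" and b: "b \<in> {1..m} \<rightarrow> carrier B"
    and rel: "\<And>i j. {i, j} \<in> K \<Longrightarrow> b i \<otimes>\<^bsub>B\<^esub> b j = \<zero>\<^bsub>B\<^esub>"
  obtains f where "lie_algebra_hom Z2 L B f" "\<And>i. i \<in> {1..m} \<Longrightarrow> f (mu m K i) = b i"
proof -
  interpret B: lie_algebra_Z2 B by (intro lie_algebra_Z2.intro B)
  obtain g where g: "lie_algebra_hom Z2 F B g" "\<And>i. i \<in> {1..m} \<Longrightarrow> g (free_lie_gen Z2 {1..m} i) = b i"
    using B.free_lie_hom [OF b] by blast
  interpret g: lie_algebra_hom Z2 F B g by fact
  let ?ker = "{x \<in> carrier F. g x = \<zero>\<^bsub>B\<^esub>}"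
  have "submodule ?ker Z2 F"
    by (rule F.Z2_submoduleI) (auto simp: g.hom_add lie_algebra_hom_zero [OF g(1)])
  then have "lie_ideal Z2 F ?ker"
    by (auto simp: lie_ideal_def F.bracket_closed g.hom_bracket g.hom_closed B.bracket_zero_right)
  moreover have "free_lie_gen Z2 {1..m} i \<otimes>\<^bsub>F\<^esub> free_lie_gen Z2 {1..m} j \<in> ?ker"
    if e: "{i, j} \<in> K" for i j
    using edge_vertices [OF e]
    by (simp add: g.hom_bracket free_lie_gen_closed g(2) rel [OF e] F.bracket_closed
        del: atLeastAtMost_iff)
  ultimately have "I \<subseteq> ?ker"
    unfolding graph_lie_ideal_def lie_ideal_generated_def by blast
  then obtain f where f: "lie_algebra_hom Z2 L B f" "\<And>x. x \<in> carrier F \<Longrightarrow> f (I +>\<^bsub>F\<^esub> x) = g x"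
    using F.lie_quotient_hom [OF graph_ideal g(1)] unfolding graph_lie_def by blast
  moreover have "f (mu m K i) = b i" if "i \<in> {1..m}" for i
    using that by (simp add: mu_def f(2) g(2) free_lie_gen_closed del: atLeastAtMost_iff)
  ultimately show ?thesis using that by blast
qed

lemma graph_lie_hom_unique:
  assumes "lie_algebra_hom Z2 L B f" "lie_algebra_hom Z2 L B g"
    and "\<And>i. i \<in> {1..m} \<Longrightarrow> f (mu m K i) = g (mu m K i)" and "x \<in> carrier L"
  shows "f x = g x"
proof -
  interpret f: lie_algebra_hom Z2 L B f by fact
  interpret g: lie_algebra_hom Z2 L B g by fact
  show ?thesis
    using assms(4)
    by (induction rule: graph_lie_induct)
      (simp_all add: assms(3) f.hom_add g.hom_add f.hom_bracket g.hom_bracket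
        lie_algebra_hom_zero [OF assms(1)] lie_algebra_hom_zero [OF assms(2)])
qed

section \<open>The grading of the graph Lie algebra\<close>

abbreviation D where "D \<equiv> graph_lie_component m K"

lemma mu_subset: "mu m K ` {1..m} \<subseteq> carrier L"
  using mu_closed by blast

lemma component_submodule: "submodule (D n) Z2 L"
  unfolding graph_lie_component_def by (rule L.homogeneous_submodule [OF mu_subset])

lemma component_bracket: "x \<in> D i \<Longrightarrow> y \<in> D j \<Longrightarrow> x \<otimes>\<^bsub>L\<^esub> y \<in> D (i + j)"
  unfolding graph_lie_component_def by (auto intro: homogeneous.bracket)

lemma mu_component: "i \<in> {1..m} \<Longrightarrow> mu m K i \<in> D 1"
  unfolding graph_lie_component_def by (auto intro!: homogeneous.gen)

lemma components_closed: "(\<Union>n. D n) \<subseteq> carrier L"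
  using component_submodule L.submodule_subset by blast

text \<open>The homomorphism \<open>L \<rightarrow> L[t]\<close> with \<open>\<mu>\<^sub>i \<mapsto> \<mu>\<^sub>i t\<close> multiplies the degree \<open>n\<close> part by \<open>t\<^sup>n\<close>, so its
  coefficients are the projections onto the homogeneous components.\<close>

lemma component_projections:
  obtains \<pi> where "\<And>n x y. \<lbrakk>x \<in> carrier L; y \<in> carrier L\<rbrakk> \<Longrightarrow> \<pi> n (x \<oplus>\<^bsub>L\<^esub> y) = \<pi> n x \<oplus>\<^bsub>L\<^esub> \<pi> n y"
    and "\<And>(n::nat) k x. x \<in> D k \<Longrightarrow> \<pi> n x = (if n = k then x else \<zero>\<^bsub>L\<^esub>)"
proof -
  let ?P = "lie_poly L" and ?m = "up_ring.monom (UP L)"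
  have P: "lie_algebra Z2 ?P" by (rule L.lie_poly_lie_algebra)
  obtain f where f: "lie_algebra_hom Z2 L ?P f" "\<And>i. i \<in> {1..m} \<Longrightarrow> f (mu m K i) = ?m (mu m K i) 1"
  proof (rule graph_lie_hom [OF P, of "\<lambda>i. ?m (mu m K i) 1"])
    show "(\<lambda>i. ?m (mu m K i) 1) \<in> {1..m} \<rightarrow> carrier ?P"
      using mu_closed by (auto simp: monom_UP L.up_monom simp del: atLeastAtMost_iff)
    show "?m (mu m K i) 1 \<otimes>\<^bsub>?P\<^esub> ?m (mu m K j) 1 = \<zero>\<^bsub>?P\<^esub>" if "{i, j} \<in> K" for i j
      using that edge_vertices [OF that] mu_closed
      by (simp only: L.monom_bracket mu_commute L.monom_zero)
  qed blast
  interpret f: lie_algebra_hom Z2 L ?P f by fact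
  have mon: "f x = ?m x n" if "x \<in> D n" for x n
  proof -
    have "homogeneous Z2 L (mu m K ` {1..m}) n x"
      using that by (simp add: graph_lie_component_def)
    then show ?thesis
    proof induction
      case (gen x)
      then show ?case using f(2) by auto
    next
      case (zero n)
      then show ?case by (simp only: lie_algebra_hom_zero [OF f(1)] L.monom_zero)
    next
      case (add n x y)
      then show ?case
        using L.homogeneous_carrier [OF _ mu_subset] by (simp add: f.hom_add L.monom_add)
    next
      case (smult r n x)
      moreover from this have "x \<in> carrier L"
        using L.homogeneous_carrier [OF _ mu_subset] by simp
      ultimately show ?case
        using lie_algebra_hom_zero [OF f(1)] L.smult_Z2 [of x r]
        by (auto simp: L.monom_zero simp del: lie_poly_simps)
    next
      case (bracket i x j y)
      then show ?case
        using L.homogeneous_carrier [OF _ mu_subset] by (simp add: f.hom_bracket L.monom_bracket)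
    qed
  qed
  show ?thesis
  proof (rule that [of "\<lambda>n x. f x n"])
    show "f (x \<oplus>\<^bsub>L\<^esub> y) n = f x n \<oplus>\<^bsub>L\<^esub> f y n" if "x \<in> carrier L" "y \<in> carrier L" for n x y
      using that f.hom_closed by (simp add: f.hom_add lie_poly_add)
    show "f x n = (if n = k then x else \<zero>\<^bsub>L\<^esub>)" if "x \<in> D k" for n k x
    proof -
      have "x \<in> carrier L" using that components_closed by blast
      then show ?thesis by (simp add: mon [OF that] monom_UP)
    qed
  qed
qed

section \<open>The GPTW generators and the subalgebra they generate\<close>

lemma nested_bracket_component:
  assumes "set ts \<subseteq> {1..m}" "x \<in> D n"
  shows "foldr (\<lambda>t y. mu m K t \<otimes>\<^bsub>L\<^esub> y) ts x \<in> D (length ts + n)"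
  using assms(1)
proof (induction ts)
  case (Cons t ts)
  then show ?case
    using component_bracket [OF mu_component [of t], of _ "length ts + n"] by (simp add: plus_1_eq_Suc)
qed (simp add: assms(2))

lemma GPTW_component: "x \<in> GPTW m K \<Longrightarrow> \<exists>n. x \<in> D n"
proof -
  assume "x \<in> GPTW m K"
  then obtain J j where J: "J \<subseteq> {1..m}" "j \<in> Theta K J"
    and x: "x = nested_bracket L (mu m K) (J - {j}) (mu m K j)"
    by (auto simp: GPTW_def)
  have "set (sorted_list_of_set (J - {j})) \<subseteq> {1..m}" "j \<in> {1..m}"
    using J finite_subset [OF J(1)] by (auto simp: Theta_def)
  then show ?thesis
    unfolding x nested_bracket_def by (blast intro: nested_bracket_component mu_component)
qed

lemma GPTW_closed: "GPTW m K \<subseteq> carrier L"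
  using GPTW_component components_closed by blast

abbreviation N where "N \<equiv> N_lie m K"

lemma N_subalgebra: "lie_subalgebra Z2 L (carrier N)"
  unfolding N_lie_def by (rule L.subalgebra_generated_lie_subalgebra [OF GPTW_closed])

lemma N_eq: "N = L\<lparr>carrier := carrier N\<rparr>"
  by (simp add: N_lie_def subalgebra_generated_def)

lemma N_minimal: "lie_subalgebra Z2 L H \<Longrightarrow> GPTW m K \<subseteq> H \<Longrightarrow> carrier N \<subseteq> H"
  by (auto simp: N_lie_def subalgebra_generated_def)

lemma GPTW_subset_N: "GPTW m K \<subseteq> carrier N"
  by (auto simp: N_lie_def subalgebra_generated_def)

lemma N_simps [simp]:
  "x \<oplus>\<^bsub>N\<^esub> y = x \<oplus>\<^bsub>L\<^esub> y" "x \<otimes>\<^bsub>N\<^esub> y = x \<otimes>\<^bsub>L\<^esub> y" "\<zero>\<^bsub>N\<^esub> = \<zero>\<^bsub>L\<^esub>" "r \<odot>\<^bsub>N\<^esub> x = r \<odot>\<^bsub>L\<^esub> x"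
  by (simp_all add: N_lie_def subalgebra_generated_def)

lemma N_closed:
  shows "carrier N \<subseteq> carrier L" "\<zero>\<^bsub>L\<^esub> \<in> carrier N"
    and "x \<in> carrier N \<Longrightarrow> y \<in> carrier N \<Longrightarrow> x \<oplus>\<^bsub>L\<^esub> y \<in> carrier N"
    and "x \<in> carrier N \<Longrightarrow> y \<in> carrier N \<Longrightarrow> x \<otimes>\<^bsub>L\<^esub> y \<in> carrier N"
  using N_subalgebra L.submodule_subset L.submodule_zero L.submodule_add
  by (auto simp: lie_subalgebra_def)

sublocale N: lie_algebra_Z2 N
  using L.subalgebra_lie_algebra [OF N_subalgebra] N_eq by (simp add: lie_algebra_Z2_def)

lemma N_component_submodule: "submodule (N_component m K n) Z2 N"
  using component_submodule [of n] N_closed(2,3) L.submodule_zero L.submodule_add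
  by (intro N.Z2_submoduleI) (auto simp: N_component_def)

text \<open>A subalgebra with homogeneous generators is graded: the sums of its homogeneous elements
  form a subalgebra that contains the generators, and \<open>N\<close> is the smallest such.\<close>

lemma N_component_span: "carrier N \<subseteq> add_span N (\<Union>n. N_component m K n)"
proof -
  let ?S = "\<Union>n. N_component m K n"
  have span: "add_span N ?S = add_span L ?S"
    by (subst N_eq) (rule add_span_carrier_update)
  have S: "?S \<subseteq> carrier L"
    using N_closed(1) by (auto simp: N_component_def)
  have "x \<otimes>\<^bsub>L\<^esub> y \<in> add_span L ?S" if "x \<in> ?S" "y \<in> ?S" for x y
  proof -
    obtain i j where "x \<in> N_component m K i" "y \<in> N_component m K j" using \<open>x \<in> ?S\<close> \<open>y \<in> ?S\<close> by blast
    then have "x \<otimes>\<^bsub>L\<^esub> y \<in> N_component m K (i + j)"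
      using component_bracket N_closed(4) by (simp add: N_component_def)
    then show ?thesis by (blast intro: add_span.base)
  qed
  then have "lie_subalgebra Z2 L (add_span L ?S)"
    unfolding lie_subalgebra_def using L.add_span_bracket [OF S] L.add_span_submodule [OF S] by blast
  moreover have "GPTW m K \<subseteq> add_span L ?S"
    using GPTW_component GPTW_subset_N by (auto simp: N_component_def intro!: add_span.base)
  ultimately show ?thesis
    unfolding span by (rule N_minimal)
qed

text \<open>The projections of the ambient graph Lie algebra serve for \<open>N\<close> as well,
  because the components of \<open>N\<close> are intersections with the ambient ones.\<close>

lemma N_poly_graded: "graded_lie_algebra Z2 (lie_poly N) (lie_poly_component N (N_component m K))"
proof -
  obtain \<pi> where \<pi>: "\<And>n x y. \<lbrakk>x \<in> carrier L; y \<in> carrier L\<rbrakk> \<Longrightarrow> \<pi> n (x \<oplus>\<^bsub>L\<^esub> y) = \<pi> n x \<oplus>\<^bsub>L\<^esub> \<pi> n y"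
    "\<And>n k x. x \<in> D k \<Longrightarrow> \<pi> n x = (if n = k then x else \<zero>\<^bsub>L\<^esub>)"
    using component_projections by blast
  show ?thesis
  proof (rule N.lie_poly_graded [of _ \<pi>, OF N_component_submodule _ N_component_span])
    show "x \<otimes>\<^bsub>N\<^esub> y \<in> N_component m K (i + j)"
      if "x \<in> N_component m K i" "y \<in> N_component m K j" for i j x y
      using that N_closed(4) component_bracket by (auto simp: N_component_def)
    show "\<pi> n (x \<oplus>\<^bsub>N\<^esub> y) = \<pi> n x \<oplus>\<^bsub>N\<^esub> \<pi> n y" if "x \<in> carrier N" "y \<in> carrier N" for n x y
      using that N_closed(1) by (simp add: \<pi>(1) subset_iff)
    show "\<pi> n x = (if n = k then x else \<zero>\<^bsub>N\<^esub>)" if "x \<in> N_component m K k" for n k x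
      using that \<pi>(2) [of x k n] by (simp add: N_component_def)
  qed
qed

end

section \<open>Groups given by generators and relations\<close>

lemma words_append [simp]: "u @ v \<in> words S \<longleftrightarrow> u \<in> words S \<and> v \<in> words S"
  and words_Cons [simp]: "x # u \<in> words S \<longleftrightarrow> fst x \<in> S \<and> u \<in> words S"
  and words_Nil [simp]: "[] \<in> words S"
  by (cases x; auto simp: words_def)+

lemma word_eq_words: "word_eq S E u v \<Longrightarrow> u \<in> words S \<and> v \<in> words S"
  by (induction rule: word_eq.induct) auto

text \<open>The generating steps of \<open>word_eq\<close> already carry an arbitrary context, which
  simply grows.\<close>

lemma word_eq_append:
  assumes "word_eq S E u v" "x \<in> words S" "y \<in> words S"
  shows "word_eq S E (x @ u @ y) (x @ v @ y)"
  using assms(1)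
proof induction
  case (refl w)
  then show ?case using assms by (intro word_eq.refl) simp
next
  case (sym v w)
  then show ?case by (blast intro: word_eq.sym)
next
  case (trans u v w)
  then show ?case by (blast intro: word_eq.trans)
next
  case (cancel u v a b)
  then show ?case
    using word_eq.cancel [of "x @ u" S "v @ y" a E b] assms by simp
next
  case (relation u v r s)
  then show ?case
    using word_eq.relation [of "x @ u" S "v @ y" r s E] assms by simp
qed

lemma word_eq_append2:
  assumes "word_eq S E u u'" "word_eq S E v v'"
  shows "word_eq S E (u @ v) (u' @ v')"
  using word_eq_append [OF assms(1), of "[]" v] word_eq_append [OF assms(2), of u' "[]"]
    word_eq_words [OF assms(1)] word_eq_words [OF assms(2)]
  by (auto intro: word_eq.trans)

lemma word_class_eqI: "word_eq S E u v \<Longrightarrow> word_class S E u = word_class S E v"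
  unfolding word_class_def by (blast intro: word_eq.sym word_eq.trans)

lemma word_class_self: "u \<in> words S \<Longrightarrow> u \<in> word_class S E u"
  by (simp add: word_class_def word_eq.refl)

lemma presented_group_mult:
  assumes "u \<in> words S" "v \<in> words S"
  shows "word_class S E u \<otimes>\<^bsub>presented_group S E\<^esub> word_class S E v = word_class S E (u @ v)"
proof -
  have "word_class S E (u' @ v') = word_class S E (u @ v)"
    if "u' \<in> word_class S E u" "v' \<in> word_class S E v" for u' v'
    using that unfolding word_class_def [of _ _ u] word_class_def [of _ _ v] mem_Collect_eq
    by (intro word_class_eqI word_eq_append2) (auto intro: word_eq.sym)
  then show ?thesis
    unfolding presented_group_def monoid.simps
    by (intro UN_constant_on [OF word_class_self [OF assms(1)]]
        UN_constant_on [OF word_class_self [OF assms(2)]])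
qed

lemma presented_group_carrier: "carrier (presented_group S E) = word_class S E ` words S"
  and presented_group_one: "\<one>\<^bsub>presented_group S E\<^esub> = word_class S E []"
  by (simp_all add: presented_group_def)

definition word_inv :: "'a word \<Rightarrow> 'a word" where
  "word_inv w = rev (map (\<lambda>(a, b). (a, \<not> b)) w)"

lemma word_inv_words: "w \<in> words S \<Longrightarrow> word_inv w \<in> words S"
  by (auto simp: word_inv_def words_def)

lemma word_inv_append: "w \<in> words S \<Longrightarrow> word_eq S E (word_inv w @ w) []"
proof (induction w)
  case (Cons x w)
  obtain a b where x: "x = (a, b)" by (cases x)
  have w: "w \<in> words S" "a \<in> S" using Cons.prems by (auto simp: x)
  have "word_eq S E (word_inv w @ [(a, \<not> b), (a, \<not> \<not> b)] @ w) (word_inv w @ w)"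
    by (intro word_eq.cancel word_inv_words w)
  then show ?case
    using Cons.IH [OF w(1)] by (auto simp: x word_inv_def intro: word_eq.trans)
qed (auto simp: word_inv_def intro: word_eq.refl)

lemma presented_group_group: "group (presented_group S E)"
proof (rule groupI)
  fix x assume "x \<in> carrier (presented_group S E)"
  then obtain w where w: "w \<in> words S" "x = word_class S E w"
    by (auto simp: presented_group_carrier)
  then show "\<exists>y\<in>carrier (presented_group S E). y \<otimes>\<^bsub>presented_group S E\<^esub> x = \<one>\<^bsub>presented_group S E\<^esub>"
    using word_class_eqI [OF word_inv_append [OF w(1)]]
    by (intro bexI [of _ "word_class S E (word_inv w)"])
      (simp_all add: presented_group_mult presented_group_one presented_group_carrier word_inv_words)
qed (auto simp: presented_group_carrier presented_group_mult presented_group_one)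

section \<open>Right-angled Coxeter groups\<close>

context graph_lie_algebra
begin

abbreviation G where "G \<equiv> RC m K"
abbreviation g where "g \<equiv> RC_gen m K"

sublocale G: group G
  unfolding RC_def by (rule presented_group_group)

lemma RC_gen_closed: "i \<in> {1..m} \<Longrightarrow> g i \<in> carrier G"
  by (auto simp: RC_gen_def RC_def presented_group_carrier)

lemma RC_gen_involution:
  assumes "i \<in> {1..m}" shows "g i \<otimes>\<^bsub>G\<^esub> g i = \<one>\<^bsub>G\<^esub>"
proof -
  have "([(i, True), (i, True)], []) \<in> RC_relations m K"
    using assms by (auto simp: RC_relations_def)
  then have "word_eq {1..m} (RC_relations m K) ([] @ [(i, True), (i, True)] @ []) ([] @ [] @ [])"
    using assms by (intro word_eq.relation) auto
  then show ?thesis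
    using assms by (simp add: RC_gen_def RC_def presented_group_mult presented_group_one word_class_eqI)
qed

lemma RC_gen_commute:
  assumes "{i, j} \<in> K" shows "g i \<otimes>\<^bsub>G\<^esub> g j = g j \<otimes>\<^bsub>G\<^esub> g i"
proof -
  have "([(i, True), (j, True)], [(j, True), (i, True)]) \<in> RC_relations m K"
    using assms by (auto simp: RC_relations_def)
  then have "word_eq {1..m} (RC_relations m K) ([] @ [(i, True), (j, True)] @ []) ([] @ [(j, True), (i, True)] @ [])"
    using edge_vertices [OF assms] by (intro word_eq.relation) auto
  then show ?thesis
    using edge_vertices [OF assms]
    by (simp add: RC_gen_def RC_def presented_group_mult word_class_eqI)
qed

text \<open>Each generator is an involution, so a letter \<open>(i, False)\<close> represents the
  same element as \<open>(i, True)\<close> and every group element is a product of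
  generators.\<close>

lemma RC_induct [consumes 1, case_names one mult]:
  assumes "x \<in> carrier G" "P \<one>\<^bsub>G\<^esub>"
    and mult: "\<And>i x. \<lbrakk>i \<in> {1..m}; x \<in> carrier G; P x\<rbrakk> \<Longrightarrow> P (g i \<otimes>\<^bsub>G\<^esub> x)"
  shows "P x"
proof -
  let ?c = "word_class {1..m} (RC_relations m K)"
  have gen: "?c [(i, b)] = g i" if "i \<in> {1..m}" for i b
  proof (cases b)
    case False
    have "?c [(i, False)] \<otimes>\<^bsub>G\<^esub> g i = ?c ([] @ [(i, False), (i, \<not> False)] @ [])"
      using that by (simp add: RC_gen_def RC_def presented_group_mult)
    also have "\<dots> = ?c ([] @ [])"
      using that by (intro word_class_eqI word_eq.cancel) auto
    finally have "?c [(i, False)] \<otimes>\<^bsub>G\<^esub> g i = g i \<otimes>\<^bsub>G\<^esub> g i"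
      using RC_gen_involution [OF that] by (simp add: RC_def presented_group_one)
    moreover have "?c [(i, False)] \<in> carrier G"
      using that by (auto simp: RC_def presented_group_carrier)
    ultimately show ?thesis
      using False RC_gen_closed [OF that] by (simp add: G.right_cancel)
  qed (simp add: RC_gen_def)
  have "P (?c w) \<and> ?c w \<in> carrier G" if "w \<in> words {1..m}" for w
    using that
  proof (induction w)
    case Nil
    then show ?case using assms(2) by (simp add: RC_def presented_group_one presented_group_carrier)
  next
    case (Cons x w)
    obtain i b where x: "x = (i, b)" by (cases x)
    have i: "i \<in> {1..m}" "w \<in> words {1..m}" using Cons.prems by (auto simp: x)
    have "g i \<otimes>\<^bsub>G\<^esub> ?c w = ?c (x # w)"
      using i presented_group_mult [of "[x]" "{1..m}" w] by (simp add: gen [symmetric, of i b] x RC_def)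
    then show ?case
      using mult [OF i(1), of "?c w"] Cons.IH [OF i(2)] G.m_closed [OF RC_gen_closed [OF i(1)]]
      by metis
  qed
  then show ?thesis using assms(1) by (auto simp: RC_def presented_group_carrier)
qed

end

section \<open>The lower central series\<close>

context group
begin

abbreviation \<gamma> where "\<gamma> \<equiv> lower_central G"
abbreviation comm where "comm \<equiv> group_commutator G"

lemma inv_cancel_left:
  "\<lbrakk>x \<in> carrier G; y \<in> carrier G\<rbrakk> \<Longrightarrow> inv x \<otimes> (x \<otimes> y) = y"
  "\<lbrakk>x \<in> carrier G; y \<in> carrier G\<rbrakk> \<Longrightarrow> x \<otimes> (inv x \<otimes> y) = y"
  by (simp_all add: m_assoc [symmetric])

lemmas word_simps = m_assoc inv_mult_group inv_cancel_left

lemma commutator_closed: "\<lbrakk>a \<in> carrier G; b \<in> carrier G\<rbrakk> \<Longrightarrow> comm a b \<in> carrier G"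
  by (simp add: group_commutator_def)

lemma lower_central_Suc_eq:
  "1 \<le> k \<Longrightarrow> \<gamma> (Suc k) = generate G {comm a b | a b. a \<in> \<gamma> k \<and> b \<in> carrier G}"
  by (cases k) auto

lemma lower_central_subgroup: "subgroup (\<gamma> k) G"
proof (induction k)
  case (Suc k)
  show ?case
  proof (cases "1 \<le> k")
    case True
    show ?thesis
      unfolding lower_central_Suc_eq [OF True]
      by (rule generate_is_subgroup)
        (use subgroup.subset [OF Suc] in \<open>auto intro: commutator_closed\<close>)
  qed (simp add: subgroup_self not_le)
qed (simp add: subgroup_self)

lemma lower_central_carrier: "x \<in> \<gamma> k \<Longrightarrow> x \<in> carrier G"
  and lower_central_one: "\<one> \<in> \<gamma> k"
  and lower_central_mult: "x \<in> \<gamma> k \<Longrightarrow> y \<in> \<gamma> k \<Longrightarrow> x \<otimes> y \<in> \<gamma> k"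
  and lower_central_inv: "x \<in> \<gamma> k \<Longrightarrow> inv x \<in> \<gamma> k"
  by (erule subgroup.mem_carrier [OF lower_central_subgroup],
    rule subgroup.one_closed [OF lower_central_subgroup],
    erule (1) subgroup.m_closed [OF lower_central_subgroup],
    erule subgroup.m_inv_closed [OF lower_central_subgroup])

lemma commutator_Suc: "\<lbrakk>1 \<le> k; a \<in> \<gamma> k; b \<in> carrier G\<rbrakk> \<Longrightarrow> comm a b \<in> \<gamma> (Suc k)"
  by (auto simp: lower_central_Suc_eq intro!: generate.incl)

text \<open>A conjugate of a commutator is the commutator of the conjugates, so the generating set
  of each term is stable under conjugation.\<close>

lemma lower_central_conj: "\<lbrakk>x \<in> \<gamma> k; y \<in> carrier G\<rbrakk> \<Longrightarrow> y \<otimes> x \<otimes> inv y \<in> \<gamma> k"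
proof (induction k arbitrary: x y)
  case (Suc k)
  show ?case
  proof (cases "1 \<le> k")
    case True
    have "generate G {comm a b | a b. a \<in> \<gamma> k \<and> b \<in> carrier G} \<lhd> G"
    proof (rule normal_generateI)
      show "{comm a b | a b. a \<in> \<gamma> k \<and> b \<in> carrier G} \<subseteq> carrier G"
        using lower_central_carrier commutator_closed by blast
      fix h g assume "h \<in> {comm a b | a b. a \<in> \<gamma> k \<and> b \<in> carrier G}" and g: "g \<in> carrier G"
      then obtain a b where h: "h = comm a b" "a \<in> \<gamma> k" "b \<in> carrier G" by blast
      note c = lower_central_carrier [OF h(2)] h(3) g
      have "g \<otimes> h \<otimes> inv g = comm (g \<otimes> a \<otimes> inv g) (g \<otimes> b \<otimes> inv g)"
        using c by (simp add: h(1) group_commutator_def word_simps)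
      moreover have "g \<otimes> a \<otimes> inv g \<in> \<gamma> k" by (rule Suc.IH [OF h(2) g])
      moreover have "g \<otimes> b \<otimes> inv g \<in> carrier G" using c by simp
      ultimately show "g \<otimes> h \<otimes> inv g \<in> {comm a b | a b. a \<in> \<gamma> k \<and> b \<in> carrier G}"
        by blast
    qed
    then show ?thesis
      using Suc.prems by (simp add: normal.inv_op_closed2 lower_central_Suc_eq [OF True])
  qed (use Suc.prems in \<open>simp add: not_le\<close>)
qed simp

lemma lower_central_conj': "\<lbrakk>x \<in> \<gamma> k; y \<in> carrier G\<rbrakk> \<Longrightarrow> inv y \<otimes> x \<otimes> y \<in> \<gamma> k"
  using lower_central_conj [of x k "inv y"] by simp

lemma lower_central_normal: "\<gamma> k \<lhd> G"
  by (simp add: normal_inv_iff lower_central_subgroup lower_central_conj)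

lemma lower_central_Suc_subset: "\<gamma> (Suc k) \<subseteq> \<gamma> k"
proof (cases "1 \<le> k")
  case True
  show ?thesis
    unfolding lower_central_Suc_eq [OF True]
  proof (rule generate_subgroup_incl [OF _ lower_central_subgroup], clarify)
    fix a b assume ab: "a \<in> \<gamma> k" "b \<in> carrier G"
    have "comm a b = inv a \<otimes> (inv b \<otimes> a \<otimes> b)"
      using ab lower_central_carrier by (simp add: group_commutator_def word_simps)
    then show "comm a b \<in> \<gamma> k"
      using lower_central_mult [OF lower_central_inv lower_central_conj'] ab by simp
  qed
qed (use lower_central_carrier in \<open>auto simp: not_le\<close>)

lemma lower_central_antimono: "i \<le> j \<Longrightarrow> x \<in> \<gamma> j \<Longrightarrow> x \<in> \<gamma> i"
  using lift_Suc_antimono_le [of \<gamma>, OF lower_central_Suc_subset] by blast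

section \<open>Commutator identities and commutators of two terms of the series\<close>

lemma commutator_inv: "\<lbrakk>a \<in> carrier G; b \<in> carrier G\<rbrakk> \<Longrightarrow> inv (comm a b) = comm b a"
  by (simp add: group_commutator_def word_simps)

lemma commutator_mult_left: "\<lbrakk>a \<in> carrier G; b \<in> carrier G; c \<in> carrier G\<rbrakk> \<Longrightarrow>
    comm (a \<otimes> b) c = comm a c \<otimes> comm (comm a c) b \<otimes> comm b c"
  by (simp add: group_commutator_def word_simps)

lemma commutator_mult_right: "\<lbrakk>a \<in> carrier G; b \<in> carrier G; c \<in> carrier G\<rbrakk> \<Longrightarrow>
    comm a (b \<otimes> c) = comm a c \<otimes> (inv c \<otimes> comm a b \<otimes> c)"
  by (simp add: group_commutator_def word_simps)

text \<open>The Hall-Witt identity. It drives both the three subgroups argument of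
  \<open>commutator_add\<close> and the Jacobi identity of L(G).\<close>

lemma hall_witt: "\<lbrakk>a \<in> carrier G; b \<in> carrier G; c \<in> carrier G\<rbrakk> \<Longrightarrow>
    (inv b \<otimes> comm (comm a (inv b)) c \<otimes> b) \<otimes> ((inv c \<otimes> comm (comm b (inv c)) a \<otimes> c)
      \<otimes> (inv a \<otimes> comm (comm c (inv a)) b \<otimes> a)) = \<one>"
  by (simp add: group_commutator_def word_simps)

lemma commutator_inv_left: "\<lbrakk>a \<in> carrier G; b \<in> carrier G\<rbrakk> \<Longrightarrow>
    comm (inv a) b = a \<otimes> inv (comm a b) \<otimes> inv a"
  by (simp add: group_commutator_def word_simps)

text \<open>Because this is a subgroup, it contains a term of the series as soon as it contains the
  commutators generating that term.\<close>

lemma commutator_centralizer_subgroup: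
  "subgroup {b \<in> carrier G. \<forall>i\<ge>1. \<forall>a\<in>\<gamma> i. comm b a \<in> \<gamma> (i + n)} G"
proof (rule subgroupI)
  have "comm \<one> a = \<one>" if "a \<in> carrier G" for a
    using that by (simp add: group_commutator_def)
  then show "{b \<in> carrier G. \<forall>i\<ge>1. \<forall>a\<in>\<gamma> i. comm b a \<in> \<gamma> (i + n)} \<noteq> {}"
    using lower_central_carrier lower_central_one by (auto intro!: exI [of _ \<one>])
next
  fix b assume "b \<in> {b \<in> carrier G. \<forall>i\<ge>1. \<forall>a\<in>\<gamma> i. comm b a \<in> \<gamma> (i + n)}"
  then show "inv b \<in> {b \<in> carrier G. \<forall>i\<ge>1. \<forall>a\<in>\<gamma> i. comm b a \<in> \<gamma> (i + n)}"
    using lower_central_carrier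
    by (auto simp: commutator_inv_left intro!: lower_central_conj lower_central_inv)
next
  fix b b' assume b: "b \<in> {b \<in> carrier G. \<forall>i\<ge>1. \<forall>a\<in>\<gamma> i. comm b a \<in> \<gamma> (i + n)}"
    "b' \<in> {b \<in> carrier G. \<forall>i\<ge>1. \<forall>a\<in>\<gamma> i. comm b a \<in> \<gamma> (i + n)}"
  have "comm (b \<otimes> b') a \<in> \<gamma> (i + n)" if a: "1 \<le> i" "a \<in> \<gamma> i" for i a
  proof -
    have "comm b a \<in> \<gamma> (i + n)" "comm b' a \<in> \<gamma> (i + n)" using a b by auto
    moreover from this have "comm (comm b a) b' \<in> \<gamma> (i + n)"
      using a b commutator_Suc [of "i + n" "comm b a" b']
      by (auto intro: lower_central_Suc_subset [THEN subsetD])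
    ultimately show ?thesis
      using b lower_central_carrier [OF a(2)]
      by (auto simp: commutator_mult_left intro!: lower_central_mult)
  qed
  then show "b \<otimes> b' \<in> {b \<in> carrier G. \<forall>i\<ge>1. \<forall>a\<in>\<gamma> i. comm b a \<in> \<gamma> (i + n)}"
    using b by auto
qed auto

text \<open>The three subgroups argument. The induction on \<open>j\<close> treats all
  \<open>i\<close> at once, since the step applies the claim for \<open>j\<close> to
  \<open>Suc i\<close>.\<close>

lemma commutator_add:
  assumes "1 \<le> i" "1 \<le> j" "a \<in> \<gamma> i" "b \<in> \<gamma> j"
  shows "comm a b \<in> \<gamma> (i + j)"
proof -
  have "\<forall>i\<ge>1. \<forall>a\<in>\<gamma> i. \<forall>b\<in>\<gamma> j. comm a b \<in> \<gamma> (i + j)"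
    using assms(2)
  proof (induction j rule: dec_induct)
    case base
    then show ?case using commutator_Suc lower_central_carrier by (metis Suc_eq_plus1)
  next
    case (step j)
    have "comm (comm y z) a \<in> \<gamma> (i + Suc j)"
      if i: "1 \<le> i" and a: "a \<in> \<gamma> i" and y: "y \<in> \<gamma> j" and z: "z \<in> carrier G" for i a y z
    proof -
      note c = lower_central_carrier [OF a] lower_central_carrier [OF y] z
      have 1: "comm (comm (inv z) (inv a)) y \<in> \<gamma> (i + Suc j)"
      proof -
        have "comm (inv z) (inv a) \<in> \<gamma> (Suc i)"
          using commutator_Suc [OF i lower_central_inv [OF a], of "inv z"] z
            lower_central_inv [of "comm (inv a) (inv z)" "Suc i"] c
          by (simp add: commutator_inv)
        then show ?thesis using step(3) [rule_format, of "Suc i" "comm (inv z) (inv a)" y] y i by simp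
      qed
      have 2: "comm (comm a (inv y)) (inv z) \<in> \<gamma> (i + Suc j)"
        using step(3) i a lower_central_inv [OF y] z commutator_Suc [of "i + j"] by simp
      \<comment> \<open>Hall-Witt for \<open>y\<close>, \<open>inv z\<close>, \<open>a\<close>. The
        inverse is chosen so that the first factor is a conjugate of
        \<open>comm (comm y z) a\<close>; the other two factors are conjugates of the elements in
        \<open>1\<close> and \<open>2\<close>.\<close>
      let ?A = "inv (inv z) \<otimes> comm (comm y (inv (inv z))) a \<otimes> inv z"
      let ?B = "inv a \<otimes> comm (comm (inv z) (inv a)) y \<otimes> a"
      let ?C = "inv y \<otimes> comm (comm a (inv y)) (inv z) \<otimes> y"
      have BC: "?B \<otimes> ?C \<in> \<gamma> (i + Suc j)"
        using lower_central_mult [OF lower_central_conj' [OF 1] lower_central_conj' [OF 2]] c by simp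
      have "?A \<otimes> (?B \<otimes> ?C) = \<one>"
        using hall_witt [of y "inv z" a] c by simp
      then have "?A = inv (?B \<otimes> ?C)"
        using c lower_central_carrier [OF BC] by (intro inv_equality [symmetric]) (simp_all add: commutator_closed)
      then have "?A \<in> \<gamma> (i + Suc j)"
        using lower_central_inv [OF BC] by simp
      then have "inv z \<otimes> ?A \<otimes> inv (inv z) \<in> \<gamma> (i + Suc j)"
        using c by (intro lower_central_conj) auto
      moreover have "inv z \<otimes> ?A \<otimes> inv (inv z) = comm (comm y z) a"
        using c by (simp add: word_simps commutator_closed)
      ultimately show ?thesis by simp
    qed
    then have sub: "\<gamma> (Suc j) \<subseteq> {b \<in> carrier G. \<forall>i\<ge>1. \<forall>a\<in>\<gamma> i. comm b a \<in> \<gamma> (i + Suc j)}"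
      unfolding lower_central_Suc_eq [OF step(1)]
      using lower_central_carrier commutator_closed
      by (intro generate_subgroup_incl commutator_centralizer_subgroup) blast
    show ?case
    proof (intro allI impI ballI)
      fix i a b assume i: "1 \<le> i" "a \<in> \<gamma> i" "b \<in> \<gamma> (Suc j)"
      then have "comm b a \<in> \<gamma> (i + Suc j)" using sub by blast
      then have "inv (comm b a) \<in> \<gamma> (i + Suc j)" by (rule lower_central_inv)
      then show "comm a b \<in> \<gamma> (i + Suc j)"
        using i lower_central_carrier by (simp add: commutator_inv)
    qed
  qed
  with assms show ?thesis by blast
qed

end

section \<open>The Lie algebra of the lower central series\<close>

context group
begin

abbreviation cls where "cls k a \<equiv> \<gamma> (Suc k) #> a"
abbreviation Q where "Q \<equiv> lcs_quotient G"

lemma cls_eq_iff: "\<lbrakk>a \<in> carrier G; b \<in> carrier G\<rbrakk> \<Longrightarrow> cls k a = cls k b \<longleftrightarrow> a \<otimes> inv b \<in> \<gamma> (Suc k)"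
  by (metis subgroup.rcos_module [OF lower_central_subgroup is_group] repr_independence
      repr_independenceD lower_central_subgroup)

lemma lcs_quotient_carrier: "carrier (Q k) = cls k ` \<gamma> k"
  by (auto simp: lcs_quotient_def FactGroup_def RCOSETS_def r_coset_def)

lemma lcs_quotient_one: "\<one>\<^bsub>Q k\<^esub> = cls k \<one>"
  by (simp add: lcs_quotient_def FactGroup_def coset_join2 lower_central_subgroup lower_central_one)

lemma lcs_quotient_mult:
  assumes "a \<in> \<gamma> k" "b \<in> \<gamma> k"
  shows "cls k a \<otimes>\<^bsub>Q k\<^esub> cls k b = cls k (a \<otimes> b)"
  using normal.rcos_sum [OF lower_central_normal, of a b "Suc k"] assms lower_central_carrier
  by (simp add: lcs_quotient_def FactGroup_def set_mult_def)

lemma lcs_quotient_comm_group: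
  assumes "1 \<le> k" shows "comm_group (Q k)"
proof (rule comm_groupI)
  fix x y assume "x \<in> carrier (Q k)" "y \<in> carrier (Q k)"
  then obtain a b where ab: "a \<in> \<gamma> k" "b \<in> \<gamma> k" "x = cls k a" "y = cls k b"
    by (auto simp: lcs_quotient_carrier)
  note c = ab(1,2) [THEN lower_central_carrier]
  have "a \<otimes> b \<otimes> inv (b \<otimes> a) = comm (inv a) (inv b)"
    using c by (simp add: group_commutator_def word_simps)
  then have "cls k (a \<otimes> b) = cls k (b \<otimes> a)"
    using c commutator_Suc [OF assms lower_central_inv [OF ab(1)], of "inv b"] by (simp add: cls_eq_iff)
  then show "x \<otimes>\<^bsub>Q k\<^esub> y = y \<otimes>\<^bsub>Q k\<^esub> x"
    using ab by (simp add: lcs_quotient_mult)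
next
  fix x assume "x \<in> carrier (Q k)"
  then obtain a where "a \<in> \<gamma> k" "x = cls k a" by (auto simp: lcs_quotient_carrier)
  then show "\<exists>y\<in>carrier (Q k). y \<otimes>\<^bsub>Q k\<^esub> x = \<one>\<^bsub>Q k\<^esub>"
    using lower_central_carrier
    by (intro bexI [of _ "cls k (inv a)"])
      (auto simp: lcs_quotient_mult lcs_quotient_one lcs_quotient_carrier lower_central_inv)
qed (auto simp: lcs_quotient_mult lcs_quotient_one lcs_quotient_carrier lower_central_one
    lower_central_mult lower_central_carrier m_assoc)

lemma lcs_quotient_group: "1 \<le> k \<Longrightarrow> group (Q k)"
  using lcs_quotient_comm_group comm_group_def by blast

lemma cls_self: "a \<in> \<gamma> k \<Longrightarrow> a \<in> cls k a"
  by (intro rcos_self lower_central_carrier lower_central_subgroup)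

lemma cls_elem: "a \<in> \<gamma> k \<Longrightarrow> x \<in> cls k a \<Longrightarrow> \<exists>h\<in>\<gamma> (Suc k). x = h \<otimes> a"
  by (auto simp: r_coset_def)

lemma cls_eq_one_iff: "a \<in> carrier G \<Longrightarrow> cls k a = \<one>\<^bsub>Q k\<^esub> \<longleftrightarrow> a \<in> \<gamma> (Suc k)"
  by (simp add: lcs_quotient_one cls_eq_iff)

text \<open>The defect is a conjugate of \<open>comm (comm a b) a'\<close>, which lies at least one
  degree deeper.\<close>

lemma cls_commutator_mult_left:
  assumes "1 \<le> i" "1 \<le> j" "a \<in> \<gamma> i" "a' \<in> \<gamma> i" "b \<in> \<gamma> j"
  shows "cls (i + j) (comm (a \<otimes> a') b) = cls (i + j) (comm a b \<otimes> comm a' b)"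
proof -
  note c = assms(3-5) [THEN lower_central_carrier]
  have "comm (comm a b) a' \<in> \<gamma> (Suc (i + j))"
    using assms c by (intro commutator_Suc commutator_add) auto
  then have "comm a b \<otimes> comm (comm a b) a' \<otimes> inv (comm a b) \<in> \<gamma> (Suc (i + j))"
    using c by (intro lower_central_conj commutator_closed)
  moreover have "comm (a \<otimes> a') b \<otimes> inv (comm a b \<otimes> comm a' b) =
      comm a b \<otimes> comm (comm a b) a' \<otimes> inv (comm a b)"
    using c by (simp add: commutator_mult_left commutator_closed word_simps)
  ultimately show ?thesis
    using c by (simp add: cls_eq_iff commutator_closed)
qed

text \<open>The expansion of the commutator yields the factors in reverse order and one of them
  conjugated. Conjugation does not affect the class, and the quotient is abelian.\<close>

lemma cls_commutator_mult_right:
  assumes "1 \<le> i" "1 \<le> j" "a \<in> \<gamma> i" "b \<in> \<gamma> j" "b' \<in> \<gamma> j"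
  shows "cls (i + j) (comm a (b \<otimes> b')) = cls (i + j) (comm a b \<otimes> comm a b')"
proof -
  note c = assms(3-5) [THEN lower_central_carrier]
  have ab: "comm a b \<in> \<gamma> (i + j)" "comm a b' \<in> \<gamma> (i + j)"
    using assms by (intro commutator_add; simp)+
  have 1: "cls (i + j) (inv b' \<otimes> comm a b \<otimes> b') = cls (i + j) (comm a b)"
  proof -
    have "inv b' \<otimes> comm a b \<otimes> b' \<otimes> inv (comm a b) = comm b' (inv (comm a b))"
      using c by (simp add: group_commutator_def [of G b'] word_simps commutator_closed)
    also have "\<dots> = inv (comm (inv (comm a b)) b')"
      using c by (simp add: commutator_inv commutator_closed)
    also have "\<dots> \<in> \<gamma> (Suc (i + j))"
      using ab assms c by (intro lower_central_inv commutator_Suc) auto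
    finally show ?thesis using c by (simp add: cls_eq_iff commutator_closed)
  qed
  have ij: "1 \<le> i + j" using assms by simp
  have conj: "inv b' \<otimes> comm a b \<otimes> b' \<in> \<gamma> (i + j)"
    using ab c by (intro lower_central_conj')
  have "cls (i + j) (comm a (b \<otimes> b')) = cls (i + j) (comm a b') \<otimes>\<^bsub>Q (i + j)\<^esub> cls (i + j) (comm a b)"
    using c ab conj by (simp add: commutator_mult_right lcs_quotient_mult [symmetric] 1)
  also have "\<dots> = cls (i + j) (comm a b \<otimes> comm a b')"
    using ab comm_groupE(4) [OF lcs_quotient_comm_group [OF ij]]
    by (simp add: lcs_quotient_mult [symmetric] lcs_quotient_carrier)
  finally show ?thesis .
qed

text \<open>A change of \<open>a\<close> by an element of \<open>\<gamma> (Suc i)\<close>, or of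
  \<open>b\<close> by one of \<open>\<gamma> (Suc j)\<close>, contributes a commutator in
  \<open>\<gamma> (Suc (i + j))\<close>; hence the union over representatives is a single
  coset.\<close>

lemma lcs_bracket_cls:
  assumes "1 \<le> i" "1 \<le> j" "a \<in> \<gamma> i" "b \<in> \<gamma> j"
  shows "lcs_bracket G i j (cls i a) (cls j b) = cls (i + j) (comm a b)"
proof -
  have "cls (i + j) (comm x y) = cls (i + j) (comm a b)" if x: "x \<in> cls i a" and y: "y \<in> cls j b" for x y
  proof -
    obtain h where h: "h \<in> \<gamma> (Suc i)" "x = h \<otimes> a"
      using cls_elem [OF assms(3) x] by blast
    obtain k where k: "k \<in> \<gamma> (Suc j)" "y = k \<otimes> b"
      using cls_elem [OF assms(4) y] by blast
    have hi: "h \<in> \<gamma> i" and kj: "k \<in> \<gamma> j"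
      using h k lower_central_Suc_subset by blast+
    have y: "y \<in> \<gamma> j" using k kj assms by (simp add: lower_central_mult)
    have ha: "comm h y \<in> \<gamma> (Suc (i + j))" "comm a k \<in> \<gamma> (Suc (i + j))"
      using commutator_add [of "Suc i" j h y] commutator_add [of i "Suc j" a k] assms h k y by auto
    have one: "cls (i + j) z = cls (i + j) \<one>" if "z \<in> \<gamma> (Suc (i + j))" for z
      using that lower_central_carrier [OF that] by (simp add: cls_eq_iff)
    have cm: "comm h y \<in> \<gamma> (i + j)" "comm a y \<in> \<gamma> (i + j)" "comm a k \<in> \<gamma> (i + j)" "comm a b \<in> \<gamma> (i + j)"
      using assms hi kj y by (intro commutator_add; simp)+
    have "cls (i + j) (comm x y) = cls (i + j) (comm h y) \<otimes>\<^bsub>Q (i + j)\<^esub> cls (i + j) (comm a y)"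
      using cls_commutator_mult_left [OF assms(1,2) hi assms(3) y] cm
      by (simp add: h lcs_quotient_mult)
    also have "\<dots> = cls (i + j) (comm a y)"
      using cm by (simp add: one [OF ha(1)] lcs_quotient_mult lower_central_one lower_central_carrier)
    also have "\<dots> = cls (i + j) (comm a k) \<otimes>\<^bsub>Q (i + j)\<^esub> cls (i + j) (comm a b)"
      using cls_commutator_mult_right [OF assms(1-3) kj assms(4)] cm by (simp add: k lcs_quotient_mult)
    also have "\<dots> = cls (i + j) (comm a b)"
      using cm by (simp add: one [OF ha(2)] lcs_quotient_mult lower_central_one lower_central_carrier)
    finally show ?thesis .
  qed
  then show ?thesis
    unfolding lcs_bracket_def
    by (intro UN_constant_on [OF cls_self [OF assms(3)]] UN_constant_on [OF cls_self [OF assms(4)]])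
qed

lemma lcs_bracket_closed:
  assumes "1 \<le> i" "1 \<le> j" "A \<in> carrier (Q i)" "B \<in> carrier (Q j)"
  shows "lcs_bracket G i j A B \<in> carrier (Q (i + j))"
  using assms by (auto simp: lcs_quotient_carrier lcs_bracket_cls commutator_add)

lemma lcs_bracket_mult_left:
  assumes "1 \<le> i" "1 \<le> j" "A \<in> carrier (Q i)" "A' \<in> carrier (Q i)" "B \<in> carrier (Q j)"
  shows "lcs_bracket G i j (A \<otimes>\<^bsub>Q i\<^esub> A') B = lcs_bracket G i j A B \<otimes>\<^bsub>Q (i + j)\<^esub> lcs_bracket G i j A' B"
  using assms
  by (auto simp: lcs_quotient_carrier lcs_quotient_mult lcs_bracket_cls commutator_add lower_central_mult
      cls_commutator_mult_left)

lemma lcs_bracket_mult_right: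
  assumes "1 \<le> i" "1 \<le> j" "A \<in> carrier (Q i)" "B \<in> carrier (Q j)" "B' \<in> carrier (Q j)"
  shows "lcs_bracket G i j A (B \<otimes>\<^bsub>Q j\<^esub> B') = lcs_bracket G i j A B \<otimes>\<^bsub>Q (i + j)\<^esub> lcs_bracket G i j A B'"
  using assms
  by (auto simp: lcs_quotient_carrier lcs_quotient_mult lcs_bracket_cls commutator_add lower_central_mult
      cls_commutator_mult_right)

lemma lcs_bracket_one:
  assumes "1 \<le> i" "1 \<le> j"
  shows "B \<in> carrier (Q j) \<Longrightarrow> lcs_bracket G i j \<one>\<^bsub>Q i\<^esub> B = \<one>\<^bsub>Q (i + j)\<^esub>"
    and "A \<in> carrier (Q i) \<Longrightarrow> lcs_bracket G i j A \<one>\<^bsub>Q j\<^esub> = \<one>\<^bsub>Q (i + j)\<^esub>"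
  using assms
  by (auto simp: lcs_quotient_carrier lcs_quotient_one lcs_bracket_cls lower_central_one
      group_commutator_def lower_central_carrier)

section \<open>The direct sum of the quotients and its bracket\<close>

abbreviation L where "L \<equiv> lcs_lie G"

lemma lcs_lie_carrier:
  "x \<in> carrier L \<longleftrightarrow> x \<in> (\<Pi>\<^sub>E n\<in>{1..}. carrier (Q n)) \<and> finite {n \<in> {1..}. x n \<noteq> \<one>\<^bsub>Q n\<^esub>}"
  using carrier_sum_group [of "{1..}" Q] lcs_quotient_group by (auto simp: lcs_lie_def)

lemma lcs_lie_component: "x \<in> carrier L \<Longrightarrow> 1 \<le> n \<Longrightarrow> x n \<in> carrier (Q n)"
  by (auto simp: lcs_lie_carrier PiE_iff)

lemma lcs_lie_ops:
  "x \<oplus>\<^bsub>L\<^esub> y = (\<lambda>n\<in>{1..}. x n \<otimes>\<^bsub>Q n\<^esub> y n)"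
  "\<zero>\<^bsub>L\<^esub> = (\<lambda>n\<in>{1..}. \<one>\<^bsub>Q n\<^esub>)"
  "x \<otimes>\<^bsub>L\<^esub> y = (\<lambda>n\<in>{1..}. finprod (Q n) (\<lambda>i. lcs_bracket G i (n - i) (x i) (y (n - i))) {1..<n})"
  "r \<odot>\<^bsub>L\<^esub> x = (\<lambda>n\<in>{1..}. x n [^]\<^bsub>Q n\<^esub> r)"
  by (simp_all add: lcs_lie_def)

lemma lcs_lie_add_at: "1 \<le> n \<Longrightarrow> (x \<oplus>\<^bsub>L\<^esub> y) n = x n \<otimes>\<^bsub>Q n\<^esub> y n"
  by (simp add: lcs_lie_ops)

lemma lcs_lie_ext:
  "\<lbrakk>x \<in> carrier L; y \<in> carrier L; \<And>n. 1 \<le> n \<Longrightarrow> x n = y n\<rbrakk> \<Longrightarrow> x = y"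
  by (rule extensionalityI [of x "{1..}" y]) (auto simp: lcs_lie_carrier PiE_iff)

lemma lcs_lie_boundE:
  assumes "x \<in> carrier L" obtains N where "\<And>n. N < n \<Longrightarrow> 1 \<le> n \<Longrightarrow> x n = \<one>\<^bsub>Q n\<^esub>"
proof -
  have "finite {n \<in> {1..}. x n \<noteq> \<one>\<^bsub>Q n\<^esub>}" using assms by (simp add: lcs_lie_carrier)
  then obtain N where N: "\<forall>n\<in>{n \<in> {1..}. x n \<noteq> \<one>\<^bsub>Q n\<^esub>}. n \<le> N"
    using finite_nat_set_iff_bounded_le by blast
  have "x n = \<one>\<^bsub>Q n\<^esub>" if "N < n" "1 \<le> n" for n
  proof (rule ccontr)
    assume "x n \<noteq> \<one>\<^bsub>Q n\<^esub>"
    with bspec [OF N, of n] that show False by simp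
  qed
  then show ?thesis by (rule that)
qed

lemma lcs_lie_carrierI:
  assumes "x \<in> extensional {1..}" "\<And>n. 1 \<le> n \<Longrightarrow> x n \<in> carrier (Q n)"
    "\<And>n. N < n \<Longrightarrow> 1 \<le> n \<Longrightarrow> x n = \<one>\<^bsub>Q n\<^esub>"
  shows "x \<in> carrier L"
proof -
  have "{n \<in> {1..}. x n \<noteq> \<one>\<^bsub>Q n\<^esub>} \<subseteq> {..N}" using assms(3) by (force simp: not_less [symmetric])
  then have "finite {n \<in> {1..}. x n \<noteq> \<one>\<^bsub>Q n\<^esub>}" by (rule finite_subset) simp
  then show ?thesis using assms(1,2) by (auto simp: lcs_lie_carrier PiE_iff)
qed

lemma lcs_lie_add_closed:
  assumes "x \<in> carrier L" "y \<in> carrier L" shows "x \<oplus>\<^bsub>L\<^esub> y \<in> carrier L"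
proof -
  obtain M N where "\<And>n. N < n \<Longrightarrow> 1 \<le> n \<Longrightarrow> x n = \<one>\<^bsub>Q n\<^esub>" "\<And>n. M < n \<Longrightarrow> 1 \<le> n \<Longrightarrow> y n = \<one>\<^bsub>Q n\<^esub>"
    using assms lcs_lie_boundE by metis
  then show ?thesis
    using assms lcs_lie_component lcs_quotient_group
    by (intro lcs_lie_carrierI [of _ "max M N"])
      (auto simp: lcs_lie_ops group.is_monoid monoid.m_closed)
qed

lemma lcs_class_closed: "1 \<le> k \<Longrightarrow> a \<in> \<gamma> k \<Longrightarrow> lcs_class G k a \<in> carrier L"
  using lcs_quotient_group
  by (intro lcs_lie_carrierI [of _ k])
    (auto simp: lcs_class_def lcs_quotient_carrier group.is_monoid monoid.one_closed
      lcs_quotient_one lower_central_one)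

lemma lcs_class_add:
  assumes "1 \<le> k" "a \<in> \<gamma> k" "b \<in> \<gamma> k"
  shows "lcs_class G k (a \<otimes> b) = lcs_class G k a \<oplus>\<^bsub>L\<^esub> lcs_class G k b"
  using assms lcs_quotient_group
  by (auto simp: lcs_class_def lcs_lie_ops lcs_quotient_mult lower_central_mult lower_central_one
      lcs_quotient_one intro!: ext)

lemma lcs_class_zero_iff: "1 \<le> k \<Longrightarrow> a \<in> \<gamma> k \<Longrightarrow> lcs_class G k a = \<zero>\<^bsub>L\<^esub> \<longleftrightarrow> a \<in> \<gamma> (Suc k)"
  using cls_eq_one_iff [of a k] lower_central_carrier
  by (auto simp: lcs_class_def lcs_lie_ops fun_eq_iff)

lemma lcs_class_one: "1 \<le> k \<Longrightarrow> lcs_class G k \<one> = \<zero>\<^bsub>L\<^esub>"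
  by (simp add: lcs_class_zero_iff lower_central_one)

text \<open>The cut-off \<open>N\<close> serves the full Lie algebra with \<open>N = 1\<close> and
  its commutator subalgebra with \<open>N = 2\<close>. Induction on a bound of the support splits
  off the top component.\<close>

lemma lcs_lie_span:
  assumes "x \<in> carrier L" "\<And>n. 1 \<le> n \<Longrightarrow> n < N \<Longrightarrow> x n = \<one>\<^bsub>Q n\<^esub>"
  shows "x \<in> add_span L {lcs_class G k a | k a. 1 \<le> k \<and> N \<le> k \<and> a \<in> \<gamma> k}" (is "_ \<in> ?S")
proof -
  have main: "x \<in> ?S" if "x \<in> carrier L" "\<And>n. 1 \<le> n \<Longrightarrow> n < N \<Longrightarrow> x n = \<one>\<^bsub>Q n\<^esub>"
    "\<And>n. M \<le> n \<Longrightarrow> 1 \<le> n \<Longrightarrow> x n = \<one>\<^bsub>Q n\<^esub>" for M x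
    using that
  proof (induction M arbitrary: x)
    case 0
    then have "x = \<zero>\<^bsub>L\<^esub>"
      by (auto simp: lcs_lie_ops lcs_lie_carrier fun_eq_iff PiE_iff extensional_def)
    then show ?case by (simp only: add_span.zero)
  next
    case (Suc M)
    show ?case
    proof (cases "1 \<le> M \<and> N \<le> M")
      case False
      show ?thesis
      proof (rule Suc.IH [OF Suc.prems(1)])
        fix n assume "M \<le> n" "1 \<le> n"
        then show "x n = \<one>\<^bsub>Q n\<^esub>" using Suc.prems(2,3) [of n] False by (cases "n = M") auto
      qed (use Suc.prems(2) in auto)
    next
      case True
      let ?y = "\<lambda>n\<in>{1..}. if n = M then \<one>\<^bsub>Q n\<^esub> else x n"
      obtain a where a: "a \<in> \<gamma> M" "x M = cls M a"
        using lcs_lie_component [OF Suc.prems(1)] True by (auto simp: lcs_quotient_carrier)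
      have grp: "\<And>n. 1 \<le> n \<Longrightarrow> monoid (Q n)" using lcs_quotient_group group.is_monoid by blast
      have y: "?y \<in> carrier L"
        using Suc.prems lcs_lie_component [OF Suc.prems(1)] grp
        by (intro lcs_lie_carrierI [of _ M]) (auto simp: monoid.one_closed)
      have yS: "?y \<in> ?S"
      proof (rule Suc.IH [OF y])
        fix n assume "M \<le> n" "1 \<le> n"
        then show "?y n = \<one>\<^bsub>Q n\<^esub>" using Suc.prems(3) [of n] by (cases "n = M") auto
      qed (use Suc.prems(2) in auto)
      have eq: "?y \<oplus>\<^bsub>L\<^esub> lcs_class G M a = x"
      proof (rule lcs_lie_ext [OF _ Suc.prems(1)])
        show "?y \<oplus>\<^bsub>L\<^esub> lcs_class G M a \<in> carrier L"
          using True a y by (intro lcs_lie_add_closed lcs_class_closed) auto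
        fix n :: nat assume n: "1 \<le> n"
        then show "(?y \<oplus>\<^bsub>L\<^esub> lcs_class G M a) n = x n"
          using a monoid.l_one [OF grp [OF n]] monoid.r_one [OF grp [OF n]] monoid.one_closed [OF grp [OF n]]
            lcs_lie_component [OF Suc.prems(1) n]
          by (auto simp: lcs_lie_ops lcs_class_def)
      qed
      have "lcs_class G M a \<in> ?S"
        using True a by (intro add_span.base) blast
      from add_span.add [OF yS this] show ?thesis by (simp only: eq)
    qed
  qed
  obtain M where "\<And>n. M < n \<Longrightarrow> 1 \<le> n \<Longrightarrow> x n = \<one>\<^bsub>Q n\<^esub>"
    using lcs_lie_boundE [OF assms(1)] by blast
  then show ?thesis
    by (intro main [OF assms, of "Suc M"]) auto
qed

lemma lcs_lie_bracket_closed: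
  assumes "x \<in> carrier L" "y \<in> carrier L" shows "x \<otimes>\<^bsub>L\<^esub> y \<in> carrier L"
proof -
  obtain M N where MN: "\<And>n. N < n \<Longrightarrow> 1 \<le> n \<Longrightarrow> x n = \<one>\<^bsub>Q n\<^esub>" "\<And>n. M < n \<Longrightarrow> 1 \<le> n \<Longrightarrow> y n = \<one>\<^bsub>Q n\<^esub>"
    using assms lcs_lie_boundE by metis
  have factor: "lcs_bracket G i (n - i) (x i) (y (n - i)) \<in> carrier (Q n)" if "i \<in> {1..<n}" for i n
    using lcs_bracket_closed [of i "n - i" "x i" "y (n - i)"] lcs_lie_component assms that by auto
  show ?thesis
  proof (rule lcs_lie_carrierI [of _ "M + N"])
    fix n :: nat assume n: "1 \<le> n"
    interpret Qn: comm_group "Q n" by (rule lcs_quotient_comm_group [OF n])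
    show "(x \<otimes>\<^bsub>L\<^esub> y) n \<in> carrier (Q n)"
      using n factor by (simp add: lcs_lie_ops Pi_iff)
    assume nMN: "M + N < n"
    have "lcs_bracket G i (n - i) (x i) (y (n - i)) = \<one>\<^bsub>Q n\<^esub>" if i: "i \<in> {1..<n}" for i
    proof -
      have ni: "1 \<le> n - i" using i by auto
      have "x i = \<one>\<^bsub>Q i\<^esub> \<or> y (n - i) = \<one>\<^bsub>Q (n - i)\<^esub>"
        using MN(1) [of i] MN(2) [of "n - i"] i nMN by (cases "N < i") auto
      then show ?thesis
      proof
        assume "x i = \<one>\<^bsub>Q i\<^esub>"
        then show ?thesis
          using lcs_bracket_one(1) [of i "n - i"] i ni lcs_lie_component [OF assms(2)] by simp
      next
        assume "y (n - i) = \<one>\<^bsub>Q (n - i)\<^esub>"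
        then show ?thesis
          using lcs_bracket_one(2) [of i "n - i"] i ni lcs_lie_component [OF assms(1)] by simp
      qed
    qed
    then have "finprod (Q n) (\<lambda>i. lcs_bracket G i (n - i) (x i) (y (n - i))) {1..<n} =
        finprod (Q n) (\<lambda>i. \<one>\<^bsub>Q n\<^esub>) {1..<n}"
      by (intro Qn.finprod_cong') auto
    then show "(x \<otimes>\<^bsub>L\<^esub> y) n = \<one>\<^bsub>Q n\<^esub>"
      using n by (simp add: lcs_lie_ops)
  qed (simp add: lcs_lie_ops)
qed

lemma lcs_lie_bracket_add_left:
  assumes "x \<in> carrier L" "y \<in> carrier L" "z \<in> carrier L"
  shows "(x \<oplus>\<^bsub>L\<^esub> y) \<otimes>\<^bsub>L\<^esub> z = x \<otimes>\<^bsub>L\<^esub> z \<oplus>\<^bsub>L\<^esub> y \<otimes>\<^bsub>L\<^esub> z"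
proof (rule lcs_lie_ext)
  fix n :: nat assume n: "1 \<le> n"
  interpret Qn: comm_group "Q n" by (rule lcs_quotient_comm_group [OF n])
  let ?B = "\<lambda>x i. lcs_bracket G i (n - i) (x i) (z (n - i))"
  have B: "?B x i \<in> carrier (Q n)" "?B y i \<in> carrier (Q n)" "?B (x \<oplus>\<^bsub>L\<^esub> y) i = ?B x i \<otimes>\<^bsub>Q n\<^esub> ?B y i"
    if "i \<in> {1..<n}" for i
    using that lcs_bracket_closed [of i "n - i"] lcs_lie_component assms
      lcs_bracket_mult_left [of i "n - i" "x i" "y i" "z (n - i)"]
    by (auto simp: lcs_lie_ops)
  then have "finprod (Q n) (?B (x \<oplus>\<^bsub>L\<^esub> y)) {1..<n} = finprod (Q n) (\<lambda>i. ?B x i \<otimes>\<^bsub>Q n\<^esub> ?B y i) {1..<n}"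
    by (intro Qn.finprod_cong') (auto simp: Pi_iff)
  then show "((x \<oplus>\<^bsub>L\<^esub> y) \<otimes>\<^bsub>L\<^esub> z) n = (x \<otimes>\<^bsub>L\<^esub> z \<oplus>\<^bsub>L\<^esub> y \<otimes>\<^bsub>L\<^esub> z) n"
    using n by (simp add: lcs_lie_add_at lcs_lie_ops(3) Qn.finprod_multf Pi_iff B)
qed (intro lcs_lie_bracket_closed lcs_lie_add_closed assms)+

lemma lcs_lie_bracket_add_right:
  assumes "x \<in> carrier L" "y \<in> carrier L" "z \<in> carrier L"
  shows "x \<otimes>\<^bsub>L\<^esub> (y \<oplus>\<^bsub>L\<^esub> z) = x \<otimes>\<^bsub>L\<^esub> y \<oplus>\<^bsub>L\<^esub> x \<otimes>\<^bsub>L\<^esub> z"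
proof (rule lcs_lie_ext)
  fix n :: nat assume n: "1 \<le> n"
  interpret Qn: comm_group "Q n" by (rule lcs_quotient_comm_group [OF n])
  let ?B = "\<lambda>y i. lcs_bracket G i (n - i) (x i) (y (n - i))"
  have B: "?B y i \<in> carrier (Q n)" "?B z i \<in> carrier (Q n)" "?B (y \<oplus>\<^bsub>L\<^esub> z) i = ?B y i \<otimes>\<^bsub>Q n\<^esub> ?B z i"
    if "i \<in> {1..<n}" for i
    using that lcs_bracket_closed [of i "n - i"] lcs_lie_component assms
      lcs_bracket_mult_right [of i "n - i" "x i" "y (n - i)" "z (n - i)"]
    by (auto simp: lcs_lie_ops)
  then have "finprod (Q n) (?B (y \<oplus>\<^bsub>L\<^esub> z)) {1..<n} = finprod (Q n) (\<lambda>i. ?B y i \<otimes>\<^bsub>Q n\<^esub> ?B z i) {1..<n}"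
    by (intro Qn.finprod_cong') (auto simp: Pi_iff)
  then show "(x \<otimes>\<^bsub>L\<^esub> (y \<oplus>\<^bsub>L\<^esub> z)) n = (x \<otimes>\<^bsub>L\<^esub> y \<oplus>\<^bsub>L\<^esub> x \<otimes>\<^bsub>L\<^esub> z) n"
    using n by (simp add: lcs_lie_add_at lcs_lie_ops(3) Qn.finprod_multf Pi_iff B)
qed (intro lcs_lie_bracket_closed lcs_lie_add_closed assms)+

text \<open>In the convolution sum the only index meeting both supports is \<open>i\<close>, and
  only in degree \<open>i + j\<close>.\<close>

lemma lcs_class_bracket:
  assumes "1 \<le> i" "1 \<le> j" "a \<in> \<gamma> i" "b \<in> \<gamma> j"
  shows "lcs_class G i a \<otimes>\<^bsub>L\<^esub> lcs_class G j b = lcs_class G (i + j) (comm a b)"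
proof (rule lcs_lie_ext)
  fix n :: nat assume n: "1 \<le> n"
  interpret Qn: comm_group "Q n" by (rule lcs_quotient_comm_group [OF n])
  let ?B = "\<lambda>k. lcs_bracket G k (n - k) (lcs_class G i a k) (lcs_class G j b (n - k))"
  let ?c = "if n = i + j then cls (i + j) (comm a b) else \<one>\<^bsub>Q n\<^esub>"
  have cab: "comm a b \<in> \<gamma> (i + j)" using assms by (intro commutator_add)
  then have cQ: "?c \<in> carrier (Q n)"
    using Qn.one_closed by (cases "n = i + j") (auto simp: lcs_quotient_carrier [of "i + j"])
  have "?B k = (if i = k then ?c else \<one>\<^bsub>Q n\<^esub>)" if k: "k \<in> {1..<n}" for k
  proof (cases "k = i \<and> n - k = j")
    case True
    then show ?thesis using assms k by (auto simp: lcs_class_def lcs_bracket_cls)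
  next
    case False
    have nk: "1 \<le> n - k" using k by auto
    from False have "lcs_class G i a k = \<one>\<^bsub>Q k\<^esub> \<or> lcs_class G j b (n - k) = \<one>\<^bsub>Q (n - k)\<^esub>"
      using k by (auto simp: lcs_class_def)
    then have "?B k = \<one>\<^bsub>Q (k + (n - k))\<^esub>"
    proof
      assume "lcs_class G i a k = \<one>\<^bsub>Q k\<^esub>"
      then show ?thesis
        using lcs_bracket_one(1) [of k "n - k"] k nk lcs_lie_component [OF lcs_class_closed [OF assms(2,4)]]
        by simp
    next
      assume "lcs_class G j b (n - k) = \<one>\<^bsub>Q (n - k)\<^esub>"
      then show ?thesis
        using lcs_bracket_one(2) [of k "n - k"] k nk lcs_lie_component [OF lcs_class_closed [OF assms(1,3)]]
        by simp
    qed
    moreover have "n \<noteq> i + j" if "i = k" using False k that by auto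
    ultimately show ?thesis using k by simp
  qed
  then have "finprod (Q n) ?B {1..<n} = finprod (Q n) (\<lambda>k. if i = k then ?c else \<one>\<^bsub>Q n\<^esub>) {1..<n}"
  proof (intro Qn.finprod_cong' refl Pi_I)
    fix k show "(if i = k then ?c else \<one>\<^bsub>Q n\<^esub>) \<in> carrier (Q n)"
    proof (cases "i = k")
      case True
      show ?thesis unfolding if_P [OF True] by (rule cQ)
    next
      case False
      show ?thesis unfolding if_not_P [OF False] by (rule Qn.one_closed)
    qed
  qed simp
  also have "\<dots> = ?c"
  proof (cases "i < n")
    case True
    then show ?thesis
      using Qn.finprod_singleton [of i "{1..<n}" "\<lambda>_. ?c"] assms(1) cQ by (auto simp del: if_split)
  next
    case False
    then have "finprod (Q n) (\<lambda>k. if i = k then ?c else \<one>\<^bsub>Q n\<^esub>) {1..<n} = finprod (Q n) (\<lambda>k. \<one>\<^bsub>Q n\<^esub>) {1..<n}"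
      by (intro Qn.finprod_cong') auto
    then show ?thesis using False assms by auto
  qed
  finally show "(lcs_class G i a \<otimes>\<^bsub>L\<^esub> lcs_class G j b) n = lcs_class G (i + j) (comm a b) n"
    using n by (simp add: lcs_lie_ops lcs_class_def [of G "i + j"])
qed (use assms in \<open>auto intro!: lcs_lie_bracket_closed lcs_class_closed commutator_add\<close>)

end

declare lower_central.simps(3) [simp del]

section \<open>Groups whose lower central quotients have exponent 2\<close>

locale lcs_exponent_2 = group G for G (structure) +
  assumes square_mem: "\<lbrakk>1 \<le> k; a \<in> lower_central G k\<rbrakk> \<Longrightarrow> a \<otimes> a \<in> lower_central G (Suc k)"

lemma (in group) square_mult:
  "\<lbrakk>a \<in> carrier G; b \<in> carrier G\<rbrakk> \<Longrightarrow> a \<otimes> b \<otimes> (a \<otimes> b) = (a \<otimes> a) \<otimes> comm a (inv b) \<otimes> (b \<otimes> b)"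
  by (simp add: group_commutator_def word_simps)

text \<open>Degree 1 decides. For \<open>c = comm a b\<close> the square of \<open>c\<close> is
  \<open>comm a (b \<otimes> b)\<close> times the inverse of \<open>comm c b\<close>; since
  \<open>b \<otimes> b\<close> lies in the second term of the series, both factors are two degrees
  deeper than \<open>a\<close>.\<close>

lemma (in group) lcs_exponent_2I:
  assumes sq: "\<And>a. a \<in> carrier G \<Longrightarrow> a \<otimes> a \<in> \<gamma> (Suc 1)"
  shows "lcs_exponent_2 G"
proof -
  have "\<forall>a\<in>\<gamma> k. a \<otimes> a \<in> \<gamma> (Suc k)" if "1 \<le> k" for k
    using that
  proof (induction k rule: dec_induct)
    case base
    then show ?case using sq lower_central_carrier by blast
  next
    case (step k)
    let ?H = "{a \<in> \<gamma> (Suc k). a \<otimes> a \<in> \<gamma> (Suc (Suc k))}"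
    have "subgroup ?H G"
    proof (rule subgroupI)
      fix a assume a: "a \<in> ?H"
      then have "inv a \<otimes> inv a = inv (a \<otimes> a)"
        using lower_central_carrier [of a "Suc k"] by (simp add: inv_mult_group)
      then show "inv a \<in> ?H" using a lower_central_inv [of a] lower_central_inv [of "a \<otimes> a"] by auto
    next
      fix a b assume ab: "a \<in> ?H" "b \<in> ?H"
      then have c: "a \<in> carrier G" "b \<in> carrier G" using lower_central_carrier by auto
      have "comm a (inv b) \<in> \<gamma> (Suc (Suc k))"
        using ab c by (intro commutator_Suc) auto
      then show "a \<otimes> b \<in> ?H"
        using ab c by (auto simp: square_mult intro!: lower_central_mult)
    next
      have "\<one> \<in> ?H" using lower_central_one by simp
      then show "?H \<noteq> {}" by blast
    qed (use lower_central_carrier in auto)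
    moreover have "comm a b \<in> ?H" if a: "a \<in> \<gamma> k" and b: "b \<in> carrier G" for a b
    proof -
      note c = lower_central_carrier [OF a] b
      have ab: "comm a b \<in> \<gamma> (Suc k)" using step(1) a b by (rule commutator_Suc)
      have "comm a (b \<otimes> b) \<in> \<gamma> (k + Suc 1)"
        using step(1) a sq [OF b] by (intro commutator_add) auto
      then have 1: "comm a (b \<otimes> b) \<in> \<gamma> (Suc (Suc k))" by simp
      have 2: "inv (comm (comm a b) b) \<in> \<gamma> (Suc (Suc k))"
        using b by (intro lower_central_inv commutator_Suc [OF _ ab]) auto
      have "comm a b \<otimes> comm a b = comm a (b \<otimes> b) \<otimes> inv (comm (comm a b) b)"
        using c by (simp add: group_commutator_def word_simps)
      then show ?thesis using ab lower_central_mult [OF 1 2] by simp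
    qed
    ultimately have "\<gamma> (Suc k) \<subseteq> ?H"
      unfolding lower_central_Suc_eq [OF step(1), symmetric]
      by (subst (1) lower_central_Suc_eq [OF step(1)], intro generate_subgroup_incl) auto
    then show ?case by blast
  qed
  then show ?thesis by unfold_locales blast
qed

context lcs_exponent_2
begin

lemma lcs_class_inv:
  assumes "1 \<le> k" "a \<in> \<gamma> k" shows "lcs_class G k (inv a) = lcs_class G k a"
proof -
  have "cls k (inv a) = cls k a"
    using square_mem [OF assms] lower_central_carrier [OF assms(2)] lower_central_inv [of "a \<otimes> a" "Suc k"]
    by (simp add: cls_eq_iff inv_mult_group)
  then show ?thesis by (simp add: lcs_class_def fun_eq_iff)
qed

lemma lcs_class_conj:
  assumes "1 \<le> k" "a \<in> \<gamma> k" "b \<in> carrier G" shows "lcs_class G k (inv b \<otimes> a \<otimes> b) = lcs_class G k a"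
proof -
  note c = lower_central_carrier [OF assms(2)] assms(3)
  have "comm (inv a) b \<in> \<gamma> (Suc k)"
    using assms lower_central_inv by (intro commutator_Suc) auto
  then have "inv (comm (inv a) b) \<in> \<gamma> (Suc k)" by (rule lower_central_inv)
  moreover have "inv b \<otimes> a \<otimes> b \<otimes> inv a = inv (comm (inv a) b)"
    using c by (simp add: group_commutator_def word_simps)
  ultimately have "cls k (inv b \<otimes> a \<otimes> b) = cls k a"
    using c by (simp add: cls_eq_iff)
  then show ?thesis by (simp add: lcs_class_def fun_eq_iff)
qed

lemma lcs_class_bracket_commute:
  assumes "1 \<le> i" "1 \<le> j" "a \<in> \<gamma> i" "b \<in> \<gamma> j"
  shows "lcs_class G i a \<otimes>\<^bsub>L\<^esub> lcs_class G j b = lcs_class G j b \<otimes>\<^bsub>L\<^esub> lcs_class G i a"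
proof -
  have "lcs_class G j b \<otimes>\<^bsub>L\<^esub> lcs_class G i a = lcs_class G (i + j) (inv (comm a b))"
    using assms lower_central_carrier by (simp add: lcs_class_bracket commutator_inv add.commute)
  then show ?thesis
    using assms by (simp add: lcs_class_inv commutator_add lcs_class_bracket)
qed

text \<open>The three factors of the Hall-Witt identity become the three Jacobi terms: on classes,
  inverses and conjugations disappear and products turn into sums.\<close>

lemma lcs_class_jacobi:
  assumes "1 \<le> i" "1 \<le> j" "1 \<le> k" "a \<in> \<gamma> i" "b \<in> \<gamma> j" "c \<in> \<gamma> k"
  shows "lcs_class G i a \<otimes>\<^bsub>L\<^esub> (lcs_class G j b \<otimes>\<^bsub>L\<^esub> lcs_class G k c)
    \<oplus>\<^bsub>L\<^esub> lcs_class G j b \<otimes>\<^bsub>L\<^esub> (lcs_class G k c \<otimes>\<^bsub>L\<^esub> lcs_class G i a)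
    \<oplus>\<^bsub>L\<^esub> lcs_class G k c \<otimes>\<^bsub>L\<^esub> (lcs_class G i a \<otimes>\<^bsub>L\<^esub> lcs_class G j b) = \<zero>\<^bsub>L\<^esub>"
proof -
  have triple: "lcs_class G i a \<otimes>\<^bsub>L\<^esub> (lcs_class G j b \<otimes>\<^bsub>L\<^esub> lcs_class G k c) =
      lcs_class G (i + j + k) (inv c \<otimes> comm (comm b (inv c)) a \<otimes> c)"
    and mem: "inv c \<otimes> comm (comm b (inv c)) a \<otimes> c \<in> \<gamma> (i + j + k)"
    if "1 \<le> i" "1 \<le> j" "1 \<le> k" "a \<in> \<gamma> i" "b \<in> \<gamma> j" "c \<in> \<gamma> k" for i j k a b c
  proof -
    have c: "inv c \<in> \<gamma> k" and cG: "c \<in> carrier G"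
      using that(6) lower_central_inv lower_central_carrier by auto
    have bc: "comm b (inv c) \<in> \<gamma> (j + k)" using that c by (intro commutator_add)
    have bca: "comm (comm b (inv c)) a \<in> \<gamma> (j + k + i)" using that by (intro commutator_add [OF _ _ bc]) auto
    then show "inv c \<otimes> comm (comm b (inv c)) a \<otimes> c \<in> \<gamma> (i + j + k)"
      using lower_central_conj' [OF bca cG] by (simp add: ac_simps)
    have "lcs_class G i a \<otimes>\<^bsub>L\<^esub> (lcs_class G j b \<otimes>\<^bsub>L\<^esub> lcs_class G k c)
        = lcs_class G i a \<otimes>\<^bsub>L\<^esub> (lcs_class G j b \<otimes>\<^bsub>L\<^esub> lcs_class G k (inv c))"
      using that by (simp add: lcs_class_inv)
    also have "\<dots> = lcs_class G (j + k) (comm b (inv c)) \<otimes>\<^bsub>L\<^esub> lcs_class G i a"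
    proof -
      have "lcs_class G j b \<otimes>\<^bsub>L\<^esub> lcs_class G k (inv c) = lcs_class G (j + k) (comm b (inv c))"
        using that c by (intro lcs_class_bracket)
      then show ?thesis
        using that bc lcs_class_bracket_commute [of i "j + k" a "comm b (inv c)"] by simp
    qed
    also have "\<dots> = lcs_class G (j + k + i) (comm (comm b (inv c)) a)"
      using that bc by (simp add: lcs_class_bracket)
    also have "\<dots> = lcs_class G (j + k + i) (inv c \<otimes> comm (comm b (inv c)) a \<otimes> c)"
      using that bca cG by (simp add: lcs_class_conj)
    finally show "lcs_class G i a \<otimes>\<^bsub>L\<^esub> (lcs_class G j b \<otimes>\<^bsub>L\<^esub> lcs_class G k c) =
      lcs_class G (i + j + k) (inv c \<otimes> comm (comm b (inv c)) a \<otimes> c)"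
      by (simp add: ac_simps)
  qed
  let ?n = "i + j + k"
  let ?X = "inv c \<otimes> comm (comm b (inv c)) a \<otimes> c"
    and ?Y = "inv a \<otimes> comm (comm c (inv a)) b \<otimes> a"
    and ?Z = "inv b \<otimes> comm (comm a (inv b)) c \<otimes> b"
  have n: "j + k + i = ?n" "k + i + j = ?n" "1 \<le> ?n" using assms by auto
  have X: "?X \<in> \<gamma> ?n" using mem [of i j k a b c] assms by simp
  have Y: "?Y \<in> \<gamma> ?n" using mem [of j k i b c a] assms by (simp add: n)
  have Z: "?Z \<in> \<gamma> ?n" using mem [of k i j c a b] assms by (simp add: n)
  note cG = X [THEN lower_central_carrier] Y [THEN lower_central_carrier] Z [THEN lower_central_carrier]
  have "?Z \<otimes> (?X \<otimes> ?Y) = \<one>"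
    using assms lower_central_carrier by (intro hall_witt) auto
  \<comment> \<open>Hall-Witt delivers the factors in the order Z, X, Y; a product equal to one may
    be rotated.\<close>
  then have "?X \<otimes> ?Y \<otimes> ?Z = \<one>"
    using cG inv_comm [of ?Z "?X \<otimes> ?Y"] by blast
  then have "lcs_class G ?n (?X \<otimes> ?Y \<otimes> ?Z) = \<zero>\<^bsub>L\<^esub>"
    using n by (simp add: lcs_class_one)
  then have "lcs_class G ?n ?X \<oplus>\<^bsub>L\<^esub> lcs_class G ?n ?Y \<oplus>\<^bsub>L\<^esub> lcs_class G ?n ?Z = \<zero>\<^bsub>L\<^esub>"
    using lcs_class_add [OF n(3) lower_central_mult [OF X Y] Z] lcs_class_add [OF n(3) X Y] by simp
  then show ?thesis
    using triple [of i j k a b c] triple [of j k i b c a] triple [of k i j c a b] assms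
    by (simp add: n)
qed

lemma lcs_lie_abelian: "abelian_2_group L"
proof -
  have self: "x \<oplus>\<^bsub>L\<^esub> x = \<zero>\<^bsub>L\<^esub>" if x: "x \<in> carrier L" for x
  proof -
    have "x n \<otimes>\<^bsub>Q n\<^esub> x n = \<one>\<^bsub>Q n\<^esub>" if n: "1 \<le> n" for n
    proof -
      obtain a where a: "a \<in> \<gamma> n" "x n = cls n a"
        using lcs_lie_component [OF x n] by (auto simp: lcs_quotient_carrier)
      then show ?thesis
        using square_mem [OF n a(1)] lower_central_carrier by (simp add: lcs_quotient_mult cls_eq_one_iff)
    qed
    then show ?thesis by (auto simp: lcs_lie_ops intro!: restrict_ext)
  qed
  have grp: "comm_group (Q n)" if "1 \<le> n" for n
    using lcs_quotient_comm_group [OF that] .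
  have zero: "\<zero>\<^bsub>L\<^esub> \<in> carrier L"
    using lcs_class_closed [OF order.refl lower_central_one] lcs_class_one [OF order.refl] by metis
  have "abelian_group L"
  proof (rule abelian_groupI)
    fix x y z assume xyz: "x \<in> carrier L" "y \<in> carrier L" "z \<in> carrier L"
    show "x \<oplus>\<^bsub>L\<^esub> y \<oplus>\<^bsub>L\<^esub> z = x \<oplus>\<^bsub>L\<^esub> (y \<oplus>\<^bsub>L\<^esub> z)"
      using xyz lcs_lie_component comm_groupE(3) [OF grp] by (auto simp: lcs_lie_ops intro!: restrict_ext)
  next
    fix x y assume xy: "x \<in> carrier L" "y \<in> carrier L"
    show "x \<oplus>\<^bsub>L\<^esub> y = y \<oplus>\<^bsub>L\<^esub> x"
      using xy lcs_lie_component comm_groupE(4) [OF grp] by (auto simp: lcs_lie_ops intro!: restrict_ext)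
  next
    fix x assume x: "x \<in> carrier L"
    show "\<zero>\<^bsub>L\<^esub> \<oplus>\<^bsub>L\<^esub> x = x"
    proof (rule lcs_lie_ext [OF lcs_lie_add_closed [OF zero x] x])
      show "(\<zero>\<^bsub>L\<^esub> \<oplus>\<^bsub>L\<^esub> x) n = x n" if "1 \<le> n" for n
        using that lcs_lie_component [OF x that] comm_groupE(5) [OF grp] by (simp add: lcs_lie_ops)
    qed
    show "\<exists>y\<in>carrier L. y \<oplus>\<^bsub>L\<^esub> x = \<zero>\<^bsub>L\<^esub>"
      using x self by blast
  qed (simp_all add: lcs_lie_add_closed zero)
  then show ?thesis
    by (intro abelian_2_group.intro abelian_2_group_axioms.intro self)
qed

lemma lcs_lie_lie_algebra: "lie_algebra Z2 L"
proof (rule lie_algebra_Z2I [OF lcs_lie_abelian])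
  let ?S = "{lcs_class G k a | k a. 1 \<le> k \<and> a \<in> \<gamma> k}"
  show "?S \<subseteq> carrier L" using lcs_class_closed by blast
  show "carrier L \<subseteq> add_span L ?S"
  proof
    fix x assume "x \<in> carrier L"
    then have "x \<in> add_span L {lcs_class G k a | k a. 1 \<le> k \<and> 1 \<le> k \<and> a \<in> \<gamma> k}"
      by (rule lcs_lie_span) simp
    then show "x \<in> add_span L ?S"
      by (rule add_span_mono) auto
  qed
  show "x \<otimes>\<^bsub>L\<^esub> x = \<zero>\<^bsub>L\<^esub>" if S: "x \<in> ?S" for x
  proof -
    obtain k a where a: "x = lcs_class G k a" "1 \<le> k" "a \<in> \<gamma> k" using S by blast
    have "comm a a = \<one>" using lower_central_carrier [OF a(3)] by (simp add: group_commutator_def word_simps)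
    then show ?thesis using a by (simp add: lcs_class_bracket lcs_class_one)
  qed
  show "x \<otimes>\<^bsub>L\<^esub> y = y \<otimes>\<^bsub>L\<^esub> x" if "x \<in> ?S" "y \<in> ?S" for x y
    using that lcs_class_bracket_commute by blast
  show "x \<otimes>\<^bsub>L\<^esub> (y \<otimes>\<^bsub>L\<^esub> z) \<oplus>\<^bsub>L\<^esub> y \<otimes>\<^bsub>L\<^esub> (z \<otimes>\<^bsub>L\<^esub> x) \<oplus>\<^bsub>L\<^esub> z \<otimes>\<^bsub>L\<^esub> (x \<otimes>\<^bsub>L\<^esub> y) = \<zero>\<^bsub>L\<^esub>"
    if S: "x \<in> ?S" "y \<in> ?S" "z \<in> ?S" for x y z
  proof -
    obtain i a j b k c where "x = lcs_class G i a" "y = lcs_class G j b" "z = lcs_class G k c"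
      "1 \<le> i" "1 \<le> j" "1 \<le> k" "a \<in> \<gamma> i" "b \<in> \<gamma> j" "c \<in> \<gamma> k"
      using S by blast
    then show ?thesis using lcs_class_jacobi by simp
  qed
  fix x assume x: "x \<in> carrier L"
  show "0 \<odot>\<^bsub>L\<^esub> x = \<zero>\<^bsub>L\<^esub>" by (auto simp: lcs_lie_ops)
  show "1 \<odot>\<^bsub>L\<^esub> x = x"
  proof
    fix n show "(1 \<odot>\<^bsub>L\<^esub> x) n = x n"
      using x lcs_lie_component [OF x] group.int_pow_1 [OF lcs_quotient_group]
      by (cases "1 \<le> n") (auto simp: lcs_lie_ops lcs_lie_carrier PiE_iff extensional_def)
  qed
qed (fact lcs_lie_bracket_closed lcs_lie_bracket_add_left lcs_lie_bracket_add_right)+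

sublocale L: lie_algebra_Z2 L
  by (intro lie_algebra_Z2.intro lcs_lie_lie_algebra)

section \<open>The commutator subalgebra and the squaring map\<close>

abbreviation L' where "L' \<equiv> lcs_lie_derived G"
abbreviation h where "h \<equiv> lcs_square G"

lemma derived_simps [simp]:
  "x \<oplus>\<^bsub>L'\<^esub> y = x \<oplus>\<^bsub>L\<^esub> y" "x \<otimes>\<^bsub>L'\<^esub> y = x \<otimes>\<^bsub>L\<^esub> y" "\<zero>\<^bsub>L'\<^esub> = \<zero>\<^bsub>L\<^esub>" "r \<odot>\<^bsub>L'\<^esub> x = r \<odot>\<^bsub>L\<^esub> x"
  by (simp_all add: lcs_lie_derived_def)

lemma derived_carrier: "x \<in> carrier L' \<longleftrightarrow> x \<in> carrier L \<and> x 1 = \<one>\<^bsub>Q 1\<^esub>"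
  by (simp add: lcs_lie_derived_def)

text \<open>In degree 1 the convolution sum is empty.\<close>

lemma lcs_lie_bracket_at_1: "(x \<otimes>\<^bsub>L\<^esub> y) 1 = \<one>\<^bsub>Q 1\<^esub>"
proof -
  interpret Q1: comm_group "Q 1" by (rule lcs_quotient_comm_group) simp
  show ?thesis by (simp add: lcs_lie_ops)
qed

lemma derived_subalgebra: "lie_subalgebra Z2 L (carrier L')"
proof -
  have 1: "\<one>\<^bsub>Q 1\<^esub> \<otimes>\<^bsub>Q 1\<^esub> \<one>\<^bsub>Q 1\<^esub> = \<one>\<^bsub>Q 1\<^esub>"
    using lcs_quotient_group [of 1] by (simp add: group.is_monoid monoid.l_one monoid.one_closed)
  have "submodule (carrier L') Z2 L"
    by (rule L.Z2_submoduleI) (auto simp: derived_carrier lcs_lie_ops(1,2) 1 simp del: L.a_closed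
        intro: lcs_lie_add_closed [unfolded lcs_lie_ops(1)] L.zero_closed [unfolded lcs_lie_ops(2)])
  then show ?thesis
    by (auto simp: lie_subalgebra_def derived_carrier lcs_lie_bracket_closed lcs_lie_bracket_at_1)
qed

lemma derived_eq: "L' = L\<lparr>carrier := carrier L'\<rparr>"
  by (simp add: lcs_lie_derived_def)

sublocale L': lie_algebra_Z2 L'
  using L.subalgebra_lie_algebra [OF derived_subalgebra] derived_eq by (simp add: lie_algebra_Z2_def)

lemma lcs_class_derived: "2 \<le> k \<Longrightarrow> a \<in> \<gamma> k \<Longrightarrow> lcs_class G k a \<in> carrier L'"
  using lcs_class_closed [of k a] by (simp add: derived_carrier lcs_class_def)

lemma derived_span:
  "carrier L' \<subseteq> add_span L {lcs_class G k a | k a. 2 \<le> k \<and> a \<in> \<gamma> k}"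
proof
  fix x assume x: "x \<in> carrier L'"
  have "x \<in> add_span L {lcs_class G k a | k a. 1 \<le> k \<and> 2 \<le> k \<and> a \<in> \<gamma> k}"
  proof (rule lcs_lie_span)
    fix n :: nat assume "1 \<le> n" "n < 2"
    then have "n = 1" by simp
    then show "x n = \<one>\<^bsub>Q n\<^esub>" using x by (simp add: derived_carrier)
  qed (use x in \<open>simp add: derived_carrier\<close>)
  then show "x \<in> add_span L {lcs_class G k a | k a. 2 \<le> k \<and> a \<in> \<gamma> k}"
    by (rule add_span_mono) blast
qed

text \<open>The two elements differ by a conjugate of \<open>comm a (inv b)\<close>, which lies in
  \<open>\<gamma> (k + k)\<close>; the bound \<open>2 \<le> k\<close> places it in
  \<open>\<gamma> (k + 2)\<close>. Both the well-definedness and the additivity of the squaring map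
  rest on this.\<close>

lemma cls_square_mult:
  assumes "2 \<le> k" "a \<in> \<gamma> k" "b \<in> \<gamma> k"
  shows "cls (Suc k) (a \<otimes> b \<otimes> (a \<otimes> b)) = cls (Suc k) (a \<otimes> a \<otimes> (b \<otimes> b))"
proof -
  note c = assms(2,3) [THEN lower_central_carrier]
  have "comm a (inv b) \<in> \<gamma> (k + k)"
    using assms lower_central_inv by (intro commutator_add) auto
  then have "comm a (inv b) \<in> \<gamma> (Suc (Suc k))"
    by (rule lower_central_antimono [rotated]) (use assms in simp)
  then have "a \<otimes> a \<otimes> comm a (inv b) \<otimes> inv (a \<otimes> a) \<in> \<gamma> (Suc (Suc k))"
    using c by (intro lower_central_conj) auto
  moreover have "a \<otimes> b \<otimes> (a \<otimes> b) \<otimes> inv (a \<otimes> a \<otimes> (b \<otimes> b)) = a \<otimes> a \<otimes> comm a (inv b) \<otimes> inv (a \<otimes> a)"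
    using c by (simp add: group_commutator_def word_simps)
  ultimately show ?thesis using c by (simp add: cls_eq_iff)
qed

lemma cls_square:
  assumes "2 \<le> k" "a \<in> \<gamma> k"
  shows "(\<Union>b\<in>cls k a. cls (Suc k) (b \<otimes> b)) = cls (Suc k) (a \<otimes> a)"
proof (rule UN_constant_on [OF cls_self [OF assms(2)]])
  fix b assume "b \<in> cls k a"
  then obtain x where x: "x \<in> \<gamma> (Suc k)" "b = x \<otimes> a" using cls_elem [OF assms(2)] by blast
  have xx: "x \<otimes> x \<in> \<gamma> (Suc (Suc k))" using x by (intro square_mem) auto
  have c: "x \<in> carrier G" "a \<in> carrier G" using x assms lower_central_carrier by auto
  have "cls (Suc k) (b \<otimes> b) = cls (Suc k) (x \<otimes> x \<otimes> (a \<otimes> a))"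
    using cls_square_mult [OF assms(1) _ assms(2), of x] x lower_central_Suc_subset by blast
  also have "\<dots> = cls (Suc k) (a \<otimes> a)"
    using c xx by (simp add: cls_eq_iff m_assoc)
  finally show "cls (Suc k) (b \<otimes> b) = cls (Suc k) (a \<otimes> a)" .
qed

lemma lcs_square_at:
  assumes "2 \<le> k" "a \<in> \<gamma> k" "x k = cls k a"
  shows "h x (Suc k) = cls (Suc k) (a \<otimes> a)"
  using assms cls_square [OF assms(1,2)] by (simp add: lcs_square_def)

lemma lcs_square_low: "1 \<le> n \<Longrightarrow> n < 3 \<Longrightarrow> h x n = \<one>\<^bsub>Q n\<^esub>"
  by (simp add: lcs_square_def)

lemma lcs_square_cases:
  assumes "1 \<le> n"
  obtains (low) "n < 3" | (high) k where "n = Suc k" "2 \<le> k"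
proof (cases "n < 3")
  case False
  then show ?thesis using high [of "n - 1"] by simp
qed (use low in blast)

lemma lcs_square_closed:
  assumes x: "x \<in> carrier L" shows "h x \<in> carrier L'"
proof -
  obtain N where N: "\<And>n. N < n \<Longrightarrow> 1 \<le> n \<Longrightarrow> x n = \<one>\<^bsub>Q n\<^esub>"
    using lcs_lie_boundE [OF x] by blast
  have "h x \<in> carrier L"
  proof (rule lcs_lie_carrierI)
    show "h x \<in> extensional {1..}" by (simp add: lcs_square_def)
    fix n :: nat assume n: "1 \<le> n"
    show "h x n \<in> carrier (Q n)"
      using n
    proof (cases rule: lcs_square_cases)
      case low
      then show ?thesis
        using n lcs_quotient_group [OF n] by (simp add: lcs_square_low group.is_monoid monoid.one_closed)
    next
      case (high k)
      then obtain a where "a \<in> \<gamma> k" "x k = cls k a"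
        using lcs_lie_component [OF x, of k] by (auto simp: lcs_quotient_carrier)
      then show ?thesis
        using high square_mem [of k a] by (simp add: lcs_square_at lcs_quotient_carrier)
    qed
    assume nN: "Suc N < n"
    show "h x n = \<one>\<^bsub>Q n\<^esub>"
      using n
    proof (cases rule: lcs_square_cases)
      case low
      then show ?thesis using n by (simp add: lcs_square_low)
    next
      case (high k)
      then have "x k = cls k \<one>" using N [of k] nN by (simp add: lcs_quotient_one)
      then show ?thesis
        using high by (simp add: lcs_square_at [OF _ lower_central_one] lcs_quotient_one)
    qed
  qed
  then show ?thesis by (simp add: derived_carrier lcs_square_low)
qed

lemma lcs_square_add:
  assumes "x \<in> carrier L" "y \<in> carrier L" shows "h (x \<oplus>\<^bsub>L\<^esub> y) = h x \<oplus>\<^bsub>L\<^esub> h y"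
proof (rule lcs_lie_ext)
  fix n :: nat assume n: "1 \<le> n"
  from n show "h (x \<oplus>\<^bsub>L\<^esub> y) n = (h x \<oplus>\<^bsub>L\<^esub> h y) n"
  proof (cases rule: lcs_square_cases)
    case low
    then show ?thesis
      using n lcs_quotient_group [OF n]
      by (simp add: lcs_square_low lcs_lie_add_at group.is_monoid monoid.l_one monoid.one_closed)
  next
    case (high k)
    then obtain a b where ab: "a \<in> \<gamma> k" "x k = cls k a" "b \<in> \<gamma> k" "y k = cls k b"
      using lcs_lie_component [OF assms(1), of k] lcs_lie_component [OF assms(2), of k]
      by (auto simp: lcs_quotient_carrier)
    then have "(x \<oplus>\<^bsub>L\<^esub> y) k = cls k (a \<otimes> b)"
      using high by (simp add: lcs_lie_add_at lcs_quotient_mult)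
    moreover have "a \<otimes> a \<in> \<gamma> (Suc k)" "b \<otimes> b \<in> \<gamma> (Suc k)"
      using square_mem ab high by auto
    ultimately show ?thesis
      using high ab cls_square_mult [of k a b]
      by (simp add: lcs_lie_add_at lcs_square_at [OF _ lower_central_mult] lcs_square_at lcs_quotient_mult)
  qed
next
  show "h (x \<oplus>\<^bsub>L\<^esub> y) \<in> carrier L" "h x \<oplus>\<^bsub>L\<^esub> h y \<in> carrier L"
    using assms lcs_square_closed lcs_lie_add_closed by (auto simp: derived_carrier)
qed

lemma lcs_square_class:
  assumes "2 \<le> k" "a \<in> \<gamma> k" shows "h (lcs_class G k a) = lcs_class G (Suc k) (a \<otimes> a)"
proof (rule lcs_lie_ext)
  fix n :: nat assume n: "1 \<le> n"
  from n show "h (lcs_class G k a) n = lcs_class G (Suc k) (a \<otimes> a) n"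
  proof (cases rule: lcs_square_cases)
    case low
    then show ?thesis using n assms by (simp add: lcs_square_low lcs_class_def)
  next
    case (high l)
    show ?thesis
    proof (cases "l = k")
      case True
      then show ?thesis
        using assms high by (simp add: lcs_square_at [OF assms] lcs_class_def)
    next
      case False
      then have "lcs_class G k a l = cls l \<one>" using high by (simp add: lcs_class_def lcs_quotient_one)
      then show ?thesis
        using False high
        by (simp add: lcs_square_at [OF _ lower_central_one] lcs_class_def lcs_quotient_one)
    qed
  qed
next
  show "h (lcs_class G k a) \<in> carrier L" "lcs_class G (Suc k) (a \<otimes> a) \<in> carrier L"
    using assms lcs_square_closed [OF lcs_class_closed, of k a] square_mem [of k a]
    by (auto simp: derived_carrier intro!: lcs_class_closed)
qed

lemma lcs_square_zero: "h \<zero>\<^bsub>L\<^esub> = \<zero>\<^bsub>L\<^esub>"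
  using lcs_square_add [of "\<zero>\<^bsub>L\<^esub>" "\<zero>\<^bsub>L\<^esub>"] lcs_square_closed [of "\<zero>\<^bsub>L\<^esub>"] L.add_self
  by (simp add: derived_carrier)

text \<open>\<open>comm (a \<otimes> a) b\<close> agrees with the square of \<open>comm a b\<close>
  up to a conjugate of \<open>comm (comm a b) a\<close>, which has degree \<open>2 k + l\<close> and
  so at least \<open>k + l + 2\<close>. The bound concerns \<open>a\<close> alone: \<open>b\<close>
  may have degree 1, as it does when \<open>h\<close> is moved past the class of a
  generator.\<close>

lemma lcs_square_bracket_class:
  assumes "2 \<le> k" "a \<in> \<gamma> k" "1 \<le> l" "b \<in> \<gamma> l"
  shows "h (lcs_class G k a) \<otimes>\<^bsub>L\<^esub> lcs_class G l b = h (lcs_class G k a \<otimes>\<^bsub>L\<^esub> lcs_class G l b)"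
proof -
  note c = assms(2,4) [THEN lower_central_carrier]
  have k: "1 \<le> k" using assms(1) by simp
  have ab: "comm a b \<in> \<gamma> (k + l)" using k assms by (intro commutator_add)
  have "comm (comm a b) a \<in> \<gamma> (k + l + k)" using k assms ab by (intro commutator_add) auto
  then have "comm (comm a b) a \<in> \<gamma> (Suc (Suc (k + l)))"
    by (rule lower_central_antimono [rotated]) (use assms in simp)
  then have "comm a b \<otimes> comm (comm a b) a \<otimes> inv (comm a b) \<in> \<gamma> (Suc (Suc (k + l)))"
    using c by (intro lower_central_conj commutator_closed)
  moreover have "comm (a \<otimes> a) b \<otimes> inv (comm a b \<otimes> comm a b) =
      comm a b \<otimes> comm (comm a b) a \<otimes> inv (comm a b)"
    using c by (simp add: commutator_mult_left commutator_closed word_simps)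
  ultimately have "cls (Suc (k + l)) (comm (a \<otimes> a) b) = cls (Suc (k + l)) (comm a b \<otimes> comm a b)"
    using c by (simp add: cls_eq_iff commutator_closed)
  then have "lcs_class G (Suc (k + l)) (comm (a \<otimes> a) b) = lcs_class G (Suc (k + l)) (comm a b \<otimes> comm a b)"
    by (simp add: lcs_class_def fun_eq_iff)
  then show ?thesis
    using assms k ab square_mem [OF k assms(2)]
    by (simp add: lcs_square_class lcs_class_bracket)
qed

lemma lcs_square_bracket:
  assumes "x \<in> carrier L'" "y \<in> carrier L"
  shows "h x \<otimes>\<^bsub>L\<^esub> y = h (x \<otimes>\<^bsub>L\<^esub> y)"
proof -
  let ?S2 = "{lcs_class G k a | k a. 2 \<le> k \<and> a \<in> \<gamma> k}"
  let ?S1 = "{lcs_class G k a | k a. 1 \<le> k \<and> a \<in> \<gamma> k}"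
  have S2: "?S2 \<subseteq> carrier L" and S1: "?S1 \<subseteq> carrier L"
    using lcs_class_closed by auto
  have hc: "h x \<in> carrier L" if "x \<in> carrier L" for x
    using lcs_square_closed [OF that] by (simp add: derived_carrier)
  have 1: "h x \<otimes>\<^bsub>L\<^esub> y = h (x \<otimes>\<^bsub>L\<^esub> y)" if x: "x \<in> ?S2" and y: "y \<in> carrier L" for x y
  proof -
    have xL: "x \<in> carrier L" using x S2 by blast
    have "y \<in> add_span L {lcs_class G k a | k a. 1 \<le> k \<and> 1 \<le> k \<and> a \<in> \<gamma> k}"
      by (rule lcs_lie_span [OF y]) simp
    then have "y \<in> add_span L ?S1"
      by (rule add_span_mono) auto
    then show ?thesis
    proof induction
      case zero
      then show ?case using xL hc by (simp add: L.bracket_zero_right lcs_square_zero)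
    next
      case (base y)
      then show ?case using x lcs_square_bracket_class by blast
    next
      case (add y z)
      then show ?case
        using xL hc L.add_span_closed [OF _ S1]
        by (simp add: L.bracket_add_right lcs_square_add lcs_lie_bracket_closed)
    qed
  qed
  have "x \<in> add_span L ?S2" using assms(1) derived_span by blast
  then show ?thesis
  proof induction
    case zero
    then show ?case using assms(2) by (simp add: L.bracket_zero_left lcs_square_zero)
  next
    case (base x)
    then show ?case using 1 assms(2) by blast
  next
    case (add x z)
    then show ?case
      using assms(2) hc L.add_span_closed [OF _ S2]
      by (simp add: L.bracket_add_left lcs_square_add lcs_lie_bracket_closed)
  qed
qed

text \<open>For an involution \<open>g\<close> the commutator \<open>y = (g, x)\<close> is inverted by \<open>g\<close>, hence \<open>(g, y) = y\<^sup>2\<close>.\<close>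

lemma involution_bracket_twice:
  assumes g: "g \<in> carrier G" "g \<otimes> g = \<one>" and x: "1 \<le> k" "x \<in> \<gamma> k"
  shows "lcs_class G 1 g \<otimes>\<^bsub>L\<^esub> (lcs_class G 1 g \<otimes>\<^bsub>L\<^esub> lcs_class G k x) = h (lcs_class G 1 g \<otimes>\<^bsub>L\<^esub> lcs_class G k x)"
proof -
  have g1: "g \<in> \<gamma> 1" using g by (simp add: One_nat_def)
  note c = g(1) lower_central_carrier [OF x(2)]
  have inv: "inv g = g" using g inv_equality by blast
  have gg: "g \<otimes> (g \<otimes> z) = z" if "z \<in> carrier G" for z
    using that g by (simp add: m_assoc [symmetric])
  have "comm g (comm g x) = comm g x \<otimes> comm g x"
    using c by (simp add: group_commutator_def inv gg word_simps)
  then show ?thesis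
    using g1 x commutator_add [OF _ x(1) g1 x(2)]
    by (simp add: lcs_class_bracket lcs_square_class plus_1_eq_Suc)
qed

end

section \<open>Homogeneous components and powers of the squaring map\<close>

context lcs_exponent_2
begin

text \<open>Components of the full algebra and not only of \<open>L'\<close>, so that the classes of
  the generators are homogeneous as well. The component of index 0 contains only zero.\<close>

definition lcs_component :: "nat \<Rightarrow> (nat \<Rightarrow> 'a set) set" where
  "lcs_component n = {x \<in> carrier L. \<forall>k\<ge>1. k \<noteq> n \<longrightarrow> x k = \<one>\<^bsub>Q k\<^esub>}"

lemma lcs_component_carrier: "x \<in> lcs_component n \<Longrightarrow> x \<in> carrier L"
  by (simp add: lcs_component_def)

lemma zero_component: "\<zero>\<^bsub>L\<^esub> \<in> lcs_component n"
  using L.zero_closed by (simp add: lcs_component_def) (simp add: lcs_lie_ops)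

lemma add_component:
  assumes "x \<in> lcs_component n" "y \<in> lcs_component n" shows "x \<oplus>\<^bsub>L\<^esub> y \<in> lcs_component n"
proof -
  have "\<one>\<^bsub>Q k\<^esub> \<otimes>\<^bsub>Q k\<^esub> \<one>\<^bsub>Q k\<^esub> = \<one>\<^bsub>Q k\<^esub>" if "1 \<le> k" for k
    using lcs_quotient_group [OF that] by (simp add: group.is_monoid monoid.l_one monoid.one_closed)
  then show ?thesis
    using assms lcs_lie_add_closed by (auto simp: lcs_component_def lcs_lie_add_at)
qed

lemma class_component: "\<lbrakk>1 \<le> k; a \<in> \<gamma> k\<rbrakk> \<Longrightarrow> lcs_class G k a \<in> lcs_component k"
  by (simp add: lcs_component_def lcs_class_closed) (simp add: lcs_class_def)

lemma lcs_component_0: "x \<in> lcs_component 0 \<Longrightarrow> x = \<zero>\<^bsub>L\<^esub>"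
  by (rule lcs_lie_ext [OF _ L.zero_closed]) (auto simp: lcs_component_def lcs_lie_ops(2))

lemma lcs_component_class:
  assumes "x \<in> lcs_component n" "1 \<le> n"
  obtains a where "a \<in> \<gamma> n" "x = lcs_class G n a"
proof -
  obtain a where a: "a \<in> \<gamma> n" "x n = cls n a"
    using lcs_lie_component [OF lcs_component_carrier [OF assms(1)] assms(2)]
    by (auto simp: lcs_quotient_carrier)
  have "x = lcs_class G n a"
  proof (rule lcs_lie_ext)
    show "x k = lcs_class G n a k" if "1 \<le> k" for k
      using that a assms(1) by (auto simp: lcs_class_def lcs_component_def)
  qed (use assms a lcs_class_closed lcs_component_carrier in auto)
  with a that show ?thesis by blast
qed

lemma bracket_component:
  assumes "x \<in> lcs_component i" "y \<in> lcs_component j" shows "x \<otimes>\<^bsub>L\<^esub> y \<in> lcs_component (i + j)"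
proof -
  have c: "x \<in> carrier L" "y \<in> carrier L" using assms lcs_component_carrier by auto
  consider "i = 0" | "j = 0" | "1 \<le> i" "1 \<le> j" by (cases "i = 0"; cases "j = 0") auto
  then show ?thesis
  proof cases
    case 1
    then have "x = \<zero>\<^bsub>L\<^esub>" using assms lcs_component_0 by auto
    then show ?thesis using c by (simp add: L.bracket_zero_left zero_component)
  next
    case 2
    then have "y = \<zero>\<^bsub>L\<^esub>" using assms lcs_component_0 by auto
    then show ?thesis using c by (simp add: L.bracket_zero_right zero_component)
  next
    case 3
    obtain a b where "a \<in> \<gamma> i" "x = lcs_class G i a" "b \<in> \<gamma> j" "y = lcs_class G j b"
      using lcs_component_class [OF assms(1) 3(1)] lcs_component_class [OF assms(2) 3(2)] by metis
    then show ?thesis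
      using 3 by (simp add: lcs_class_bracket class_component commutator_add)
  qed
qed

lemma derived_component_iff: "x \<in> lcs_derived_component G n \<longleftrightarrow> x \<in> carrier L' \<and> x \<in> lcs_component n"
  by (auto simp: lcs_derived_component_def lcs_component_def derived_carrier)

lemma component_derived: "2 \<le> n \<Longrightarrow> x \<in> lcs_component n \<Longrightarrow> x \<in> carrier L'"
  by (auto simp: derived_carrier lcs_component_def)

lemma lcs_square_component:
  assumes "x \<in> carrier L'" "x \<in> lcs_component n" shows "h x \<in> lcs_component (Suc n)"
proof (cases "2 \<le> n")
  case True
  then obtain a where "a \<in> \<gamma> n" "x = lcs_class G n a"
    using lcs_component_class [OF assms(2)] by auto
  then show ?thesis
    using True by (simp add: lcs_square_class class_component square_mem)
next
  case False
  \<comment> \<open>\<open>L'\<close> has nothing below degree 2.\<close>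
  have "x = \<zero>\<^bsub>L\<^esub>"
  proof (rule lcs_lie_ext)
    show "x k = \<zero>\<^bsub>L\<^esub> k" if "1 \<le> k" for k
      using that assms False by (cases "k = 1") (auto simp: lcs_lie_ops(2) derived_carrier lcs_component_def)
  qed (use assms in \<open>auto simp: derived_carrier\<close>)
  then show ?thesis by (simp add: lcs_square_zero zero_component)
qed

lemma derived_carrier_closed: "x \<in> carrier L' \<Longrightarrow> x \<in> carrier L"
  by (simp add: derived_carrier)

lemma derived_add_span: "add_span L' S = add_span L S"
  unfolding lcs_lie_derived_def by (rule add_span_carrier_update)

lemma derived_graded: "graded_lie_algebra Z2 L' (lcs_derived_component G)"
proof (rule L'.graded_by_projections [where \<pi> = "\<lambda>n x. \<lambda>k\<in>{1..}. if k = n then x k else \<one>\<^bsub>Q k\<^esub>"])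
  show "submodule (lcs_derived_component G n) Z2 L'" for n
    using L'.a_closed L'.zero_closed
    by (intro L'.Z2_submoduleI) (auto simp: derived_component_iff zero_component add_component)
  show "x \<otimes>\<^bsub>L'\<^esub> y \<in> lcs_derived_component G (i + j)"
    if "x \<in> lcs_derived_component G i" "y \<in> lcs_derived_component G j" for i j x y
    using that L'.bracket_closed [of x y] by (simp add: derived_component_iff bracket_component)
  have "{lcs_class G k a | k a. 2 \<le> k \<and> a \<in> \<gamma> k} \<subseteq> (\<Union>n. lcs_derived_component G n)"
  proof clarify
    fix k a assume "2 \<le> k" "a \<in> \<gamma> k"
    then have "lcs_class G k a \<in> lcs_derived_component G k"
      by (simp add: derived_component_iff lcs_class_derived class_component)
    then show "lcs_class G k a \<in> (\<Union>n. lcs_derived_component G n)" by blast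
  qed
  then have "carrier L' \<subseteq> add_span L (\<Union>n. lcs_derived_component G n)"
    using derived_span add_span_mono [of _ L "{lcs_class G k a | k a. 2 \<le> k \<and> a \<in> \<gamma> k}"] by auto
  then show "carrier L' \<subseteq> add_span L' (\<Union>n. lcs_derived_component G n)"
    by (simp only: derived_add_span)
  have one: "\<one>\<^bsub>Q k\<^esub> \<otimes>\<^bsub>Q k\<^esub> \<one>\<^bsub>Q k\<^esub> = \<one>\<^bsub>Q k\<^esub>" if "1 \<le> k" for k
    using lcs_quotient_group [OF that] by (simp add: group.is_monoid monoid.l_one monoid.one_closed)
  then show "(\<lambda>k\<in>{1..}. if k = n then (x \<oplus>\<^bsub>L'\<^esub> y) k else \<one>\<^bsub>Q k\<^esub>) =
      (\<lambda>k\<in>{1..}. if k = n then x k else \<one>\<^bsub>Q k\<^esub>) \<oplus>\<^bsub>L'\<^esub> (\<lambda>k\<in>{1..}. if k = n then y k else \<one>\<^bsub>Q k\<^esub>)" for n x y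
    by (auto simp: lcs_lie_ops(1) intro!: restrict_ext)
  show "(\<lambda>k\<in>{1..}. if k = n then x k else \<one>\<^bsub>Q k\<^esub>) = (if n = l then x else \<zero>\<^bsub>L'\<^esub>)"
    if "x \<in> lcs_derived_component G l" for n l x
  proof
    fix k
    have "x \<in> carrier L" "k \<noteq> l \<Longrightarrow> 1 \<le> k \<Longrightarrow> x k = \<one>\<^bsub>Q k\<^esub>"
      using that by (auto simp: derived_component_iff lcs_component_def)
    then show "(\<lambda>k\<in>{1..}. if k = n then x k else \<one>\<^bsub>Q k\<^esub>) k = (if n = l then x else \<zero>\<^bsub>L'\<^esub>) k"
      by (cases "1 \<le> k") (auto simp: lcs_lie_ops(2) lcs_lie_carrier PiE_iff extensional_def)
  qed
qed

lemma lcs_square_power_closed: "x \<in> carrier L' \<Longrightarrow> (h ^^ k) x \<in> carrier L'"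
  by (induction k) (auto intro: lcs_square_closed derived_carrier_closed)

lemma lcs_square_power_add:
  "\<lbrakk>x \<in> carrier L'; y \<in> carrier L'\<rbrakk> \<Longrightarrow> (h ^^ k) (x \<oplus>\<^bsub>L\<^esub> y) = (h ^^ k) x \<oplus>\<^bsub>L\<^esub> (h ^^ k) y"
  by (induction k) (auto simp: lcs_square_add derived_carrier_closed lcs_square_power_closed)

lemma lcs_square_power_zero: "(h ^^ k) \<zero>\<^bsub>L\<^esub> = \<zero>\<^bsub>L\<^esub>"
  by (induction k) (auto simp: lcs_square_zero)

text \<open>\<open>h\<close> leaves the left factor by \<open>lcs_square_bracket\<close>, and the
  right factor by the same rule after commuting the bracket. This is what makes the map on
  polynomials respect brackets of monomials.\<close>

lemma lcs_square_power_bracket: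
  assumes "x \<in> carrier L'" "y \<in> carrier L'"
  shows "(h ^^ k) x \<otimes>\<^bsub>L\<^esub> (h ^^ l) y = (h ^^ (k + l)) (x \<otimes>\<^bsub>L\<^esub> y)"
proof (induction k)
  case 0
  show ?case
  proof (induction l)
    case (Suc l)
    have c: "(h ^^ l) y \<in> carrier L'" "h ((h ^^ l) y) \<in> carrier L'"
      using assms lcs_square_power_closed [of y l] lcs_square_power_closed [of y "Suc l"] by auto
    have "x \<otimes>\<^bsub>L\<^esub> h ((h ^^ l) y) = h ((h ^^ l) y) \<otimes>\<^bsub>L\<^esub> x"
      using assms c by (simp add: L.bracket_commute derived_carrier_closed)
    also have "\<dots> = h ((h ^^ l) y \<otimes>\<^bsub>L\<^esub> x)"
      using assms c by (simp add: lcs_square_bracket derived_carrier_closed)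
    also have "(h ^^ l) y \<otimes>\<^bsub>L\<^esub> x = x \<otimes>\<^bsub>L\<^esub> (h ^^ l) y"
      using assms c by (simp add: L.bracket_commute [of x] derived_carrier_closed)
    finally show ?case using Suc by simp
  qed simp
next
  case (Suc k)
  then show ?case
    using assms by (simp add: lcs_square_bracket lcs_square_power_closed derived_carrier_closed)
qed

lemma lcs_square_power_component:
  "\<lbrakk>x \<in> carrier L'; x \<in> lcs_component n\<rbrakk> \<Longrightarrow> (h ^^ k) x \<in> lcs_component (n + k)"
  by (induction k) (auto simp: lcs_square_component lcs_square_power_closed)

end

section \<open>The homomorphism\<close>

context graph_lie_algebra
begin

text \<open>As \<open>g i\<close> is an involution, the square of \<open>g i \<otimes> x\<close> is
  the commutator of \<open>g i\<close> and \<open>inv x\<close> times the square of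
  \<open>x\<close>; induction along a word makes every square a product of commutators.\<close>

lemma RC_square: "a \<in> carrier G \<Longrightarrow> a \<otimes>\<^bsub>G\<^esub> a \<in> lower_central G (Suc 1)"
proof (induction rule: RC_induct)
  case one
  then show ?case by (simp add: G.lower_central_one)
next
  case (mult i x)
  note c = RC_gen_closed [OF mult(1)] mult(2)
  have inv: "inv\<^bsub>G\<^esub> (g i) = g i"
    using RC_gen_involution [OF mult(1)] c by (intro G.inv_equality)
  have "g i \<in> lower_central G 1" using c by (simp add: One_nat_def)
  then have 1: "group_commutator G (g i) (inv\<^bsub>G\<^esub> x) \<in> lower_central G (Suc 1)"
    using c by (intro G.commutator_Suc) auto
  have "g i \<otimes>\<^bsub>G\<^esub> x \<otimes>\<^bsub>G\<^esub> (g i \<otimes>\<^bsub>G\<^esub> x) = group_commutator G (g i) (inv\<^bsub>G\<^esub> x) \<otimes>\<^bsub>G\<^esub> (x \<otimes>\<^bsub>G\<^esub> x)"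
    using c by (simp add: group_commutator_def inv G.word_simps)
  then show ?case using G.lower_central_mult [OF 1 mult(3)] by simp
qed

sublocale C: lcs_exponent_2 G
  by (rule G.lcs_exponent_2I [OF RC_square])

abbreviation A where "A \<equiv> lcs_lie G"
abbreviation A' where "A' \<equiv> lcs_lie_derived G"
abbreviation gbar where "gbar i \<equiv> lcs_class G 1 (g i)"

lemma RC_gen_lcs: "i \<in> {1..m} \<Longrightarrow> g i \<in> lower_central G 1"
  using RC_gen_closed by (simp add: One_nat_def)

lemma gbar_closed: "i \<in> {1..m} \<Longrightarrow> gbar i \<in> carrier A"
  by (intro G.lcs_class_closed RC_gen_lcs) auto

lemma gbar_commute:
  assumes "{i, j} \<in> K" shows "gbar i \<otimes>\<^bsub>A\<^esub> gbar j = \<zero>\<^bsub>A\<^esub>"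
proof -
  note ij = edge_vertices [OF assms, THEN conjunct1] edge_vertices [OF assms, THEN conjunct2]
  note c = RC_gen_closed [OF ij(1)] RC_gen_closed [OF ij(2)]
  have "group_commutator G (g i) (g j) = inv\<^bsub>G\<^esub> (g j \<otimes>\<^bsub>G\<^esub> g i) \<otimes>\<^bsub>G\<^esub> (g i \<otimes>\<^bsub>G\<^esub> g j)"
    using c by (simp add: group_commutator_def G.word_simps)
  also have "\<dots> = \<one>\<^bsub>G\<^esub>"
    using c by (simp add: RC_gen_commute [OF assms])
  finally show ?thesis
    using ij RC_gen_lcs by (simp add: G.lcs_class_bracket G.lcs_class_one)
qed

text \<open>The description by \<open>THE\<close> requires both existence, from the presentation,
  and uniqueness, from generation by the \<mu>; restriction to the carrier meets the extensionality
  clause.\<close>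

lemma varphi_hom: "lie_algebra_hom Z2 L A (varphi m K)"
  and varphi_mu: "i \<in> {1..m} \<Longrightarrow> varphi m K (mu m K i) = gbar i"
proof -
  obtain f where f: "lie_algebra_hom Z2 L A f" "\<And>i. i \<in> {1..m} \<Longrightarrow> f (mu m K i) = gbar i"
    using graph_lie_hom [OF C.lcs_lie_lie_algebra, of gbar] gbar_closed gbar_commute by blast
  interpret f: lie_algebra_hom Z2 L A f by fact
  let ?P = "\<lambda>f. f \<in> extensional (carrier L) \<and> lie_algebra_hom Z2 L A f \<and>
    (\<forall>i\<in>{1..m}. f (mu m K i) = gbar i)"
  let ?f = "restrict f (carrier L)"
  have "lie_algebra_hom Z2 L A ?f"
    by (intro lie_algebra_hom.intro lie_algebra_hom_axioms.intro L.lie_algebra_axioms C.lcs_lie_lie_algebra)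
      (simp_all add: f.hom_closed f.hom_add f.hom_smult [simplified] f.hom_bracket L.bracket_closed
        L.smult_closed [simplified])
  then have "?P ?f" using f(2) mu_closed by simp
  moreover have "f' = ?f" if "?P f'" for f'
    using that graph_lie_hom_unique [of A f' f] f
    by (intro extensionalityI [of _ "carrier L"]) auto
  ultimately have "?P (varphi m K)"
    unfolding varphi_def by (rule theI)
  then show "lie_algebra_hom Z2 L A (varphi m K)"
    and "i \<in> {1..m} \<Longrightarrow> varphi m K (mu m K i) = gbar i" by auto
qed

abbreviation \<phi> where "\<phi> \<equiv> varphi m K"

sublocale \<phi>: lie_algebra_hom Z2 L A \<phi>
  by (rule varphi_hom)

lemma varphi_component: "x \<in> D n \<Longrightarrow> \<phi> x \<in> C.lcs_component n"
proof -
  assume "x \<in> D n"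
  then have "homogeneous Z2 L (mu m K ` {1..m}) n x"
    by (simp add: graph_lie_component_def)
  then show ?thesis
  proof induction
    case (gen x)
    then show ?case using varphi_mu C.class_component [OF _ RC_gen_lcs] by auto
  next
    case (zero n)
    then show ?case by (simp add: lie_algebra_hom_zero [OF varphi_hom] C.zero_component)
  next
    case (add n x y)
    then show ?case
      using L.homogeneous_carrier [OF _ mu_subset] by (simp add: \<phi>.hom_add C.add_component)
  next
    case (smult r n x)
    moreover from this have "x \<in> carrier L"
      using L.homogeneous_carrier [OF _ mu_subset] by simp
    ultimately show ?case
      using L.smult_Z2 [of x r] by (auto simp: lie_algebra_hom_zero [OF varphi_hom] C.zero_component)
  next
    case (bracket i x j y)
    then show ?case
      using L.homogeneous_carrier [OF _ mu_subset] by (simp add: \<phi>.hom_bracket C.bracket_component)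
  qed
qed

text \<open>The component relation is reflexive, so \<open>j\<close> cannot be
  \<open>Max J\<close>.\<close>

lemma Theta_max: "finite J \<Longrightarrow> j \<in> Theta K J \<Longrightarrow> j \<in> J \<and> Max J \<in> J - {j}"
  by (auto simp: Theta_def same_component_def intro!: Max_in)

text \<open>A generator for \<open>J\<close> has degree \<open>card J\<close>, which is at least 2
  since \<open>J\<close> contains both \<open>j\<close> and \<open>Max J\<close>; the preimage of
  the commutator subalgebra is a subalgebra.\<close>

lemma varphi_N_derived: "x \<in> carrier N \<Longrightarrow> \<phi> x \<in> carrier A'"
proof -
  let ?H = "{x \<in> carrier L. \<phi> x \<in> carrier A'}"
  have "submodule ?H Z2 L"
    using C.L'.a_closed C.L'.zero_closed
    by (intro L.Z2_submoduleI) (auto simp: \<phi>.hom_add lie_algebra_hom_zero [OF varphi_hom])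
  then have "lie_subalgebra Z2 L ?H"
    using C.L'.bracket_closed by (auto simp: lie_subalgebra_def \<phi>.hom_bracket L.bracket_closed)
  moreover have "GPTW m K \<subseteq> ?H"
  proof
    fix x assume x: "x \<in> GPTW m K"
    then obtain J j where J: "J \<subseteq> {1..m}" "j \<in> Theta K J"
      and x': "x = nested_bracket L (mu m K) (J - {j}) (mu m K j)"
      by (auto simp: GPTW_def)
    have fin: "finite J" using J(1) finite_subset by blast
    have j: "j \<in> J" "Max J \<in> J - {j}" using Theta_max [OF fin J(2)] by auto
    let ?ts = "sorted_list_of_set (J - {j})"
    have "Max J \<in> set ?ts" using fin j by simp
    then have ts: "?ts \<noteq> []" by auto
    have "x \<in> D (length ?ts + 1)"
      unfolding x' nested_bracket_def using fin J j
      by (intro nested_bracket_component mu_component) auto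
    moreover have "2 \<le> length ?ts + 1" using ts by (cases ?ts) auto
    ultimately have "\<phi> x \<in> carrier A'"
      using varphi_component C.component_derived by blast
    then show "x \<in> ?H" using x GPTW_closed by auto
  qed
  ultimately have "carrier N \<subseteq> ?H" by (rule N_minimal)
  then show "x \<in> carrier N \<Longrightarrow> \<phi> x \<in> carrier A'" by blast
qed

section \<open>The map on polynomials\<close>

abbreviation sq where "sq \<equiv> lcs_square G"

definition psi :: "(nat \<Rightarrow> (int, nat) lie_term set set) \<Rightarrow> nat \<Rightarrow> nat word set set" where
  "psi p = (\<Oplus>\<^bsub>A'\<^esub>k\<in>{k. p k \<noteq> \<zero>\<^bsub>N\<^esub>}. (sq ^^ k) (\<phi> (p k)))"

lemma psi_term_closed: "p \<in> up N \<Longrightarrow> (sq ^^ k) (\<phi> (p k)) \<in> carrier A'"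
  by (intro C.lcs_square_power_closed varphi_N_derived) auto

text \<open>\<open>\<phi>\<close> and the powers of \<open>h\<close> annihilate zero, so two
  polynomials can be summed over one common index set.\<close>

lemma psi_superset:
  assumes "p \<in> up N" "finite B" "{k. p k \<noteq> \<zero>\<^bsub>N\<^esub>} \<subseteq> B"
  shows "psi p = (\<Oplus>\<^bsub>A'\<^esub>k\<in>B. (sq ^^ k) (\<phi> (p k)))"
  unfolding psi_def
  using assms(2,3) psi_term_closed [OF assms(1)]
  by (intro C.L'.add.finprod_mono_neutral_cong_left)
    (auto simp: lie_algebra_hom_zero [OF varphi_hom] C.lcs_square_power_zero)

lemma psi_closed: "p \<in> up N \<Longrightarrow> psi p \<in> carrier A'"
  unfolding psi_def using psi_term_closed by (intro C.L'.finsum_closed) auto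

lemma psi_add:
  assumes "p \<in> up N" "q \<in> up N"
  shows "psi (p \<oplus>\<^bsub>lie_poly N\<^esub> q) = psi p \<oplus>\<^bsub>A'\<^esub> psi q"
proof -
  let ?B = "{k. p k \<noteq> \<zero>\<^bsub>N\<^esub>} \<union> {k. q k \<noteq> \<zero>\<^bsub>N\<^esub>}"
  have fin: "finite ?B" using assms up_finite_support by blast
  have c: "p k \<in> carrier N" "q k \<in> carrier N" for k using assms by auto
  have "psi (p \<oplus>\<^bsub>lie_poly N\<^esub> q) = (\<Oplus>\<^bsub>A'\<^esub>k\<in>?B. (sq ^^ k) (\<phi> ((p \<oplus>\<^bsub>lie_poly N\<^esub> q) k)))"
    using assms N.up_add c by (intro psi_superset fin) (auto simp: lie_poly_add simp del: N_simps)
  also have "\<dots> = (\<Oplus>\<^bsub>A'\<^esub>k\<in>?B. (sq ^^ k) (\<phi> (p k)) \<oplus>\<^bsub>A'\<^esub> (sq ^^ k) (\<phi> (q k)))"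
  proof (rule C.L'.finsum_cong')
    show "(\<lambda>k. (sq ^^ k) (\<phi> (p k)) \<oplus>\<^bsub>A'\<^esub> (sq ^^ k) (\<phi> (q k))) \<in> ?B \<rightarrow> carrier A'"
      using assms psi_term_closed C.L'.a_closed by blast
    show "(sq ^^ k) (\<phi> ((p \<oplus>\<^bsub>lie_poly N\<^esub> q) k)) = (sq ^^ k) (\<phi> (p k)) \<oplus>\<^bsub>A'\<^esub> (sq ^^ k) (\<phi> (q k))" for k
      using assms c [of k] N_closed(1)
      by (simp add: lie_poly_add subset_iff \<phi>.hom_add C.lcs_square_power_add varphi_N_derived)
  qed simp
  also have "\<dots> = (\<Oplus>\<^bsub>A'\<^esub>k\<in>?B. (sq ^^ k) (\<phi> (p k))) \<oplus>\<^bsub>A'\<^esub> (\<Oplus>\<^bsub>A'\<^esub>k\<in>?B. (sq ^^ k) (\<phi> (q k)))"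
    using assms psi_term_closed by (intro C.L'.finsum_addf) auto
  also have "\<dots> = psi p \<oplus>\<^bsub>A'\<^esub> psi q"
    using assms fin by (simp add: psi_superset [of _ ?B])
  finally show ?thesis .
qed

lemma psi_monom:
  assumes "x \<in> carrier N" shows "psi (up_ring.monom (UP N) x k) = (sq ^^ k) (\<phi> x)"
proof -
  have c: "(sq ^^ k) (\<phi> x) \<in> carrier A'"
    using assms by (intro C.lcs_square_power_closed varphi_N_derived)
  have "psi (up_ring.monom (UP N) x k) = (\<Oplus>\<^bsub>A'\<^esub>i\<in>{k}. (sq ^^ i) (\<phi> (if i = k then x else \<zero>\<^bsub>N\<^esub>)))"
    using assms N.up_monom by (subst psi_superset [of _ "{k}"]) (auto simp: monom_UP simp del: N_simps)
  then show ?thesis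
    using c C.derived_carrier_closed [OF c] by (simp add: C.L'.finsum_insert)
qed

lemma psi_hom: "lie_algebra_hom Z2 (lie_poly N) A' psi"
proof (rule lie_algebra_hom_Z2I [OF N.lie_poly_lie_algebra C.L'.lie_algebra_axioms])
  let ?S = "{up_ring.monom (UP N) x k | x k. x \<in> carrier N}"
  show "?S \<subseteq> carrier (lie_poly N)"
    using N.up_monom by (auto simp: monom_UP simp del: N_simps)
  show "carrier (lie_poly N) \<subseteq> add_span (lie_poly N) ?S"
    using N.lie_poly_span by simp
  fix p q assume "p \<in> ?S" "q \<in> ?S"
  then obtain x k y l where pq: "p = up_ring.monom (UP N) x k" "q = up_ring.monom (UP N) y l"
    and x: "x \<in> carrier N" and y: "y \<in> carrier N" by blast
  have xy: "x \<otimes>\<^bsub>N\<^esub> y \<in> carrier N" "x \<in> carrier L" "y \<in> carrier L"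
    using x y N.bracket_closed N_closed(1) by auto
  have "psi (p \<otimes>\<^bsub>lie_poly N\<^esub> q) = (sq ^^ (k + l)) (\<phi> (x \<otimes>\<^bsub>N\<^esub> y))"
    unfolding pq using x y xy by (simp only: N.monom_bracket psi_monom)
  also have "\<dots> = (sq ^^ k) (\<phi> x) \<otimes>\<^bsub>A'\<^esub> (sq ^^ l) (\<phi> y)"
    using x y xy by (simp add: \<phi>.hom_bracket C.lcs_square_power_bracket varphi_N_derived)
  finally show "psi (p \<otimes>\<^bsub>lie_poly N\<^esub> q) = psi p \<otimes>\<^bsub>A'\<^esub> psi q"
    unfolding pq by (simp only: psi_monom x y)
next
  show "psi (p \<oplus>\<^bsub>lie_poly N\<^esub> q) = psi p \<oplus>\<^bsub>A'\<^esub> psi q"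
    if "p \<in> carrier (lie_poly N)" "q \<in> carrier (lie_poly N)" for p q
    using that psi_add by simp
qed (simp add: psi_closed)

text \<open>\<open>\<phi>\<close> preserves degree, and every squaring raises it by one, just as t
  does.\<close>

lemma psi_degree:
  assumes "p \<in> lie_poly_component N (N_component m K) n"
  shows "psi p \<in> lcs_derived_component G n"
proof -
  have p: "p \<in> up N" "\<And>k. k \<le> n \<Longrightarrow> p k \<in> N_component m K (n - k)" "\<And>k. \<not> k \<le> n \<Longrightarrow> p k = \<zero>\<^bsub>N\<^esub>"
    using assms by (auto simp: lie_poly_component_def split: if_splits)
  have sub: "submodule (lcs_derived_component G n) Z2 A'"
    using C.derived_graded by (rule graded_lie_algebra.component_submodule)
  have "(sq ^^ k) (\<phi> (p k)) \<in> lcs_derived_component G n" for k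
  proof (cases "k \<le> n")
    case True
    then have pk: "p k \<in> carrier N" "p k \<in> D (n - k)"
      using p(2) by (auto simp: N_component_def)
    then have "(sq ^^ k) (\<phi> (p k)) \<in> C.lcs_component (n - k + k)"
      by (intro C.lcs_square_power_component varphi_N_derived varphi_component)
    then show ?thesis
      using True psi_term_closed [OF p(1)] by (simp add: C.derived_component_iff)
  next
    case False
    then have "(sq ^^ k) (\<phi> (p k)) = \<zero>\<^bsub>A'\<^esub>"
      using p(3) by (simp add: lie_algebra_hom_zero [OF varphi_hom] C.lcs_square_power_zero)
    then show ?thesis using C.L'.submodule_zero [OF sub] by simp
  qed
  then show ?thesis
    unfolding psi_def by (intro C.L'.submodule_finsum [OF sub] up_finite_support p(1))
qed

end

section \<open>Surjectivity\<close>

context graph_lie_algebra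
begin

abbreviation ad where "ad ws x \<equiv> foldr (\<lambda>i y. gbar i \<otimes>\<^bsub>A\<^esub> y) ws x"

lemma ad_closed: "\<lbrakk>set ws \<subseteq> {1..m}; x \<in> carrier A\<rbrakk> \<Longrightarrow> ad ws x \<in> carrier A"
  by (induction ws) (auto intro!: G.lcs_lie_bracket_closed gbar_closed)

lemma ad_add: "\<lbrakk>set ws \<subseteq> {1..m}; x \<in> carrier A; y \<in> carrier A\<rbrakk> \<Longrightarrow>
    ad ws (x \<oplus>\<^bsub>A\<^esub> y) = ad ws x \<oplus>\<^bsub>A\<^esub> ad ws y"
  by (induction ws) (simp_all add: gbar_closed ad_closed C.L.bracket_add_right)

lemma ad_zero: "set ws \<subseteq> {1..m} \<Longrightarrow> ad ws \<zero>\<^bsub>A\<^esub> = \<zero>\<^bsub>A\<^esub>"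
  by (induction ws) (simp_all add: gbar_closed C.L.bracket_zero_right)

lemma gbar_component: "i \<in> {1..m} \<Longrightarrow> gbar i \<in> C.lcs_component 1"
  by (intro C.class_component RC_gen_lcs) auto

lemma ad_component: "\<lbrakk>set ws \<subseteq> {1..m}; x \<in> C.lcs_component n\<rbrakk> \<Longrightarrow> ad ws x \<in> C.lcs_component (n + length ws)"
proof (induction ws)
  case (Cons i ws)
  then show ?case
    using C.bracket_component [OF gbar_component [of i], of _ "n + length ws"]
    by (simp add: plus_1_eq_Suc)
qed simp

lemma gbar_twice:
  assumes "i \<in> {1..m}" "x \<in> C.lcs_component n" "1 \<le> n"
  shows "gbar i \<otimes>\<^bsub>A\<^esub> (gbar i \<otimes>\<^bsub>A\<^esub> x) = sq (gbar i \<otimes>\<^bsub>A\<^esub> x)"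
proof -
  obtain a where "a \<in> lower_central G n" "x = lcs_class G n a"
    using C.lcs_component_class assms by blast
  then show ?thesis
    using assms C.involution_bracket_twice [OF RC_gen_closed RC_gen_involution] by simp
qed

text \<open>Modulo this subspace of the degree \<open>n\<close> part of \<open>L'\<close> the operators \<open>ad g\<^sub>i\<close> commute and satisfy
  \<open>(ad g\<^sub>i)\<^sup>2 = 0\<close> on \<open>L'\<close>.\<close>

definition decomposables :: "nat \<Rightarrow> (nat \<Rightarrow> nat word set set) set" where
  "decomposables n = add_span A
    ({x \<otimes>\<^bsub>A\<^esub> y | x y i j. 2 \<le> i \<and> 2 \<le> j \<and> i + j = n \<and> x \<in> C.lcs_component i \<and> y \<in> C.lcs_component j} \<union>
     {sq x | x k. 2 \<le> k \<and> Suc k = n \<and> x \<in> C.lcs_component k})"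

lemma decomposables_bracket:
  "\<lbrakk>2 \<le> i; 2 \<le> j; x \<in> C.lcs_component i; y \<in> C.lcs_component j\<rbrakk> \<Longrightarrow> x \<otimes>\<^bsub>A\<^esub> y \<in> decomposables (i + j)"
  unfolding decomposables_def by (rule add_span.base) blast

lemma decomposables_square: "\<lbrakk>2 \<le> k; x \<in> C.lcs_component k\<rbrakk> \<Longrightarrow> sq x \<in> decomposables (Suc k)"
  unfolding decomposables_def by (rule add_span.base) blast

lemma decomposables_zero: "\<zero>\<^bsub>A\<^esub> \<in> decomposables n"
  and decomposables_add: "\<lbrakk>x \<in> decomposables n; y \<in> decomposables n\<rbrakk> \<Longrightarrow> x \<oplus>\<^bsub>A\<^esub> y \<in> decomposables n"
  unfolding decomposables_def by (rule add_span.zero, rule add_span.add)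

lemma decomposables_induct [consumes 1, case_names zero bracket square add]:
  assumes "x \<in> decomposables n" "P \<zero>\<^bsub>A\<^esub>"
    and "\<And>x y i j. \<lbrakk>2 \<le> i; 2 \<le> j; i + j = n; x \<in> C.lcs_component i; y \<in> C.lcs_component j\<rbrakk> \<Longrightarrow> P (x \<otimes>\<^bsub>A\<^esub> y)"
    and "\<And>x k. \<lbrakk>2 \<le> k; Suc k = n; x \<in> C.lcs_component k\<rbrakk> \<Longrightarrow> P (sq x)"
    and "\<And>x y. \<lbrakk>x \<in> decomposables n; y \<in> decomposables n; P x; P y\<rbrakk> \<Longrightarrow> P (x \<oplus>\<^bsub>A\<^esub> y)"
  shows "P x"
  using assms(1) unfolding decomposables_def
  by (induction) (use assms(2-5) in \<open>auto simp: decomposables_def\<close>)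

lemma decomposables_closed: "x \<in> decomposables n \<Longrightarrow> x \<in> carrier A"
proof (induction rule: decomposables_induct)
  case (square x k)
  then show ?case
    using C.lcs_square_closed C.derived_carrier_closed C.lcs_component_carrier by blast
qed (auto intro: G.lcs_lie_bracket_closed G.lcs_lie_add_closed C.lcs_component_carrier)

text \<open>Bracketing with a generator is a derivation and commutes with \<open>h\<close> on
  \<open>L'\<close>, so it sends brackets to sums of brackets and squares to squares, one degree up.
  Congruences therefore survive further bracketing.\<close>

lemma decomposables_gbar:
  assumes "x \<in> decomposables n" "i \<in> {1..m}"
  shows "gbar i \<otimes>\<^bsub>A\<^esub> x \<in> decomposables (Suc n)"
  using assms(1)
proof (induction rule: decomposables_induct)
  case zero
  then show ?case using gbar_closed [OF assms(2)] by (simp add: C.L.bracket_zero_right decomposables_zero)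
next
  case (bracket x y k l)
  note c = gbar_closed [OF assms(2)] bracket(4,5) [THEN C.lcs_component_carrier]
  have "gbar i \<otimes>\<^bsub>A\<^esub> x \<in> C.lcs_component (Suc k)" "gbar i \<otimes>\<^bsub>A\<^esub> y \<in> C.lcs_component (Suc l)"
    using C.bracket_component [OF gbar_component [OF assms(2)]] bracket
    by (simp_all add: plus_1_eq_Suc [symmetric] del: plus_1_eq_Suc)
  then have "(gbar i \<otimes>\<^bsub>A\<^esub> x) \<otimes>\<^bsub>A\<^esub> y \<in> decomposables (Suc k + l)" "x \<otimes>\<^bsub>A\<^esub> (gbar i \<otimes>\<^bsub>A\<^esub> y) \<in> decomposables (k + Suc l)"
    using bracket by (intro decomposables_bracket; simp)+
  then show ?case
    using c bracket(3) by (auto simp: C.L.bracket_leibniz [of "gbar i"] intro!: decomposables_add)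
next
  case (square x k)
  have c: "gbar i \<in> carrier A" "x \<in> carrier A" "sq x \<in> carrier A" "x \<in> carrier A'"
    using gbar_closed [OF assms(2)] square C.lcs_component_carrier C.component_derived
      C.lcs_square_closed C.derived_carrier_closed by blast+
  have "gbar i \<otimes>\<^bsub>A\<^esub> sq x = sq (gbar i \<otimes>\<^bsub>A\<^esub> x)"
    using c by (simp add: C.L.bracket_commute [of "gbar i"] C.lcs_square_bracket)
  moreover have "gbar i \<otimes>\<^bsub>A\<^esub> x \<in> C.lcs_component (Suc k)"
    using C.bracket_component [OF gbar_component [OF assms(2)] square(3)] by (simp add: plus_1_eq_Suc)
  ultimately show ?case
    using square decomposables_square [of "Suc k"] by auto
next
  case (add x y)
  then show ?case
    using gbar_closed [OF assms(2)] by (simp add: C.L.bracket_add_right decomposables_closed decomposables_add)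
qed

lemma decomposables_ad:
  "\<lbrakk>x \<in> decomposables n; set ws \<subseteq> {1..m}\<rbrakk> \<Longrightarrow> ad ws x \<in> decomposables (n + length ws)"
  by (induction ws) (auto intro: decomposables_gbar)

section \<open>Congruence modulo decomposables\<close>

definition eqv :: "nat \<Rightarrow> (nat \<Rightarrow> nat word set set) \<Rightarrow> (nat \<Rightarrow> nat word set set) \<Rightarrow> bool" where
  "eqv n x y \<longleftrightarrow> x \<in> carrier A \<and> y \<in> carrier A \<and> x \<oplus>\<^bsub>A\<^esub> y \<in> decomposables n"

lemma eqv_refl: "x \<in> carrier A \<Longrightarrow> eqv n x x"
  by (simp add: eqv_def C.L.add_self decomposables_zero)

lemma eqv_sym: "eqv n x y \<Longrightarrow> eqv n y x"
  by (simp add: eqv_def C.L.a_comm)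

lemma eqv_trans [trans]:
  assumes "eqv n x y" "eqv n y z" shows "eqv n x z"
proof -
  have "(x \<oplus>\<^bsub>A\<^esub> y) \<oplus>\<^bsub>A\<^esub> (y \<oplus>\<^bsub>A\<^esub> z) \<in> decomposables n"
    using assms by (auto simp: eqv_def intro: decomposables_add)
  then show ?thesis
    using assms by (simp add: eqv_def C.L.a_assoc C.L.add_self_left)
qed

lemma eqv_add:
  assumes "eqv n x y" "eqv n x' y'" shows "eqv n (x \<oplus>\<^bsub>A\<^esub> x') (y \<oplus>\<^bsub>A\<^esub> y')"
proof -
  have "(x \<oplus>\<^bsub>A\<^esub> y) \<oplus>\<^bsub>A\<^esub> (x' \<oplus>\<^bsub>A\<^esub> y') \<in> decomposables n"
    using assms by (auto simp: eqv_def intro: decomposables_add)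
  then show ?thesis
    using assms by (simp add: eqv_def C.L.a_ac)
qed

lemma eqv_zero_iff: "eqv n x \<zero>\<^bsub>A\<^esub> \<longleftrightarrow> x \<in> decomposables n"
  using decomposables_closed by (auto simp: eqv_def)

lemma eqv_ad: "\<lbrakk>eqv n x y; set ws \<subseteq> {1..m}\<rbrakk> \<Longrightarrow> eqv (n + length ws) (ad ws x) (ad ws y)"
  using decomposables_ad [of "x \<oplus>\<^bsub>A\<^esub> y" n ws] by (simp add: eqv_def ad_closed ad_add)

text \<open>By the Leibniz rule the difference is the bracket of
  \<open>gbar i \<otimes> gbar j\<close> with \<open>x\<close>; the factors have degrees 2 and
  \<open>n\<close>, both at least 2.\<close>

lemma eqv_swap:
  assumes "i \<in> {1..m}" "j \<in> {1..m}" "x \<in> C.lcs_component n" "2 \<le> n"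
  shows "eqv (Suc (Suc n)) (ad [i, j] x) (ad [j, i] x)"
proof -
  note c = gbar_closed [OF assms(1)] gbar_closed [OF assms(2)] C.lcs_component_carrier [OF assms(3)]
  have "ad [i, j] x \<oplus>\<^bsub>A\<^esub> ad [j, i] x = (gbar i \<otimes>\<^bsub>A\<^esub> gbar j) \<otimes>\<^bsub>A\<^esub> x"
    using c C.L.bracket_leibniz [of "gbar i" "gbar j" x]
    by (simp add: C.L.a_assoc C.L.add_self C.L.bracket_closed)
  moreover have "gbar i \<otimes>\<^bsub>A\<^esub> gbar j \<in> C.lcs_component 2"
    using C.bracket_component [OF gbar_component [OF assms(1)] gbar_component [OF assms(2)]] by simp
  ultimately show ?thesis
    using decomposables_bracket [of 2 n, OF _ assms(4) _ assms(3)] c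
    by (simp add: eqv_def C.L.bracket_closed)
qed

lemma eqv_move_front:
  assumes "set (i # us @ vs) \<subseteq> {1..m}" "x \<in> C.lcs_component n" "2 \<le> n"
  shows "eqv (n + length (i # us @ vs)) (ad (us @ i # vs) x) (ad (i # us @ vs) x)"
  using assms(1)
proof (induction us)
  case Nil
  then show ?case using assms C.lcs_component_carrier by (auto intro!: eqv_refl ad_closed [of "i # vs", simplified])
next
  case (Cons u us)
  have z: "ad (us @ vs) x \<in> C.lcs_component (n + length (us @ vs))"
    using Cons.prems assms(2) by (intro ad_component) auto
  have "eqv (n + length (i # us @ vs) + length [u]) (ad [u] (ad (us @ i # vs) x)) (ad [u] (ad (i # us @ vs) x))"
    using Cons by (intro eqv_ad) auto
  moreover have "eqv (Suc (Suc (n + length (us @ vs)))) (ad [u, i] (ad (us @ vs) x)) (ad [i, u] (ad (us @ vs) x))"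
    using Cons.prems assms(3) by (intro eqv_swap z) auto
  ultimately show ?case by (auto intro: eqv_trans)
qed

text \<open>Only operators applied to an element of degree at least 2 are permuted; this is why
  \<open>brk\<close> keeps the two innermost letters apart from the word \<open>ws\<close>.\<close>

lemma eqv_perm:
  assumes "mset ws = mset ws'" "set ws \<subseteq> {1..m}" "x \<in> C.lcs_component n" "2 \<le> n"
  shows "eqv (n + length ws) (ad ws x) (ad ws' x)"
  using assms(1,2)
proof (induction ws arbitrary: ws')
  case Nil
  then show ?case using C.lcs_component_carrier [OF assms(3)] by (simp add: eqv_refl)
next
  case (Cons w ws)
  then obtain us vs where ws': "ws' = us @ w # vs"
    by (metis list.set_intros(1) mset_eq_setD split_list)
  have m: "mset ws = mset (us @ vs)" using Cons.prems(1) by (simp add: ws')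
  have s: "set (w # us @ vs) \<subseteq> {1..m}" using Cons.prems mset_eq_setD [OF m] by auto
  have l: "length ws = length (us @ vs)" using m mset_eq_length by blast
  have "eqv (n + length ws + length [w]) (ad [w] (ad ws x)) (ad [w] (ad (us @ vs) x))"
    using Cons.IH [OF m] Cons.prems(2) by (intro eqv_ad) auto
  moreover have "eqv (n + length (w # us @ vs)) (ad (w # us @ vs) x) (ad ws' x)"
    unfolding ws' by (intro eqv_sym [OF eqv_move_front] s assms)
  ultimately show ?case using l by (auto intro: eqv_trans)
qed

section \<open>Iterated brackets of generators with a distinguished innermost pair\<close>

abbreviation brk where "brk ws a b \<equiv> ad ws (gbar a \<otimes>\<^bsub>A\<^esub> gbar b)"

lemma pair_component: "\<lbrakk>a \<in> {1..m}; b \<in> {1..m}\<rbrakk> \<Longrightarrow> gbar a \<otimes>\<^bsub>A\<^esub> gbar b \<in> C.lcs_component 2"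
  using C.bracket_component [OF gbar_component gbar_component, of a b] by simp

lemma brk_closed: "\<lbrakk>set ws \<subseteq> {1..m}; a \<in> {1..m}; b \<in> {1..m}\<rbrakk> \<Longrightarrow> brk ws a b \<in> carrier A"
  by (intro ad_closed G.lcs_lie_bracket_closed gbar_closed)

lemma brk_commute: "\<lbrakk>a \<in> {1..m}; b \<in> {1..m}\<rbrakk> \<Longrightarrow> brk ws a b = brk ws b a"
  using C.L.bracket_commute [OF gbar_closed gbar_closed, of a b] by simp

lemma brk_perm:
  "\<lbrakk>mset ws = mset ws'; set ws \<subseteq> {1..m}; a \<in> {1..m}; b \<in> {1..m}\<rbrakk> \<Longrightarrow>
    eqv (length ws + 2) (brk ws a b) (brk ws' a b)"
  using eqv_perm [OF _ _ pair_component, of ws ws' a b] by (simp add: add.commute)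

text \<open>The repeated letter is moved next to the innermost pair, where [g_a, [g_a, g_b]] is the
  square of [g_a, g_b].\<close>

lemma brk_repeated_inner:
  assumes "set ws \<subseteq> {1..m}" "a \<in> {1..m}" "b \<in> {1..m}" "a \<in> set ws"
  shows "brk ws a b \<in> decomposables (length ws + 2)"
proof -
  obtain us vs where ws: "ws = us @ a # vs" using assms(4) split_list by metis
  have "eqv (length ws + 2) (brk ws a b) (brk ((us @ vs) @ [a]) a b)"
    using assms by (intro brk_perm) (auto simp: ws)
  moreover have "sq (gbar a \<otimes>\<^bsub>A\<^esub> gbar b) \<in> decomposables (Suc 2)"
    using assms by (intro decomposables_square pair_component) auto
  then have "gbar a \<otimes>\<^bsub>A\<^esub> (gbar a \<otimes>\<^bsub>A\<^esub> gbar b) \<in> decomposables (Suc 2)"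
    using gbar_twice [OF assms(2) gbar_component [OF assms(3)]] by simp
  then have "ad (us @ vs) (gbar a \<otimes>\<^bsub>A\<^esub> (gbar a \<otimes>\<^bsub>A\<^esub> gbar b)) \<in> decomposables (Suc 2 + length (us @ vs))"
    using assms by (intro decomposables_ad) (auto simp: ws)
  then have "brk ((us @ vs) @ [a]) a b \<in> decomposables (length ws + 2)"
    by (simp add: ws add.commute numeral_3_eq_3)
  ultimately show ?thesis
    using eqv_trans eqv_zero_iff by blast
qed

lemma brk_not_distinct:
  assumes "set ws \<subseteq> {1..m}" "a \<in> {1..m}" "b \<in> {1..m}" "\<not> distinct (a # b # ws)"
  shows "brk ws a b \<in> decomposables (length ws + 2)"
proof -
  consider "a = b" | "a \<in> set ws" | "b \<in> set ws" | "\<not> distinct ws" using assms(4) by auto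
  then show ?thesis
  proof cases
    case 1
    then show ?thesis
      using assms by (simp add: C.L.bracket_self gbar_closed ad_zero decomposables_zero)
  next
    case 2
    then show ?thesis using assms brk_repeated_inner by blast
  next
    case 3
    then show ?thesis using assms brk_repeated_inner [of ws b a] by (simp add: brk_commute [of a b])
  next
    case 4
    then obtain us y vs zs where ws: "ws = us @ [y] @ vs @ [y] @ zs"
      using not_distinct_decomp by blast
    let ?r = "us @ vs @ zs"
    have s: "set ?r \<subseteq> {1..m}" "y \<in> {1..m}" using assms(1) by (auto simp: ws)
    \<comment> \<open>With both copies of \<open>y\<close> outermost, the double bracket is a square
      by \<open>gbar_twice\<close>.\<close>
    have "eqv (length ws + 2) (brk ws a b) (brk (y # y # ?r) a b)"
      using assms by (intro brk_perm) (auto simp: ws)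
    moreover have r: "brk ?r a b \<in> C.lcs_component (2 + length ?r)"
      using s assms by (intro ad_component pair_component)
    have "brk (y # ?r) a b \<in> C.lcs_component (2 + length (y # ?r))"
      using s assms by (intro ad_component pair_component) auto
    then have "sq (brk (y # ?r) a b) \<in> decomposables (Suc (2 + length (y # ?r)))"
      by (intro decomposables_square) auto
    then have "brk (y # y # ?r) a b \<in> decomposables (length ws + 2)"
      using gbar_twice [OF s(2) r] by (simp add: ws)
    ultimately show ?thesis
      using eqv_trans eqv_zero_iff by blast
  qed
qed

text \<open>An outer letter is moved next to the innermost pair, the Jacobi identity is applied to
  the three innermost letters, and the new third letters are moved out again. The moves, unlike the
  Jacobi identity, are valid only modulo decomposables.\<close>

lemma brk_jacobi:
  assumes "set ws \<subseteq> {1..m}" "a \<in> {1..m}" "b \<in> {1..m}" "c \<in> {1..m}"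
  shows "eqv (length ws + 3) (brk (c # ws) a b) (brk (a # ws) b c \<oplus>\<^bsub>A\<^esub> brk (b # ws) a c)"
proof -
  note g = gbar_closed [OF assms(2)] gbar_closed [OF assms(3)] gbar_closed [OF assms(4)]
  have last: "eqv (length ws + 3) (brk (x # ws) y z) (ad ws (gbar x \<otimes>\<^bsub>A\<^esub> (gbar y \<otimes>\<^bsub>A\<^esub> gbar z)))"
    if "x \<in> {1..m}" "y \<in> {1..m}" "z \<in> {1..m}" for x y z
    using brk_perm [of "x # ws" "ws @ [x]" y z] that assms(1) by (simp add: numeral_3_eq_3)
  have "gbar c \<otimes>\<^bsub>A\<^esub> (gbar a \<otimes>\<^bsub>A\<^esub> gbar b) =
      gbar a \<otimes>\<^bsub>A\<^esub> (gbar b \<otimes>\<^bsub>A\<^esub> gbar c) \<oplus>\<^bsub>A\<^esub> gbar b \<otimes>\<^bsub>A\<^esub> (gbar a \<otimes>\<^bsub>A\<^esub> gbar c)"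
    using C.L.bracket_leibniz [of "gbar c" "gbar a" "gbar b"] g
    by (simp add: C.L.bracket_closed C.L.bracket_commute [of "gbar c"] C.L.bracket_commute [of _ "gbar b"] C.L.a_comm)
  then have "ad ws (gbar c \<otimes>\<^bsub>A\<^esub> (gbar a \<otimes>\<^bsub>A\<^esub> gbar b)) =
      ad ws (gbar a \<otimes>\<^bsub>A\<^esub> (gbar b \<otimes>\<^bsub>A\<^esub> gbar c)) \<oplus>\<^bsub>A\<^esub> ad ws (gbar b \<otimes>\<^bsub>A\<^esub> (gbar a \<otimes>\<^bsub>A\<^esub> gbar c))"
    using g assms(1) by (simp add: ad_add C.L.bracket_closed)
  then show ?thesis
    using last [of c a b] eqv_sym [OF eqv_add [OF last [of a b c] last [of b a c]]] assms
    by (auto intro: eqv_trans)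
qed

section \<open>Closure properties of the image\<close>

abbreviation image_psi where "image_psi \<equiv> psi ` carrier (lie_poly N)"

lemma image_psi_subalgebra: "lie_subalgebra Z2 A' image_psi"
proof -
  interpret \<psi>: lie_algebra_hom Z2 "lie_poly N" A' psi by (rule psi_hom)
  have "submodule image_psi Z2 A'"
  proof (rule C.L'.Z2_submoduleI)
    show "image_psi \<subseteq> carrier A'" using \<psi>.hom_closed by blast
    show "\<zero>\<^bsub>A'\<^esub> \<in> image_psi"
      using lie_algebra_hom_zero [OF psi_hom] \<psi>.dom.M.zero_closed by (metis imageI)
    fix x y assume "x \<in> image_psi" "y \<in> image_psi"
    then show "x \<oplus>\<^bsub>A'\<^esub> y \<in> image_psi"
      using \<psi>.dom.M.a_closed by (auto simp: \<psi>.hom_add [symmetric] simp del: lie_poly_simps C.derived_simps)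
  qed
  moreover have "x \<otimes>\<^bsub>A'\<^esub> y \<in> image_psi" if "x \<in> image_psi" "y \<in> image_psi" for x y
    using that \<psi>.dom.bracket_closed
    by (auto simp: \<psi>.hom_bracket [symmetric] simp del: lie_poly_simps C.derived_simps)
  ultimately show ?thesis by (simp add: lie_subalgebra_def)
qed

lemma image_psi_add: "\<lbrakk>x \<in> image_psi; y \<in> image_psi\<rbrakk> \<Longrightarrow> x \<oplus>\<^bsub>A\<^esub> y \<in> image_psi"
  and image_psi_bracket: "\<lbrakk>x \<in> image_psi; y \<in> image_psi\<rbrakk> \<Longrightarrow> x \<otimes>\<^bsub>A\<^esub> y \<in> image_psi"
  and image_psi_zero: "\<zero>\<^bsub>A\<^esub> \<in> image_psi"
  using image_psi_subalgebra C.L'.submodule_add C.L'.submodule_zero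
  by (auto simp: lie_subalgebra_def simp del: lie_poly_simps)

lemma image_psi_N: "x \<in> carrier N \<Longrightarrow> \<phi> x \<in> image_psi"
  using psi_monom [of x 0] N.up_monom [of x 0] by (force simp: monom_UP image_iff)

text \<open>Upstairs, squaring is multiplication by t: the image of a monomial goes to the image of
  the same monomial with exponent raised by one, and additivity of \<open>sq\<close> covers
  sums.\<close>

lemma image_psi_square:
  assumes "x \<in> image_psi" shows "sq x \<in> image_psi"
proof -
  obtain p where p: "p \<in> up N" "x = psi p" using assms by auto
  let ?S = "{up_ring.monom (UP N) x k | x k. x \<in> carrier N}"
  have S: "?S \<subseteq> up N" using N.up_monom by (auto simp: monom_UP simp del: N_simps)
  have up: "p \<in> up N" if "p \<in> add_span (lie_poly N) ?S" for p
    using abelian_2_group.add_span_closed [OF N.lie_poly_abelian that] S by simp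
  have "p \<in> add_span (lie_poly N) ?S" using p N.lie_poly_span by blast
  then have "sq (psi p) \<in> image_psi"
  proof induction
    case zero
    then show ?case
      using lie_algebra_hom_zero [OF psi_hom] image_psi_zero
      by (simp add: C.lcs_square_zero del: lie_poly_simps)
  next
    case (base q)
    then obtain x k where q: "q = up_ring.monom (UP N) x k" "x \<in> carrier N" by blast
    then have "sq (psi q) = psi (up_ring.monom (UP N) x (Suc k))"
      by (simp add: psi_monom)
    moreover have "up_ring.monom (UP N) x (Suc k) \<in> up N" using S q(2) by blast
    ultimately show ?case by simp
  next
    case (add q r)
    then show ?case
      using up C.derived_carrier_closed psi_closed image_psi_add
      by (simp add: psi_add C.lcs_square_add)
  qed
  then show ?thesis by (simp add: p)
qed

text \<open>The factors and the elements being squared have degree at least 2 and less than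
  \<open>n\<close>, so the induction hypothesis applies to each of them.\<close>

lemma decomposables_image:
  assumes IH: "(\<Union>k\<in>{2..<n}. C.lcs_component k) \<subseteq> image_psi"
    and "x \<in> decomposables n"
  shows "x \<in> image_psi"
  using assms(2)
proof (induction rule: decomposables_induct)
  case (bracket x y i j)
  then have "i \<in> {2..<n}" "j \<in> {2..<n}" by auto
  then show ?case using bracket IH by (intro image_psi_bracket) blast+
next
  case (square x k)
  then have "k \<in> {2..<n}" by auto
  then show ?case using square IH by (intro image_psi_square) blast
qed (simp_all add: image_psi_zero image_psi_add del: lie_poly_simps)

lemma varphi_foldr:
  assumes "set ts \<subseteq> {1..m}" "x \<in> carrier L"
  shows "foldr (\<lambda>t y. mu m K t \<otimes>\<^bsub>L\<^esub> y) ts x \<in> carrier L \<and>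
    \<phi> (foldr (\<lambda>t y. mu m K t \<otimes>\<^bsub>L\<^esub> y) ts x) = ad ts (\<phi> x)"
  using assms(1)
  by (induction ts) (simp_all add: assms(2) L.bracket_closed mu_closed \<phi>.hom_bracket varphi_mu)

lemma image_psi_eqv:
  assumes IH: "(\<Union>k\<in>{2..<n}. C.lcs_component k) \<subseteq> image_psi"
    and "eqv n x y" "y \<in> image_psi"
  shows "x \<in> image_psi"
proof -
  have "x \<oplus>\<^bsub>A\<^esub> y \<in> image_psi"
    using decomposables_image [OF IH] assms(2) by (auto simp: eqv_def simp del: lie_poly_simps)
  then have "(x \<oplus>\<^bsub>A\<^esub> y) \<oplus>\<^bsub>A\<^esub> y \<in> image_psi" using assms(3) by (rule image_psi_add)
  then show ?thesis using assms(2) by (simp add: eqv_def C.L.a_assoc C.L.add_self del: lie_poly_simps)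
qed

text \<open>The classes \<open>pair J a b\<close> of the multilinear commutators on \<open>J\<close> form, by the Jacobi identity, a
  cocycle on the complete graph on \<open>J\<close>; it is the coboundary of \<open>potential J\<close>, which is constant on the
  components of \<open>K\<^sub>J\<close> since \<open>pair J\<close> vanishes on edges.\<close>

definition pair :: "nat set \<Rightarrow> nat \<Rightarrow> nat \<Rightarrow> nat \<Rightarrow> nat word set set" where
  "pair J a b = brk (sorted_list_of_set (J - {a, b})) a b"

definition potential :: "nat set \<Rightarrow> nat \<Rightarrow> nat \<Rightarrow> nat word set set" where
  "potential J a = (if a = Max J then \<zero>\<^bsub>A\<^esub> else pair J a (Max J))"

context
  fixes J :: "nat set"
  assumes J: "J \<subseteq> {1..m}" "J \<noteq> {}"
begin

lemma J_finite: "finite J"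
  using J finite_subset by blast

lemma Max_J: "Max J \<in> J"
  using J J_finite by simp

lemma pair_closed: "\<lbrakk>a \<in> J; b \<in> J\<rbrakk> \<Longrightarrow> pair J a b \<in> carrier A"
  unfolding pair_def using J J_finite by (intro brk_closed) auto

lemma pair_commute: "\<lbrakk>a \<in> J; b \<in> J\<rbrakk> \<Longrightarrow> pair J a b = pair J b a"
  unfolding pair_def using J by (subst brk_commute) (auto simp: insert_commute)

lemma potential_closed: "a \<in> J \<Longrightarrow> potential J a \<in> carrier A"
  using Max_J pair_closed by (simp add: potential_def)

text \<open>The order of the outer letters does not matter modulo decomposables, so a multilinear
  bracket depends only on its support and its innermost pair.\<close>

lemma brk_pair:
  assumes "distinct (a # b # ws)" "set (a # b # ws) = J"
  shows "eqv (card J) (brk ws a b) (pair J a b)"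
proof -
  have c: "card J = length ws + 2"
    using distinct_card [OF assms(1)] assms(2) by simp
  have "set ws = J - {a, b}" using assms by auto
  then have "mset ws = mset (sorted_list_of_set (J - {a, b}))"
    using assms(1) mset_set_set [of ws] mset_set_set [of "sorted_list_of_set (J - {a, b})"] J_finite
    by simp
  then show ?thesis
    unfolding pair_def c using assms J by (intro brk_perm) auto
qed

text \<open>Jacobi with \<open>Max J\<close> as the third letter. If \<open>a\<close> or
  \<open>b\<close> is \<open>Max J\<close> itself, its potential is zero and the other one is the
  pair by definition.\<close>

lemma pair_potential:
  assumes "a \<in> J" "b \<in> J" "a \<noteq> b"
  shows "eqv (card J) (pair J a b) (potential J a \<oplus>\<^bsub>A\<^esub> potential J b)"
proof -
  let ?M = "Max J"
  consider "a = ?M" | "b = ?M" | "a \<noteq> ?M" "b \<noteq> ?M" by blast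
  then show ?thesis
  proof cases
    case 1
    then show ?thesis
      using assms pair_closed pair_commute [of a b] by (simp add: potential_def eqv_refl)
  next
    case 2
    then show ?thesis
      using assms pair_closed by (simp add: potential_def eqv_refl)
  next
    case 3
    let ?ws = "sorted_list_of_set (J - {a, b, ?M})"
    have ws: "set ?ws = J - {a, b, ?M}" "distinct ?ws" using J_finite by auto
    have n: "card J = length ?ws + 3"
    proof -
      have "card {a, b, ?M} = 3" using 3 assms(3) by simp
      moreover have "card {a, b, ?M} \<le> card J" using assms Max_J J_finite by (intro card_mono) auto
      ultimately show ?thesis
        using assms Max_J J_finite by (simp add: card_Diff_subset)
    qed
    have "eqv (card J) (pair J a b) (brk (?M # ?ws) a b)"
      using ws 3 assms Max_J by (intro eqv_sym [OF brk_pair]) auto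
    also have "eqv (card J) \<dots> (brk (a # ?ws) b ?M \<oplus>\<^bsub>A\<^esub> brk (b # ?ws) a ?M)"
    proof -
      have "set ?ws \<subseteq> {1..m}" "a \<in> {1..m}" "b \<in> {1..m}" "?M \<in> {1..m}"
        unfolding ws(1) using J(1) assms Max_J by blast+
      from brk_jacobi [OF this] show ?thesis by (simp only: n)
    qed
    also have "eqv (card J) \<dots> (pair J b ?M \<oplus>\<^bsub>A\<^esub> pair J a ?M)"
      using ws 3 assms Max_J by (intro eqv_add brk_pair) auto
    finally show ?thesis
      using 3 assms Max_J pair_closed by (simp add: potential_def C.L.a_comm)
  qed
qed

lemma potential_edge:
  assumes "{a, b} \<in> K" "a \<in> J" "b \<in> J"
  shows "eqv (card J) (potential J a) (potential J b)"
proof (cases "a = b")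
  case True
  then show ?thesis using assms potential_closed by (simp add: eqv_refl)
next
  case False
  have "pair J a b = \<zero>\<^bsub>A\<^esub>"
    unfolding pair_def gbar_commute [OF assms(1)] using J J_finite by (intro ad_zero) auto
  then have "eqv (card J) (potential J a \<oplus>\<^bsub>A\<^esub> potential J b) \<zero>\<^bsub>A\<^esub>"
    using eqv_sym [OF pair_potential [OF assms(2,3) False]] by simp
  then show ?thesis
    using assms potential_closed unfolding eqv_zero_iff eqv_def by simp
qed

text \<open>Edges of the full subcomplex have both ends in \<open>J\<close>, so membership in
  \<open>J\<close> is carried along the path together with the congruence.\<close>

lemma potential_component:
  assumes "(a, b) \<in> same_component (full_subcomplex K J)" "a \<in> J"
  shows "b \<in> J \<and> eqv (card J) (potential J a) (potential J b)"
  using assms(1) unfolding same_component_def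
proof (induction rule: rtrancl_induct)
  case base
  then show ?case using assms(2) potential_closed by (simp add: eqv_refl)
next
  case (step y z)
  then have "{y, z} \<in> K" "y \<in> J" "z \<in> J" by (auto simp: full_subcomplex_def)
  then show ?case using step potential_edge eqv_trans by blast
qed

text \<open>In ascending order \<open>Max J\<close> is the last of the letters other than
  \<open>j\<close>, hence it stands innermost in the generator and forms the innermost pair with
  \<open>j\<close>. So the image of the generator is the potential itself and not merely congruent
  to it.\<close>

lemma GPTW_potential:
  assumes "j \<in> Theta K J" shows "potential J j \<in> image_psi"
proof -
  let ?M = "Max J"
  have j: "j \<in> J" "?M \<noteq> j" using Theta_max [OF J_finite assms] by auto
  let ?ws = "sorted_list_of_set (J - {j, ?M})"
  have "sorted_list_of_set (J - {j}) = ?ws @ [?M]"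
  proof (rule sorted_distinct_set_unique)
    show "sorted (?ws @ [?M])"
      using J_finite by (auto simp: sorted_append)
    show "set (sorted_list_of_set (J - {j})) = set (?ws @ [?M])"
      using J_finite j Max_J by auto
  qed (use J_finite in auto)
  then have "\<phi> (nested_bracket L (mu m K) (J - {j}) (mu m K j)) = ad (?ws @ [?M]) (gbar j)"
    using varphi_foldr [of "?ws @ [?M]" "mu m K j"] J J_finite j Max_J mu_closed varphi_mu
    unfolding nested_bracket_def by (simp add: subset_iff)
  also have "\<dots> = brk ?ws j ?M"
  proof -
    have "j \<in> {1..m}" "?M \<in> {1..m}" using J(1) j(1) Max_J by blast+
    from brk_commute [OF this] show ?thesis by simp
  qed
  also have "\<dots> = potential J j"
    using j by (simp add: potential_def pair_def)
  finally have "\<phi> (nested_bracket L (mu m K) (J - {j}) (mu m K j)) = potential J j" .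
  moreover have "nested_bracket L (mu m K) (J - {j}) (mu m K j) \<in> carrier N"
    using GPTW_subset_N J assms by (auto simp: GPTW_def)
  ultimately show ?thesis using image_psi_N by metis
qed

text \<open>\<open>j\<close> may be replaced by the least vertex of its component. If that component
  contains \<open>Max J\<close>, the potential is congruent to zero; if not, the least vertex
  belongs to \<open>Theta K J\<close>.\<close>

lemma potential_image:
  assumes IH: "(\<Union>k\<in>{2..<card J}. C.lcs_component k) \<subseteq> image_psi"
    and j: "j \<in> J"
  shows "potential J j \<in> image_psi"
proof -
  let ?X = "full_subcomplex K J"
  define B where "B = {i \<in> J. (i, j) \<in> same_component ?X}"
  have refl: "(j, j) \<in> same_component ?X" by (simp add: same_component_def)
  have B: "finite B" "B \<noteq> {}" using J_finite j refl by (auto simp: B_def)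
  let ?j = "Min B"
  have j0: "?j \<in> J" "(?j, j) \<in> same_component ?X" using Min_in [OF B] by (auto simp: B_def)
  have eq: "eqv (card J) (potential J j) (potential J ?j)"
    using potential_component [OF j0(2,1)] eqv_sym by blast
  show ?thesis
  proof (cases "(?j, Max J) \<in> same_component ?X")
    case True
    have "eqv (card J) (potential J ?j) (potential J (Max J))"
      using potential_component [OF True j0(1)] by blast
    then have "eqv (card J) (potential J j) \<zero>\<^bsub>A\<^esub>"
      using eqv_trans [OF eq] by (simp add: potential_def)
    then show ?thesis
      using image_psi_eqv [OF IH] image_psi_zero by blast
  next
    case False
    have "?j \<le> i" if "i \<in> J" "(i, ?j) \<in> same_component ?X" for i
    proof -
      have "(i, j) \<in> same_component ?X"
        using that(2) j0(2) unfolding same_component_def by (rule rtrancl_trans)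
      then show ?thesis using that B by (auto simp: B_def)
    qed
    then have "?j \<in> Theta K J" using j0 False by (auto simp: Theta_def)
    then show ?thesis using image_psi_eqv [OF IH eq] GPTW_potential by blast
  qed
qed

end

text \<open>A repeated letter makes the bracket decomposable; otherwise it is congruent to a sum of
  two potentials.\<close>

lemma brk_image:
  assumes IH: "(\<Union>k\<in>{2..<length ws + 2}. C.lcs_component k) \<subseteq> image_psi"
    and ws: "set ws \<subseteq> {1..m}" "a \<in> {1..m}" "b \<in> {1..m}"
  shows "brk ws a b \<in> image_psi"
proof (cases "distinct (a # b # ws)")
  case False
  then show ?thesis using decomposables_image [OF IH] brk_not_distinct [OF ws] by blast
next
  case True
  define J where "J = set (a # b # ws)"
  have J: "J \<subseteq> {1..m}" "J \<noteq> {}" "a \<in> J" "b \<in> J" using ws by (auto simp: J_def)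
  have n: "card J = length ws + 2" using distinct_card [OF True] by (simp add: J_def)
  have "eqv (card J) (brk ws a b) (pair J a b)"
    using True J by (intro brk_pair) (auto simp: J_def)
  also have "eqv (card J) \<dots> (potential J a \<oplus>\<^bsub>A\<^esub> potential J b)"
    using True J by (intro pair_potential) auto
  finally have "eqv (card J) (brk ws a b) (potential J a \<oplus>\<^bsub>A\<^esub> potential J b)" .
  moreover have "potential J a \<oplus>\<^bsub>A\<^esub> potential J b \<in> image_psi"
    by (intro image_psi_add potential_image J) (simp_all only: n IH)
  ultimately show ?thesis
    using image_psi_eqv IH unfolding n by blast
qed

section \<open>Spanning by iterated brackets of the generators\<close>

definition word_brackets :: "nat \<Rightarrow> (nat \<Rightarrow> nat word set set) set" where
  "word_brackets n = {ad ws (gbar b) | ws b. Suc (length ws) = n \<and> set ws \<subseteq> {1..m} \<and> b \<in> {1..m}}"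

lemma word_bracketsI:
  "\<lbrakk>set ws \<subseteq> {1..m}; b \<in> {1..m}\<rbrakk> \<Longrightarrow> ad ws (gbar b) \<in> word_brackets (Suc (length ws))"
  unfolding word_brackets_def by blast

lemma word_bracketsE:
  assumes "x \<in> word_brackets n"
  obtains ws b where "x = ad ws (gbar b)" "Suc (length ws) = n" "set ws \<subseteq> {1..m}" "b \<in> {1..m}"
  using assms unfolding word_brackets_def by blast

lemma word_brackets_closed: "word_brackets n \<subseteq> carrier A"
  using ad_closed gbar_closed by (auto elim!: word_bracketsE simp del: atLeastAtMost_iff)

lemma class_word_brackets_1: "x \<in> carrier G \<Longrightarrow> lcs_class G 1 x \<in> add_span A (word_brackets 1)"
proof (induction rule: RC_induct)
  case one
  then show ?case by (simp add: G.lcs_class_one add_span.zero)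
next
  case (mult i x)
  have "gbar i \<in> word_brackets 1" using word_bracketsI [of "[]" i] mult(1) by (simp add: One_nat_def)
  then have "gbar i \<oplus>\<^bsub>A\<^esub> lcs_class G 1 x \<in> add_span A (word_brackets 1)"
    by (intro add_span.add [OF add_span.base mult(3)])
  then show ?case
    using mult G.lcs_class_add [of 1 "g i" x] RC_gen_lcs [of i] by (simp add: One_nat_def)
qed

lemma word_brackets_bracket:
  assumes "x \<in> add_span A (word_brackets n)" "y \<in> add_span A (word_brackets 1)"
  shows "x \<otimes>\<^bsub>A\<^esub> y \<in> add_span A (word_brackets (Suc n))"
proof -
  have c: "x \<in> carrier A" if "x \<in> add_span A (word_brackets n)" for x n
    using C.L.add_span_closed [OF that word_brackets_closed] .
  have 1: "x \<otimes>\<^bsub>A\<^esub> gbar i \<in> add_span A (word_brackets (Suc n))" if i: "i \<in> {1..m}" for i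
    using assms(1)
  proof induction
    case zero
    then show ?case using gbar_closed [OF i] by (simp add: C.L.bracket_zero_left add_span.zero)
  next
    case (base x)
    then obtain ws b where ws: "x = ad ws (gbar b)" "Suc (length ws) = n" "set ws \<subseteq> {1..m}" "b \<in> {1..m}"
      by (rule word_bracketsE)
    have eq: "x \<otimes>\<^bsub>A\<^esub> gbar i = ad (i # ws) (gbar b)"
      using ws gbar_closed i ad_closed C.L.bracket_commute [of "gbar i" "ad ws (gbar b)"] by simp
    have "ad (i # ws) (gbar b) \<in> word_brackets (Suc n)"
      using word_bracketsI [of "i # ws" b] ws i by simp
    then show ?case unfolding eq by (rule add_span.base)
  next
    case (add x y)
    then show ?case using gbar_closed [OF i] c by (auto simp: C.L.bracket_add_left intro: add_span.add)
  qed
  show ?thesis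
    using assms(2)
  proof induction
    case zero
    then show ?case using c [OF assms(1)] by (simp add: C.L.bracket_zero_right add_span.zero)
  next
    case (base y)
    then obtain i where "y = gbar i" "i \<in> {1..m}" by (rule word_bracketsE) (simp add: One_nat_def)
    then show ?case using 1 by simp
  next
    case (add y z)
    then show ?case using c [OF assms(1)] c by (auto simp: C.L.bracket_add_right intro: add_span.add)
  qed
qed

text \<open>L(G) is generated in degree 1: each term of the series is generated by commutators with
  an arbitrary group element, whose class in degree 1 is a sum of classes of generators. Inverses do
  not change a class in exponent 2.\<close>

lemma class_word_brackets:
  assumes "1 \<le> n" "x \<in> lower_central G n"
  shows "lcs_class G n x \<in> add_span A (word_brackets n)"
  using assms
proof (induction n arbitrary: x rule: dec_induct)
  case base
  then show ?case using class_word_brackets_1 G.lower_central_carrier by blast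
next
  case (step n)
  let ?S = "{group_commutator G a b | a b. a \<in> lower_central G n \<and> b \<in> carrier G}"
  have S: "group_commutator G a b \<in> lower_central G (Suc n) \<and>
      lcs_class G (Suc n) (group_commutator G a b) \<in> add_span A (word_brackets (Suc n))"
    if "a \<in> lower_central G n" "b \<in> carrier G" for a b
  proof -
    have b: "b \<in> lower_central G 1" using that by (simp add: One_nat_def)
    have "lcs_class G n a \<otimes>\<^bsub>A\<^esub> lcs_class G 1 b \<in> add_span A (word_brackets (Suc n))"
      using that step by (intro word_brackets_bracket class_word_brackets_1) auto
    moreover have "lcs_class G n a \<otimes>\<^bsub>A\<^esub> lcs_class G 1 b = lcs_class G (Suc n) (group_commutator G a b)"
      unfolding Suc_eq_plus1 using that(1) step(1) b by (intro G.lcs_class_bracket) auto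
    ultimately show ?thesis
      using G.commutator_Suc [OF step(1) that] by simp
  qed
  have "x \<in> generate G ?S" using step.prems by (simp add: G.lower_central_Suc_eq [OF step(1)])
  then have "x \<in> lower_central G (Suc n) \<and> lcs_class G (Suc n) x \<in> add_span A (word_brackets (Suc n))"
  proof induction
    case one
    then show ?case by (simp add: G.lower_central_one G.lcs_class_one add_span.zero)
  next
    case (incl h)
    then show ?case using S by blast
  next
    case (inv h)
    then show ?case using S by (auto simp: C.lcs_class_inv G.lower_central_inv)
  next
    case (eng h1 h2)
    then show ?case by (auto simp: G.lcs_class_add G.lower_central_mult intro: add_span.add)
  qed
  then show ?case by blast
qed

lemma component_image: "\<lbrakk>2 \<le> n; x \<in> C.lcs_component n\<rbrakk> \<Longrightarrow> x \<in> image_psi"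
proof (induction n arbitrary: x rule: less_induct)
  case (less n)
  obtain a where a: "a \<in> lower_central G n" "x = lcs_class G n a"
    using C.lcs_component_class [OF less.prems(2)] less.prems(1) by auto
  have "x \<in> add_span A (word_brackets n)"
    unfolding a(2) using a(1) less.prems by (intro class_word_brackets) auto
  then show ?case
  proof induction
    case (base y)
    then obtain ws b where ws: "y = ad ws (gbar b)" "Suc (length ws) = n" "set ws \<subseteq> {1..m}" "b \<in> {1..m}"
      by (rule word_bracketsE)
    \<comment> \<open>Since \<open>n\<close> is at least 2, \<open>ws\<close> is not empty; its last
      letter and \<open>b\<close> form the innermost pair.\<close>
    then obtain us a where us: "ws = us @ [a]"
      using less.prems(1) by (cases ws rule: rev_cases) auto
    have "brk us a b \<in> image_psi"
    proof (rule brk_image)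
      have "C.lcs_component k \<subseteq> image_psi" if "k \<in> {2..<length us + 2}" for k
        using that less.IH [of k] ws(2) us by auto
      then show "(\<Union>k\<in>{2..<length us + 2}. C.lcs_component k) \<subseteq> image_psi" by blast
    qed (use ws us in auto)
    then show ?case using ws us by simp
  qed (simp_all add: image_psi_zero image_psi_add del: lie_poly_simps)
qed

lemma psi_surjective: "image_psi = carrier A'"
proof
  show "image_psi \<subseteq> carrier A'" using psi_closed by auto
  show "carrier A' \<subseteq> image_psi"
  proof
    fix x assume "x \<in> carrier A'"
    then have "x \<in> add_span A {lcs_class G k a | k a. 2 \<le> k \<and> a \<in> lower_central G k}"
      using C.derived_span by blast
    then show "x \<in> image_psi"
    proof induction
      case (base x)
      then obtain k a where "x = lcs_class G k a" "2 \<le> k" "a \<in> lower_central G k" by blast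
      then show ?case using component_image [OF _ C.class_component] by auto
    qed (simp_all add: image_psi_zero image_psi_add del: lie_poly_simps)
  qed
qed

end

theorem theorem4p3:
  fixes m :: nat and K :: "nat set set"
  assumes "flag_complex m K"
  shows "\<exists>\<psi>.
    graded_lie_algebra_hom Z2
      (lie_poly (N_lie m K)) (lie_poly_component (N_lie m K) (N_component m K))
      (lcs_lie_derived (RC m K)) (lcs_derived_component (RC m K)) \<psi> \<and>
    \<psi> ` carrier (lie_poly (N_lie m K)) = carrier (lcs_lie_derived (RC m K)) \<and>
    (\<forall>x\<in>carrier (N_lie m K). \<forall>k.
      \<psi> (monom (UP (N_lie m K)) x k) = (lcs_square (RC m K) ^^ k) (varphi_N m K x))"
proof -
  interpret graph_lie_algebra m K
    using assms by unfold_locales (simp add: flag_complex_def)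
  show ?thesis
  proof (intro exI conjI ballI allI)
    show "graded_lie_algebra_hom Z2 (lie_poly (N_lie m K)) (lie_poly_component (N_lie m K) (N_component m K))
        (lcs_lie_derived (RC m K)) (lcs_derived_component (RC m K)) psi"
      by (intro graded_lie_algebra_hom.intro graded_lie_algebra_hom_axioms.intro
          psi_hom N_poly_graded C.derived_graded psi_degree)
    show "psi ` carrier (lie_poly (N_lie m K)) = carrier (lcs_lie_derived (RC m K))"
      by (rule psi_surjective)
    show "psi (monom (UP (N_lie m K)) x k) = (lcs_square (RC m K) ^^ k) (varphi_N m K x)"
      if "x \<in> carrier (N_lie m K)" for x k
      using that psi_monom by (simp add: varphi_N_def)
  qed
qed

end
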